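(* Let $[u,v]\subset S_n$ be a Bruhat interval, let $I$ be a diamond-closed order ideal of $[u,v]$, and let $x\in I$. Assume there is a hypercube cluster at $x$ relative to $I$ which is strong and satisfies property (E). Then \[ \widetilde{R}_{x,v,I} = \sum_{\substack{Y\in\mathcal{A}_x \\ \theta_x(Y)=v}}q^{|Y|}. \]
   Context: $S_n$: symmetric group, simple reflections $s_i=(i\;i+1)$, length $\ell$, reflections = transpositions. Bruhat graph $\Gamma$: vertices $S_n$, edge $x\to y$ labelled by $yx^{-1}$ when $yx^{-1}$ is a reflection and $\ell(x)<\ell(y)$; Bruhat order $x\le y$ iff there is a directed path. $\Gamma(u,v)$: induced subgraph on $[u,v]$; $\ell(u,v)=\ell(v)-\ell(u)$. Hypercubes: an $m$-hypercube in $\Gamma(u,v)$ is a subgraph isomorphic to the upward directed Hasse diagram of a rank-$m$ Boolean lattice, spanned by the endpoints of edges leaving its bottom vertex; a diamond is a $2$-hypercube; $I$ is diamond-closed if it contains the fourth vertex of any diamond in $\Gamma(u,v)$ of which it contains three vertices. For $x\in I$: $\mathcal{Y}_x=\{y\in[u,v]\setminus I : x\to y\}$, $\mathcal{A}_x$ the antichains (including $\varnothing$) in $(\mathcal{Y}_x,\le)$. Hypercube cluster at $x$: for each $Y\in\mathcal{A}_x$ a unique hypercube in $\Gamma(u,v)$ with bottom $x$ spanned by $Y$, with top $\theta_x(Y)$. Strong: for all $Y_1,Y_2\in\mathcal{A}_x$ with $|Y_1|=|Y_2|=|Y_1\cap Y_2|+1$, if there is $w$ with edges $\theta_x(Y_1\cap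 Y_2)\to\theta_x(Y_i)\to w$ ($i=1,2$) in $\Gamma(u,v)$, then $Y_1\cup Y_2$ is an antichain and $\theta_x(Y_1\cup Y_2)=w$. A reflection order is a total order $\prec$ on the transpositions such that for all $1\le a<b<c\le n$ either $(a\,b)\prec(a\,c)\prec(b\,c)$ or $(b\,c)\prec(a\,c)\prec(a\,b)$. Property (E) for the cluster at $x$: there is a reflection order $\prec$ such that whenever $x_1\xrightarrow{t_1}x_2$ and $x_3\xrightarrow{t_2}y$ are edges of $\Gamma$ with $x_1,x_2,x_3\in I\cap[x,v]$ and $y\in[x,v]\setminus I$, then $t_1\prec t_2$. $R$-polynomials: $R_{u,v}=0$ if $u\not\le v$, $R_{u,u}=1$, and for $u<v$ and simple $s$ with $sv<v$: $R_{u,v}=R_{su,sv}$ if $su<u$, else $(q-1)R_{u,sv}+qR_{su,sv}$. $\widetilde R_{u,v}$ is the polynomial with $R_{u,v}(q)=q^{\ell(u,v)/2}\widetilde{R}_{u,v}(q^{1/2}-q^{-1/2})$. For a nonempty order ideal $K$ of $[a,b]$, the relative $\widetilde R$-polynomial is $\widetilde{R}_{a,b,K}=\sum_{y\in K}\widetilde{R}_{a,y}(-q)\,\widetilde{R}_{y,b}(q)$; for $a,b\in[u,v]$, $\widetilde R_{a,b,I}$ means $\widetilde R_{a,b,I\cap[a,b]}$. *)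

theory Defs
  imports
    "HOL-Combinatorics.Permutations"
    "HOL-Computational_Algebra.Polynomial"
    "HOL-Computational_Algebra.Formal_Laurent_Series"
    "Graph_Theory.Pair_Digraph"
    "Graph_Theory.Digraph_Isomorphism"
begin

section \<open>The symmetric group and its Bruhat graph\<close>

text \<open>
  Permutations of \<open>{1..n}\<close> are functions on \<open>nat\<close> fixing everything outside \<open>{1..n}\<close>;
  the product \<open>x y\<close> of the group is the composition \<open>x \<circ> y\<close>.
\<close>

definition symgrp :: "nat \<Rightarrow> (nat \<Rightarrow> nat) set" where
  "symgrp n = {w. w permutes {1..n}}"

definition simple_refl :: "nat \<Rightarrow> nat \<Rightarrow> nat" where
  "simple_refl i = transpose i (i + 1)"

definition reflections :: "nat \<Rightarrow> (nat \<Rightarrow> nat) set" where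
  "reflections n = {transpose a b | a b. 1 \<le> a \<and> a < b \<and> b \<le> n}"

text \<open>The Coxeter length: the least length of a word in the simple reflections representing \<open>w\<close>.\<close>

definition len :: "nat \<Rightarrow> (nat \<Rightarrow> nat) \<Rightarrow> nat" where
  "len n w = (LEAST k. \<exists>is. length is = k \<and> set is \<subseteq> {1..<n} \<and>
                            w = foldr (\<circ>) (map simple_refl is) id)"

definition bruhat_graph :: "nat \<Rightarrow> (nat \<Rightarrow> nat, (nat \<Rightarrow> nat) \<times> (nat \<Rightarrow> nat)) pre_digraph" where
  "bruhat_graph n = with_proj
     \<lparr> pverts = symgrp n,
       parcs = {(x, y). x \<in> symgrp n \<and> y \<in> symgrp n \<and>
                        y \<circ> inv x \<in> reflections n \<and> len n x < len n y} \<rparr>"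

definition edge_label :: "(nat \<Rightarrow> nat) \<Rightarrow> (nat \<Rightarrow> nat) \<Rightarrow> nat \<Rightarrow> nat" where
  "edge_label x y = y \<circ> inv x"

definition bruhat_le :: "nat \<Rightarrow> (nat \<Rightarrow> nat) \<Rightarrow> (nat \<Rightarrow> nat) \<Rightarrow> bool" where
  "bruhat_le n x y \<longleftrightarrow> x \<rightarrow>\<^sup>*\<^bsub>bruhat_graph n\<^esub> y"

definition bruhat_less :: "nat \<Rightarrow> (nat \<Rightarrow> nat) \<Rightarrow> (nat \<Rightarrow> nat) \<Rightarrow> bool" where
  "bruhat_less n x y \<longleftrightarrow> bruhat_le n x y \<and> x \<noteq> y"

definition interval :: "nat \<Rightarrow> (nat \<Rightarrow> nat) \<Rightarrow> (nat \<Rightarrow> nat) \<Rightarrow> (nat \<Rightarrow> nat) set" where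
  "interval n u v = {w. bruhat_le n u w \<and> bruhat_le n w v}"

definition interval_graph ::
  "nat \<Rightarrow> (nat \<Rightarrow> nat) \<Rightarrow> (nat \<Rightarrow> nat) \<Rightarrow> (nat \<Rightarrow> nat, (nat \<Rightarrow> nat) \<times> (nat \<Rightarrow> nat)) pre_digraph" where
  "interval_graph n u v = bruhat_graph n \<restriction> interval n u v"

definition order_ideal ::
  "nat \<Rightarrow> (nat \<Rightarrow> nat) \<Rightarrow> (nat \<Rightarrow> nat) \<Rightarrow> (nat \<Rightarrow> nat) set \<Rightarrow> bool" where
  "order_ideal n u v I \<longleftrightarrow> I \<subseteq> interval n u v \<and>
     (\<forall>y\<in>I. \<forall>x\<in>interval n u v. bruhat_le n x y \<longrightarrow> x \<in> I)"

section \<open>Hypercubes\<close>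

definition boolean_hasse :: "nat \<Rightarrow> (nat set, nat set \<times> nat set) pre_digraph" where
  "boolean_hasse m = with_proj
     \<lparr> pverts = Pow {..<m},
       parcs = {(A, insert i A) | A i. A \<subseteq> {..<m} \<and> i < m \<and> i \<notin> A} \<rparr>"

text \<open>
  Subgraphs are not required to be induced; a subgraph is a set of vertices together with a set
  of arcs.
\<close>

definition hypercube_in ::
  "('a, 'a \<times> 'a) pre_digraph \<Rightarrow> nat \<Rightarrow> 'a pair_pre_digraph \<Rightarrow> bool" where
  "hypercube_in G m H \<longleftrightarrow> subgraph (with_proj H) G \<and> digraph_iso (boolean_hasse m) (with_proj H)"

definition is_bottom :: "'a pair_pre_digraph \<Rightarrow> 'a \<Rightarrow> bool" where
  "is_bottom H x \<longleftrightarrow> x \<in> pverts H \<and> (\<forall>w\<in>pverts H. x \<rightarrow>\<^sup>*\<^bsub>with_proj H\<^esub> w)"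

definition is_top :: "'a pair_pre_digraph \<Rightarrow> 'a \<Rightarrow> bool" where
  "is_top H z \<longleftrightarrow> z \<in> pverts H \<and> (\<forall>w\<in>pverts H. w \<rightarrow>\<^sup>*\<^bsub>with_proj H\<^esub> z)"

definition hypercube_spanned_by ::
  "('a, 'a \<times> 'a) pre_digraph \<Rightarrow> 'a \<Rightarrow> 'a set \<Rightarrow> 'a pair_pre_digraph \<Rightarrow> bool" where
  "hypercube_spanned_by G x Y H \<longleftrightarrow>
     (\<exists>m. hypercube_in G m H) \<and> is_bottom H x \<and> {y. x \<rightarrow>\<^bsub>with_proj H\<^esub> y} = Y"

definition diamond_closed ::
  "nat \<Rightarrow> (nat \<Rightarrow> nat) \<Rightarrow> (nat \<Rightarrow> nat) \<Rightarrow> (nat \<Rightarrow> nat) set \<Rightarrow> bool" where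
  "diamond_closed n u v I \<longleftrightarrow>
     (\<forall>H. hypercube_in (interval_graph n u v) 2 H \<and> card (pverts H \<inter> I) \<ge> 3 \<longrightarrow> pverts H \<subseteq> I)"

section \<open>Hypercube clusters\<close>

definition out_nbrs ::
  "nat \<Rightarrow> (nat \<Rightarrow> nat) \<Rightarrow> (nat \<Rightarrow> nat) \<Rightarrow> (nat \<Rightarrow> nat) set \<Rightarrow> (nat \<Rightarrow> nat) \<Rightarrow> (nat \<Rightarrow> nat) set" where
  "out_nbrs n u v I x = {y \<in> interval n u v - I. x \<rightarrow>\<^bsub>bruhat_graph n\<^esub> y}"

definition antichains ::
  "nat \<Rightarrow> (nat \<Rightarrow> nat) \<Rightarrow> (nat \<Rightarrow> nat) \<Rightarrow> (nat \<Rightarrow> nat) set \<Rightarrow> (nat \<Rightarrow> nat) \<Rightarrow> (nat \<Rightarrow> nat) set set" where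
  "antichains n u v I x =
     {Y. Y \<subseteq> out_nbrs n u v I x \<and> (\<forall>a\<in>Y. \<forall>b\<in>Y. bruhat_le n a b \<longrightarrow> a = b)}"

definition hypercube_cluster ::
  "nat \<Rightarrow> (nat \<Rightarrow> nat) \<Rightarrow> (nat \<Rightarrow> nat) \<Rightarrow> (nat \<Rightarrow> nat) set \<Rightarrow> (nat \<Rightarrow> nat) \<Rightarrow> bool" where
  "hypercube_cluster n u v I x \<longleftrightarrow>
     (\<forall>Y\<in>antichains n u v I x. \<exists>!H. hypercube_spanned_by (interval_graph n u v) x Y H)"

text \<open>Meaningful when there is exactly one hypercube with bottom \<open>x\<close> spanned by \<open>Y\<close>.\<close>

definition theta ::
  "nat \<Rightarrow> (nat \<Rightarrow> nat) \<Rightarrow> (nat \<Rightarrow> nat) \<Rightarrow> (nat \<Rightarrow> nat) \<Rightarrow> (nat \<Rightarrow> nat) set \<Rightarrow> nat \<Rightarrow> nat" where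
  "theta n u v x Y =
     (THE w. is_top (THE H. hypercube_spanned_by (interval_graph n u v) x Y H) w)"

definition strong_cluster ::
  "nat \<Rightarrow> (nat \<Rightarrow> nat) \<Rightarrow> (nat \<Rightarrow> nat) \<Rightarrow> (nat \<Rightarrow> nat) set \<Rightarrow> (nat \<Rightarrow> nat) \<Rightarrow> bool" where
  "strong_cluster n u v I x \<longleftrightarrow>
     (\<forall>Y1\<in>antichains n u v I x. \<forall>Y2\<in>antichains n u v I x. \<forall>w.
        card Y1 = card Y2 \<and> card Y2 = card (Y1 \<inter> Y2) + 1 \<and>
        theta n u v x (Y1 \<inter> Y2) \<rightarrow>\<^bsub>interval_graph n u v\<^esub> theta n u v x Y1 \<and>
        theta n u v x Y1 \<rightarrow>\<^bsub>interval_graph n u v\<^esub> w \<and>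
        theta n u v x (Y1 \<inter> Y2) \<rightarrow>\<^bsub>interval_graph n u v\<^esub> theta n u v x Y2 \<and>
        theta n u v x Y2 \<rightarrow>\<^bsub>interval_graph n u v\<^esub> w \<longrightarrow>
        Y1 \<union> Y2 \<in> antichains n u v I x \<and> theta n u v x (Y1 \<union> Y2) = w)"

definition reflection_order :: "nat \<Rightarrow> (nat \<Rightarrow> nat) rel \<Rightarrow> bool" where
  "reflection_order n r \<longleftrightarrow>
     r \<subseteq> reflections n \<times> reflections n \<and> strict_linear_order_on (reflections n) r \<and>
     (\<forall>a b c. 1 \<le> a \<and> a < b \<and> b < c \<and> c \<le> n \<longrightarrow>
        (transpose a b, transpose a c) \<in> r \<and> (transpose a c, transpose b c) \<in> r \<or>
        (transpose b c, transpose a c) \<in> r \<and> (transpose a c, transpose a b) \<in> r)"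

definition property_E ::
  "nat \<Rightarrow> (nat \<Rightarrow> nat) \<Rightarrow> (nat \<Rightarrow> nat) set \<Rightarrow> (nat \<Rightarrow> nat) \<Rightarrow> bool" where
  "property_E n v I x \<longleftrightarrow>
     (\<exists>r. reflection_order n r \<and>
       (\<forall>x1\<in>I \<inter> interval n x v. \<forall>x2\<in>I \<inter> interval n x v. \<forall>x3\<in>I \<inter> interval n x v.
        \<forall>y\<in>interval n x v - I.
          x1 \<rightarrow>\<^bsub>bruhat_graph n\<^esub> x2 \<and> x3 \<rightarrow>\<^bsub>bruhat_graph n\<^esub> y \<longrightarrow>
          (edge_label x1 x2, edge_label x3 y) \<in> r))"

section \<open>\<open>R\<close>-polynomials\<close>

text \<open>
  The recursion is imposed for every simple reflection \<open>s\<close> with \<open>s v < v\<close>; it determines a unique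
  family, since the first clause also covers all pairs not in the symmetric group.
\<close>

definition R_family :: "nat \<Rightarrow> ((nat \<Rightarrow> nat) \<Rightarrow> (nat \<Rightarrow> nat) \<Rightarrow> int poly) \<Rightarrow> bool" where
  "R_family n R \<longleftrightarrow>
     (\<forall>u v. \<not> bruhat_le n u v \<longrightarrow> R u v = 0) \<and>
     (\<forall>u\<in>symgrp n. R u u = 1) \<and>
     (\<forall>u v. \<forall>i\<in>{1..<n}. let s = simple_refl i in
        bruhat_less n u v \<and> bruhat_less n (s \<circ> v) v \<longrightarrow>
        R u v = (if bruhat_less n (s \<circ> u) u then R (s \<circ> u) (s \<circ> v)
                 else [:-1, 1:] * R u (s \<circ> v) + [:0, 1:] * R (s \<circ> u) (s \<circ> v)))"

definition R_poly :: "nat \<Rightarrow> (nat \<Rightarrow> nat) \<Rightarrow> (nat \<Rightarrow> nat) \<Rightarrow> int poly" where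
  "R_poly n = (THE R. R_family n R)"

text \<open>
  The defining identity \<open>R(q) = q\<^sup>\<ell>\<^sup>/\<^sup>2 R'(q\<^sup>1\<^sup>/\<^sup>2 - q\<^sup>-\<^sup>1\<^sup>/\<^sup>2)\<close> is an identity of Laurent polynomials
  in the indeterminate \<open>X = q\<^sup>1\<^sup>/\<^sup>2\<close>.
\<close>

definition Rt_poly :: "nat \<Rightarrow> (nat \<Rightarrow> nat) \<Rightarrow> (nat \<Rightarrow> nat) \<Rightarrow> int poly" where
  "Rt_poly n u v = (THE p.
     poly (map_poly of_int (R_poly n u v)) (fls_X ^ 2 :: int fls) =
     fls_X_intpow (int (len n v) - int (len n u)) *
     poly (map_poly of_int p) (fls_X - fls_X_inv))"

definition Rt_rel ::
  "nat \<Rightarrow> (nat \<Rightarrow> nat) \<Rightarrow> (nat \<Rightarrow> nat) \<Rightarrow> (nat \<Rightarrow> nat) set \<Rightarrow> int poly" where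
  "Rt_rel n a b K = (\<Sum>y\<in>K. (Rt_poly n a y \<circ>\<^sub>p [:0, -1:]) * Rt_poly n y b)"

end

theory Submission
  imports Defs
begin

text \<open>
  By Dyer's formula, the modified \<open>R\<close>-polynomial counts label-increasing paths in the Bruhat graph
  for any reflection order. Hence the relative polynomial of \<open>I\<close> is a signed count of pairs of a
  decreasing path inside \<open>I\<close> and an increasing path starting at its end. Moving the smallest label
  from one path to the other cancels all pairs, except, by property (E), those made of the trivial path
  and an increasing path from \<open>x\<close> that leaves \<open>I\<close> at its first step.

  Each path of length two lies in exactly one diamond, which has one increasing and one decreasing
  side. Flipping the last two steps of an increasing path from \<open>x\<close> that leaves \<open>I\<close> at once gives
  a shorter increasing path of the same kind, so that by induction and strongness the path lies in the
  hypercube of a unique antichain, with the same endpoint; conversely such a hypercube has exactly one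
  increasing path from bottom to top.
\<close>


section \<open>Lengths\<close>

declare One_nat_def [simp del]

text \<open>The obstacle in the path formula is a mismatch of sides. A label
  \<open>y \<circ> inv x\<close> is unchanged when both ends are multiplied on the right, whereas
  the recursion defining \<open>R_poly\<close> multiplies on the left, which conjugates labels and
  so changes the reflection order. The right-handed recursion is therefore proved first, for every
  order. As it does not mention the order, all orders give the same path polynomial, and this
  freedom yields the left-handed recursion: an order that starts with the simple reflection
  \<open>s\<close> is compared with its conjugate, in which \<open>s\<close> comes last. Property
  (E) cuts the order into an initial segment \<open>as\<close>, whose labels never lead from the
  ideal to the outside within the interval above \<open>x\<close>, and a final segment
  \<open>bs\<close>, whose labels never join two of its elements there. What remains to count are
  the paths with labels in \<open>bs\<close>. They are matched with cubes by deleting from an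
  antichain the direction of the largest label among the edges into the top: this label is the last
  one on the increasing path through the cube.\<close>

definition inversions :: "nat \<Rightarrow> (nat \<Rightarrow> nat) \<Rightarrow> (nat \<times> nat) set" where
  "inversions n w = {(i, j). 1 \<le> i \<and> i < j \<and> j \<le> n \<and> w j < w i}"

lemma finite_inversions [simp]: "finite (inversions n w)"
  by (rule finite_subset[of _ "{1..n} \<times> {1..n}"]) (auto simp: inversions_def)

text \<open>An inversion is moved along with the swapped positions whenever the swap keeps their
  order. Otherwise one position is \<open>i\<close> or \<open>j\<close> and the other lies between
  them; the pair then stays an inversion in place, since the swap only widens its drop in value. The
  pair \<open>(i, j)\<close> is new.\<close>

lemma card_inversions_transpose_less:
  assumes w: "w permutes {1..n}" and ij: "1 \<le> i" "i < j" "j \<le> n" and lt: "w i < w j"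
  shows "card (inversions n w) < card (inversions n (w \<circ> transpose i j))"
proof -
  define \<tau> where "\<tau> = transpose i j"
  define \<phi> where "\<phi> = (\<lambda>(p, q). if \<tau> p < \<tau> q then (\<tau> p, \<tau> q) else (p, q))"
  have inv: "\<tau> (\<tau> p) = p" for p by (simp add: \<tau>_def)
  have rng: "1 \<le> \<tau> p \<and> \<tau> p \<le> n" if "1 \<le> p" "p \<le> n" for p
    using that ij by (auto simp: \<tau>_def transpose_def)
  have inj: "inj_on \<phi> (inversions n w)"
    by (rule inj_onI) (auto simp: \<phi>_def inversions_def split: if_splits, (metis inv)+)
  have mem: "\<phi> pq \<in> inversions n (w \<circ> \<tau>)" if "pq \<in> inversions n w" for pq
  proof -
    obtain p q where pq': "pq = (p, q)" by (cases pq)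
    then have pq: "pq = (p, q)" "1 \<le> p" "p < q" "q \<le> n" "w q < w p"
      using that by (auto simp: inversions_def)
    show ?thesis
    proof (cases "\<tau> p < \<tau> q")
      case True
      then show ?thesis using pq rng[of p] rng[of q] by (auto simp: \<phi>_def inversions_def inv)
    next
      case False
      have "w (\<tau> q) < w (\<tau> p)"
        using False pq lt ij by (auto simp: \<tau>_def transpose_def split: if_splits)
      then show ?thesis using False pq by (auto simp: \<phi>_def inversions_def)
    qed
  qed
  have new: "(i, j) \<in> inversions n (w \<circ> \<tau>)"
    using ij lt by (auto simp: inversions_def \<tau>_def)
  have notin: "(i, j) \<notin> \<phi> ` inversions n w"
    using lt ij by (auto simp: \<phi>_def inversions_def \<tau>_def transpose_def split: if_splits)
  have "card (inversions n w) = card (\<phi> ` inversions n w)"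
    by (simp add: card_image inj)
  also have "\<dots> < card (inversions n (w \<circ> \<tau>))"
    by (rule psubset_card_mono) (use mem new notin in auto)
  finally show ?thesis by (simp add: \<tau>_def)
qed

text \<open>A swap of neighbours preserves the order of every pair of positions except
  \<open>(i, i + 1)\<close>, so all other inversions correspond one to one.\<close>

lemma card_inversions_simple_refl:
  assumes w: "w permutes {1..n}" and i: "1 \<le> i" "i < n" and lt: "w i < w (i + 1)"
  shows "card (inversions n (w \<circ> simple_refl i)) = Suc (card (inversions n w))"
proof -
  define \<tau> where "\<tau> = simple_refl i"
  have inv: "\<tau> (\<tau> p) = p" for p by (simp add: \<tau>_def simple_refl_def)
  have rng: "1 \<le> \<tau> p \<and> \<tau> p \<le> n" if "1 \<le> p" "p \<le> n" for p
    using that i by (auto simp: \<tau>_def transpose_def simple_refl_def)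
  have ord: "\<tau> p < \<tau> q" if "p < q" "(p, q) \<noteq> (i, i + 1)" for p q
    using that by (auto simp: \<tau>_def transpose_def simple_refl_def)
  have "bij_betw (\<lambda>(p, q). (\<tau> p, \<tau> q)) (inversions n w) (inversions n (w \<circ> \<tau>) - {(i, i + 1)})"
  proof (rule bij_betwI[where g = "\<lambda>(p, q). (\<tau> p, \<tau> q)"], goal_cases)
    case 1
    show ?case
    proof (clarsimp simp: inversions_def inv)
      fix p q assume a: "1 \<le> p" "p < q" "q \<le> n" "w q < w p"
      then have "(p, q) \<noteq> (i, i + 1)" using lt by auto
      then show "1 \<le> \<tau> p \<and> \<tau> p < \<tau> q \<and> \<tau> q \<le> n \<and> (\<tau> p = i \<longrightarrow> \<tau> q \<noteq> i + 1)"
        using a ord[of p q] rng[of p] rng[of q] inv[of p] inv[of q]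
        by (auto simp: \<tau>_def transpose_def simple_refl_def split: if_splits)
    qed
  next
    case 2
    show ?case
    proof (clarsimp simp: inversions_def inv)
      fix p q assume a: "1 \<le> p" "p < q" "q \<le> n" "w (\<tau> q) < w (\<tau> p)" "p = i \<longrightarrow> q \<noteq> i + 1"
      then show "1 \<le> \<tau> p \<and> \<tau> p < \<tau> q \<and> \<tau> q \<le> n"
        using ord[of p q] rng[of p] rng[of q] by auto
    qed
  qed (auto simp: inv)
  then have "card (inversions n w) = card (inversions n (w \<circ> \<tau>) - {(i, i + 1)})"
    by (rule bij_betw_same_card)
  moreover have "(i, i + 1) \<in> inversions n (w \<circ> \<tau>)"
    using i lt by (auto simp: inversions_def \<tau>_def simple_refl_def)
  ultimately show ?thesis
    by (metis \<tau>_def card.remove finite_inversions)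
qed

lemma simple_refl_permutes: "1 \<le> i \<Longrightarrow> i < n \<Longrightarrow> simple_refl i permutes {1..n}"
  by (auto simp: simple_refl_def intro: permutes_swap_id)

lemma simple_refl_comp_self [simp]: "simple_refl i \<circ> simple_refl i = id"
  by (simp add: simple_refl_def)

lemma comp_simple_refl_cancel [simp]: "w \<circ> simple_refl i \<circ> simple_refl i = w"
  by (simp add: comp_assoc)

lemma simple_refl_comp_cancel [simp]: "simple_refl i \<circ> (simple_refl i \<circ> w) = w"
  by (simp add: comp_assoc[symmetric])

lemma card_inversions_simple_refl':
  assumes w: "w permutes {1..n}" and i: "1 \<le> i" "i < n" and lt: "w (i + 1) < w i"
  shows "card (inversions n w) = Suc (card (inversions n (w \<circ> simple_refl i)))"
proof -
  have "(w \<circ> simple_refl i) permutes {1..n}"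
    by (rule permutes_compose[OF simple_refl_permutes w]) (use i in auto)
  from card_inversions_simple_refl[OF this i] lt show ?thesis
    by (auto simp: simple_refl_def comp_assoc)
qed

lemma permutes_no_descent_eq_id:
  fixes w :: "nat \<Rightarrow> nat"
  assumes w: "w permutes {1..n}" and nd: "\<And>i. 1 \<le> i \<Longrightarrow> i < n \<Longrightarrow> w i < w (i + 1)"
  shows "w = id"
proof -
  have "1 \<le> k \<longrightarrow> k \<le> n \<longrightarrow> k \<le> w k" for k
  proof (induction k)
    case (Suc k)
    show ?case
    proof (cases "k = 0")
      case True
      then show ?thesis using permutes_in_image[OF w, of 1] Suc by (auto simp: One_nat_def)
    next
      case False
      then show ?thesis using Suc nd[of k] by (auto simp: One_nat_def)
    qed
  qed simp
  then have ge: "k \<le> w k" if "1 \<le> k" "k \<le> n" for k using that by blast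
  have "w k = k" if "k \<in> {1..n}" for k
  proof (rule ccontr)
    assume "w k \<noteq> k"
    then have "k < w k" using ge that by (simp add: le_neq_implies_less)
    \<comment> \<open>All values are at least their positions, so one excess would raise the sum of
      the values; but \<open>w\<close> only rearranges the summands.\<close>
    then have "(\<Sum>k\<in>{1..n}. k) < (\<Sum>k\<in>{1..n}. w k)"
      using ge that by (intro sum_strict_mono_ex1) auto
    moreover have "(\<Sum>k\<in>{1..n}. w k) = (\<Sum>k\<in>{1..n}. k)"
      using sum.permute[OF w, of id] by (simp add: comp_def)
    ultimately show False by simp
  qed
  then show ?thesis using w by (auto simp: permutes_def fun_eq_iff)
qed

section \<open>Words in the simple reflections, and length as the number of inversions\<close>

primrec word :: "nat list \<Rightarrow> nat \<Rightarrow> nat" where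
  "word [] = id"
| "word (i # is) = simple_refl i \<circ> word is"

lemma foldr_comp_eq_word: "foldr (\<circ>) (map simple_refl is) id = word is"
  by (induction "is") simp_all

lemma word_append: "word (is @ js) = word is \<circ> word js"
  by (induction "is") (auto simp: comp_assoc)

lemma word_permutes: "set is \<subseteq> {1..<n} \<Longrightarrow> word is permutes {1..n}"
proof (induction "is")
  case Nil
  then show ?case by (simp add: permutes_def)
next
  case (Cons a "is")
  have "simple_refl a \<circ> word is permutes {1..n}"
    by (rule permutes_compose[OF Cons.IH simple_refl_permutes]) (use Cons.prems in auto)
  then show ?case by (simp only: word.simps)
qed

lemma permutes_neq_image: "w permutes S \<Longrightarrow> i \<noteq> j \<Longrightarrow> w i \<noteq> w j"
  by (meson injD permutes_inj)

lemma inversions_id [simp]: "inversions n id = {}"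
  by (auto simp: inversions_def)

lemma card_inversions_word_le: "set is \<subseteq> {1..<n} \<Longrightarrow> card (inversions n (word is)) \<le> length is"
proof (induction "is" rule: rev_induct)
  case Nil
  then show ?case by (simp only: word.simps inversions_id card.empty)
next
  case (snoc i "is")
  have w: "word is permutes {1..n}" and i: "1 \<le> i" "i < n"
    using snoc.prems word_permutes[of "is" n] by auto
  have "word is i \<noteq> word is (i + 1)" using permutes_neq_image[OF w] by simp
  then have "card (inversions n (word is \<circ> simple_refl i)) \<le> Suc (card (inversions n (word is)))"
    using card_inversions_simple_refl[OF w i] card_inversions_simple_refl'[OF w i] by linarith
  moreover have "card (inversions n (word is)) \<le> length is"
    using snoc by simp
  ultimately have "card (inversions n (word (is @ [i]))) \<le> Suc (length is)"
    unfolding word_append word.simps comp_id by linarith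
  then show ?case by simp
qed

text \<open>Bubble sort: a permutation other than the identity has a descent, and removing it lowers
  the number of inversions by exactly one.\<close>

lemma ex_word:
  "w permutes {1..n} \<Longrightarrow> \<exists>is. length is = card (inversions n w) \<and> set is \<subseteq> {1..<n} \<and> w = word is"
proof (induction "card (inversions n w)" arbitrary: w)
  case 0
  have "w = id"
  proof (rule permutes_no_descent_eq_id[OF 0(2)])
    fix i assume i: "1 \<le> i" "i < n"
    show "w i < w (i + 1)"
    proof (rule ccontr)
      assume "\<not> ?thesis"
      then have "w (i + 1) < w i"
        using permutes_neq_image[OF 0(2), of i "i + 1"] by simp
      from card_inversions_simple_refl'[OF 0(2) i this] 0(1) show False by simp
    qed
  qed
  then show ?case using 0 by auto
next
  case (Suc k)
  have "\<exists>i. 1 \<le> i \<and> i < n \<and> w (i + 1) < w i"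
  proof (rule ccontr)
    assume *: "\<not> ?thesis"
    have "w = id"
    proof (rule permutes_no_descent_eq_id[OF Suc.prems])
      fix i assume "1 \<le> i" "i < n"
      then show "w i < w (i + 1)"
        using * permutes_neq_image[OF Suc.prems, of i "i + 1"] by (metis linorder_neqE_nat n_not_Suc_n Suc_eq_plus1)
    qed
    then show False using Suc(2) by simp
  qed
  then obtain i where i: "1 \<le> i" "i < n" "w (i + 1) < w i" by blast
  have "(w \<circ> simple_refl i) permutes {1..n}"
    by (rule permutes_compose[OF simple_refl_permutes Suc.prems]) (use i in auto)
  from Suc(1)[OF _ this] card_inversions_simple_refl'[OF Suc.prems i] Suc(2)
  obtain "is" where "length is = k" "set is \<subseteq> {1..<n}" "w \<circ> simple_refl i = word is" by auto
  then have "length (is @ [i]) = Suc k" "set (is @ [i]) \<subseteq> {1..<n}" "w = word (is @ [i])"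
    using i word_append[of "is" "[i]"] by (auto simp: comp_assoc fun_eq_iff simple_refl_def)
      (metis comp_apply transpose_involutory)
  then show ?case using Suc(2) by metis
qed

lemma len_eq_card_inversions:
  assumes "w permutes {1..n}"
  shows "len n w = card (inversions n w)"
  unfolding len_def foldr_comp_eq_word
proof (rule Least_equality)
  show "\<exists>is. length is = card (inversions n w) \<and> set is \<subseteq> {1..<n} \<and> w = word is"
    by (rule ex_word[OF assms])
next
  fix k assume "\<exists>is. length is = k \<and> set is \<subseteq> {1..<n} \<and> w = word is"
  then show "card (inversions n w) \<le> k" using card_inversions_word_le by blast
qed

lemma ex_word_len:
  assumes "x \<in> symgrp n"
  shows "\<exists>is. length is = len n x \<and> set is \<subseteq> {1..<n} \<and> x = word is"
  using ex_word[of x n] assms len_eq_card_inversions[of x n] by (simp add: symgrp_def)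

section \<open>Ascents and descents of permutations\<close>

lemma symgrp_transpose: "1 \<le> a \<Longrightarrow> a \<le> n \<Longrightarrow> 1 \<le> b \<Longrightarrow> b \<le> n \<Longrightarrow> transpose a b \<in> symgrp n"
  by (auto simp: symgrp_def intro: permutes_swap_id)

lemma symgrp_comp: "x \<in> symgrp n \<Longrightarrow> y \<in> symgrp n \<Longrightarrow> x \<circ> y \<in> symgrp n"
  by (auto simp: symgrp_def intro: permutes_compose)

lemma symgrp_inv: "x \<in> symgrp n \<Longrightarrow> inv x \<in> symgrp n"
  by (auto simp: symgrp_def permutes_inv)

lemma symgrp_bij: "x \<in> symgrp n \<Longrightarrow> bij x"
  by (auto simp: symgrp_def permutes_bij)

lemma symgrp_simple_refl: "i \<in> {1..<n} \<Longrightarrow> simple_refl i \<in> symgrp n"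
  by (auto simp: symgrp_def intro: simple_refl_permutes[simplified])

lemma finite_symgrp: "finite (symgrp n)"
  by (simp add: symgrp_def finite_permutations)

lemma reflectionsE:
  assumes "t \<in> reflections n"
  obtains a b where "t = transpose a b" "1 \<le> a" "a < b" "b \<le> n"
  using assms by (auto simp: reflections_def)

lemma reflections_symgrp: "t \<in> reflections n \<Longrightarrow> t \<in> symgrp n"
  by (auto elim!: reflectionsE intro: symgrp_transpose)

lemma reflections_comp_self [simp]: "t \<in> reflections n \<Longrightarrow> t \<circ> t = id"
  by (auto elim!: reflectionsE)

lemma reflections_cancel [simp]: "t \<in> reflections n \<Longrightarrow> t \<circ> (t \<circ> x) = x"
  by (simp add: comp_assoc[symmetric])

lemma finite_reflections: "finite (reflections n)"
  by (rule finite_subset[OF _ finite_symgrp[of n]]) (auto intro: reflections_symgrp)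

lemma transpose_in_reflections:
  "1 \<le> a \<Longrightarrow> a \<le> n \<Longrightarrow> 1 \<le> b \<Longrightarrow> b \<le> n \<Longrightarrow> a \<noteq> b \<Longrightarrow> transpose a b \<in> reflections n"
  unfolding reflections_def by (cases "a < b") (auto, metis linorder_neqE_nat transpose_commute)

lemma simple_refl_in_reflections: "i \<in> {1..<n} \<Longrightarrow> simple_refl i \<in> reflections n"
  by (auto simp: simple_refl_def intro!: transpose_in_reflections)

lemma symgrp_in_range: "x \<in> symgrp n \<Longrightarrow> k \<in> {1..n} \<Longrightarrow> x k \<in> {1..n}"
  by (auto simp: symgrp_def dest: permutes_in_image)

text \<open>Multiplying by \<open>transpose a b\<close> on the left exchanges the entries at the
  positions \<open>inv x a\<close> and \<open>inv x b\<close>, so the length grows exactly when the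
  smaller value stands first. This turns ascents into comparisons of positions, which the later case
  analyses can decide.\<close>

lemma len_less_transpose_iff:
  assumes x: "x \<in> symgrp n" and ab: "1 \<le> a" "a < b" "b \<le> n"
  shows "len n x < len n (transpose a b \<circ> x) \<longleftrightarrow> inv x a < inv x b"
proof -
  have xp: "x permutes {1..n}" using x by (simp add: symgrp_def)
  have bij: "bij x" using x by (rule symgrp_bij)
  define i j where "i = inv x a" and "j = inv x b"
  have xi: "x i = a" "x j = b" using bij by (simp_all add: i_def j_def bij_inv_eq_iff[symmetric])
  have rng: "i \<in> {1..n}" "j \<in> {1..n}"
    using symgrp_in_range[OF symgrp_inv[OF x]] ab by (auto simp: i_def j_def)
  have eq: "transpose a b \<circ> x = x \<circ> transpose i j"
    using transpose_comp_eq[OF bij] by (simp add: i_def j_def)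
  have yp: "(transpose a b \<circ> x) permutes {1..n}"
    using symgrp_comp[OF symgrp_transpose x, of a b] ab by (auto simp: symgrp_def)
  have "i \<noteq> j" using xi ab by auto
  then consider "i < j" | "j < i" by linarith
  then show ?thesis
  proof cases
    case 1
    then have "card (inversions n x) < card (inversions n (x \<circ> transpose i j))"
      using card_inversions_transpose_less[OF xp, of i j] rng xi ab by auto
    then show ?thesis using 1 len_eq_card_inversions[OF xp] len_eq_card_inversions[OF yp] eq
      by (simp add: i_def j_def)
  next
    case 2
    have "card (inversions n (transpose a b \<circ> x)) < card (inversions n (transpose a b \<circ> x \<circ> transpose j i))"
      using card_inversions_transpose_less[OF yp, of j i] rng xi ab 2 by auto
    moreover have "transpose a b \<circ> x \<circ> transpose j i = x"
      by (simp add: eq comp_assoc transpose_commute[of j i])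
    ultimately show ?thesis using 2 len_eq_card_inversions[OF xp] len_eq_card_inversions[OF yp]
      by (simp add: i_def j_def)
  qed
qed

lemma len_simple_refl_right:
  assumes x: "x \<in> symgrp n" and i: "i \<in> {1..<n}"
  shows "len n x < len n (x \<circ> simple_refl i) \<longleftrightarrow> x i < x (i + 1)"
    and "len n x < len n (x \<circ> simple_refl i) \<Longrightarrow> len n (x \<circ> simple_refl i) = Suc (len n x)"
    and "\<not> len n x < len n (x \<circ> simple_refl i) \<Longrightarrow> len n x = Suc (len n (x \<circ> simple_refl i))"
proof -
  have xp: "x permutes {1..n}" using x by (simp add: symgrp_def)
  have yp: "(x \<circ> simple_refl i) permutes {1..n}"
    using symgrp_comp[OF x symgrp_simple_refl[OF i]] by (auto simp: symgrp_def)
  have i': "1 \<le> i" "i < n" using i by auto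
  have ne: "x i \<noteq> x (i + 1)" using permutes_neq_image[OF xp] by simp
  note L = len_eq_card_inversions[OF xp] len_eq_card_inversions[OF yp]
    card_inversions_simple_refl[OF xp i'] card_inversions_simple_refl'[OF xp i']
  show 1: "len n x < len n (x \<circ> simple_refl i) \<longleftrightarrow> x i < x (i + 1)"
    and "len n x < len n (x \<circ> simple_refl i) \<Longrightarrow> len n (x \<circ> simple_refl i) = Suc (len n x)"
    and "\<not> len n x < len n (x \<circ> simple_refl i) \<Longrightarrow> len n x = Suc (len n (x \<circ> simple_refl i))"
    using L ne by linarith+
qed

lemma ex_right_descent:
  assumes x: "x \<in> symgrp n" "x \<noteq> id"
  obtains i where "i \<in> {1..<n}" "len n (x \<circ> simple_refl i) < len n x"
proof -
  have xp: "x permutes {1..n}" using x by (simp add: symgrp_def)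
  obtain i where i: "1 \<le> i" "i < n" "\<not> x i < x (i + 1)"
    using permutes_no_descent_eq_id[OF xp] x by blast
  then show ?thesis using that[of i] len_simple_refl_right[OF x(1), of i] by auto
qed

lemma word_rev_comp: "word (rev is) \<circ> word is = id"
proof (induction "is")
  case (Cons a "is")
  have "word (rev (a # is)) \<circ> word (a # is) = word (rev is) \<circ> (simple_refl a \<circ> simple_refl a) \<circ> word is"
    using word_append[of "rev is" "[a]"] by (simp add: comp_assoc del: simple_refl_comp_self)
  also have "\<dots> = word (rev is) \<circ> word is"
    by (simp only: simple_refl_comp_self comp_id)
  finally show ?case using Cons.IH by (simp only:)
qed simp

lemma word_inv: "inv (word is) = word (rev is)"
  using word_rev_comp[of "is"] word_rev_comp[of "rev is"] by (intro inv_unique_comp) auto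

text \<open>A reversed word represents the inverse. This carries facts on right multiplication by
  simple reflections over to left multiplication.\<close>

lemma len_inv:
  assumes "x \<in> symgrp n"
  shows "len n (inv x) = len n x"
proof -
  have *: "len n (inv x) \<le> len n x" if "x \<in> symgrp n" for x
  proof -
    from ex_word_len[OF that]
    obtain "is" where w: "length is = len n x" "set is \<subseteq> {1..<n}" "x = word is" by blast
    have ip: "inv x permutes {1..n}" using symgrp_inv[OF that] unfolding symgrp_def by blast
    have "card (inversions n (word (rev is))) \<le> length (rev is)"
      by (rule card_inversions_word_le) (use w in auto)
    then show ?thesis using w word_inv[of "is"] len_eq_card_inversions[OF ip] by simp
  qed
  have "inv (inv x) = x" using assms by (simp add: symgrp_bij inv_inv_eq)
  then show ?thesis using *[OF assms] *[OF symgrp_inv[OF assms]] by simp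
qed

lemma len_simple_refl_left:
  assumes x: "x \<in> symgrp n" and i: "i \<in> {1..<n}"
  shows "len n x < len n (simple_refl i \<circ> x) \<Longrightarrow> len n (simple_refl i \<circ> x) = Suc (len n x)"
    and "\<not> len n x < len n (simple_refl i \<circ> x) \<Longrightarrow> len n x = Suc (len n (simple_refl i \<circ> x))"
proof -
  let ?s = "simple_refl i"
  have "inv (?s \<circ> x) = inv x \<circ> ?s"
    using symgrp_bij[OF x] by (simp add: o_inv_distrib simple_refl_def)
  moreover have "len n (inv (?s \<circ> x)) = len n (?s \<circ> x)"
    by (intro len_inv symgrp_comp symgrp_simple_refl x i)
  ultimately have eq: "len n (?s \<circ> x) = len n (inv x \<circ> ?s)" by simp
  show "len n x < len n (?s \<circ> x) \<Longrightarrow> len n (?s \<circ> x) = Suc (len n x)"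
    and "\<not> len n x < len n (?s \<circ> x) \<Longrightarrow> len n x = Suc (len n (?s \<circ> x))"
    using len_simple_refl_right[OF symgrp_inv[OF x] i] eq len_inv[OF x] by auto
qed

lemma ex_left_descent:
  assumes x: "x \<in> symgrp n" "x \<noteq> id"
  obtains i where "i \<in> {1..<n}" "len n (simple_refl i \<circ> x) < len n x"
proof -
  have "inv x \<noteq> id" using x by (metis inv_id inv_inv_eq symgrp_bij)
  then obtain i where i: "i \<in> {1..<n}" "len n (inv x \<circ> simple_refl i) < len n (inv x)"
    using ex_right_descent[OF symgrp_inv[OF x(1)]] by blast
  have "inv (simple_refl i \<circ> x) = inv x \<circ> simple_refl i"
    using symgrp_bij[OF x(1)] by (simp add: o_inv_distrib simple_refl_def)
  then have "len n (simple_refl i \<circ> x) = len n (inv x \<circ> simple_refl i)"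
    using len_inv[OF symgrp_comp[OF symgrp_simple_refl[OF i(1)] x(1)]] by simp
  then show ?thesis using that[OF i(1)] i(2) len_inv[OF x(1)] by simp
qed

lemma len_id [simp]: "len n id = 0"
  using len_eq_card_inversions[of id n] by (simp only: permutes_id inversions_id card.empty)

lemma sign_eq_len:
  assumes "x \<in> symgrp n"
  shows "sign x = (-1) ^ len n x"
proof -
  from ex_word_len[OF assms]
  obtain "is" where w: "length is = len n x" "set is \<subseteq> {1..<n}" "x = word is" by blast
  have "set is \<subseteq> {1..<n} \<Longrightarrow> sign (word is) = (-1) ^ length is \<and> permutation (word is)" for "is"
  proof (induction "is")
    case (Cons a "is")
    have "permutation (simple_refl a)" "sign (simple_refl a) = -1"
      by (simp_all add: simple_refl_def permutation_swap_id sign_swap_id)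
    moreover have "sign (word is) = (-1) ^ length is" "permutation (word is)"
      using Cons by auto
    ultimately have "sign (simple_refl a \<circ> word is) = (-1) ^ Suc (length is)"
      "permutation (simple_refl a \<circ> word is)"
      by (metis sign_compose power_Suc, metis permutation_compose)
    then show ?case by (simp only: word.simps list.size add_Suc_right add_0_right simp_thms One_nat_def)
  qed simp
  then show ?thesis using w by metis
qed

text \<open>A transposition changes the sign. Besides excluding equal lengths, the odd difference is
  what later leaves only integral powers in the \<open>R\<close>-polynomials.\<close>

lemma odd_len_reflection:
  assumes x: "x \<in> symgrp n" and t: "t \<in> reflections n"
  shows "odd (len n x + len n (t \<circ> x))"
proof -
  obtain a b where ab: "t = transpose a b" "a < b" using t by (auto elim: reflectionsE)
  have "permutation x" using x by (auto simp: symgrp_def permutation_permutes)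
  then have "sign (t \<circ> x) = - sign x"
    using ab by (simp add: sign_compose permutation_swap_id sign_swap_id)
  then have "(-1) ^ len n (t \<circ> x) = - ((-1) ^ len n x :: int)"
    using sign_eq_len[OF x] sign_eq_len[OF symgrp_comp[OF reflections_symgrp[OF t] x]] by simp
  then show ?thesis by (auto simp: minus_one_power_iff split: if_splits)
qed

section \<open>Increasing paths along a reflection order\<close>

declare comp_apply [simp del]

abbreviation ascends :: "nat \<Rightarrow> (nat \<Rightarrow> nat) \<Rightarrow> (nat \<Rightarrow> nat) \<Rightarrow> bool" where
  "ascends n x t \<equiv> len n x < len n (t \<circ> x)"

abbreviation q :: "int poly" where "q \<equiv> [:0, 1:]"

text \<open>
  The generating function, by length, of the paths from \<open>u\<close> to \<open>v\<close> whose labels form a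
  subsequence of \<open>ts\<close>.
\<close>

fun incp :: "nat \<Rightarrow> (nat \<Rightarrow> nat) list \<Rightarrow> (nat \<Rightarrow> nat) \<Rightarrow> (nat \<Rightarrow> nat) \<Rightarrow> int poly" where
  "incp n [] u v = (if u = v then 1 else 0)"
| "incp n (t # ts) u v = incp n ts u v + (if ascends n u t then q * incp n ts (t \<circ> u) v else 0)"

text \<open>Listing the order turns its initial and final segments into sublists, and induction
  along the order into list induction.\<close>

definition reflection_list :: "nat \<Rightarrow> (nat \<Rightarrow> nat) rel \<Rightarrow> (nat \<Rightarrow> nat) list \<Rightarrow> bool" where
  "reflection_list n r ts \<longleftrightarrow>
     reflection_order n r \<and> sorted_wrt (\<lambda>s t. (s, t) \<in> r) ts \<and> set ts = reflections n"

lemma not_ascends_iff: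
  assumes "x \<in> symgrp n" "t \<in> reflections n"
  shows "\<not> ascends n x t \<longleftrightarrow> len n (t \<circ> x) < len n x"
  using odd_len_reflection[OF assms] by (metis even_add linorder_neqE_nat order.asym)

lemma incp_neq_0D: "incp n ts u v \<noteq> 0 \<Longrightarrow> u = v \<or> len n u < len n v"
proof (induction ts arbitrary: u)
  case (Cons t ts)
  then have "incp n ts u v \<noteq> 0 \<or> ascends n u t \<and> incp n ts (t \<circ> u) v \<noteq> 0"
    by (auto split: if_splits)
  then show ?case
  proof
    assume "incp n ts u v \<noteq> 0"
    then show ?thesis by (rule Cons.IH)
  next
    assume *: "ascends n u t \<and> incp n ts (t \<circ> u) v \<noteq> 0"
    then have "t \<circ> u = v \<or> len n (t \<circ> u) < len n v" using Cons.IH by blast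
    then show ?thesis using * by (metis order.strict_trans)
  qed
qed (auto split: if_splits)

lemma incp_self: "incp n ts u u = 1"
proof (induction ts)
  case (Cons t ts)
  have "incp n ts (t \<circ> u) u = 0" if "ascends n u t"
    using incp_neq_0D[of n ts "t \<circ> u" u] that by (metis order.asym order.irrefl)
  then show ?case using Cons by simp
qed simp

text \<open>The defining recursion splits off the first label of the list, which can only start a
  path; here the last label is split off, which can only end one.\<close>

lemma incp_append:
  assumes "set ts \<subseteq> reflections n" "t \<in> reflections n" "u \<in> symgrp n" "v \<in> symgrp n"
  shows "incp n (ts @ [t]) u v =
    incp n ts u v + (if len n (t \<circ> v) < len n v then q * incp n ts u (t \<circ> v) else 0)"
  using assms
proof (induction ts arbitrary: u)
  case Nil
  have "t \<circ> u = v \<longleftrightarrow> u = t \<circ> v"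
    using reflections_cancel[OF Nil(2)] by metis
  moreover have "t \<circ> (t \<circ> v) = v" using Nil by simp
  ultimately have "incp n ([] @ [t]) u v =
    incp n [] u v + (if len n (t \<circ> v) < len n v then q * incp n [] u (t \<circ> v) else 0)"
    by simp
  then show ?case .
next
  case (Cons p ts)
  have "p \<circ> u \<in> symgrp n" using Cons.prems by (auto intro: symgrp_comp reflections_symgrp)
  then show ?case using Cons by (simp add: algebra_simps)
qed

section \<open>Comparing labels in a reflection order\<close>

lemma reflection_orderD:
  assumes "reflection_order n r"
  shows "trans r" "(t, t) \<notin> r" "r \<subseteq> reflections n \<times> reflections n"
    "t \<in> reflections n \<Longrightarrow> t' \<in> reflections n \<Longrightarrow> t \<noteq> t' \<Longrightarrow> (t, t') \<in> r \<or> (t', t) \<in> r"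
    "(t, t') \<in> r \<Longrightarrow> (t', t) \<notin> r"
proof -
  show tr: "trans r" and ir: "(t, t) \<notin> r" and "r \<subseteq> reflections n \<times> reflections n"
    using assms unfolding reflection_order_def strict_linear_order_on_def by (auto simp: irrefl_def)
  show "t \<in> reflections n \<Longrightarrow> t' \<in> reflections n \<Longrightarrow> t \<noteq> t' \<Longrightarrow> (t, t') \<in> r \<or> (t', t) \<in> r"
    using assms unfolding reflection_order_def strict_linear_order_on_def total_on_def by blast
  show "(t, t') \<in> r \<Longrightarrow> (t', t) \<notin> r"
    using tr ir by (metis assms irrefl_def reflection_order_def strict_linear_order_on_def transD)
qed

lemma reflection_order_triple:
  assumes "reflection_order n r" "1 \<le> a" "a < b" "b < c" "c \<le> n"
  shows "(transpose a b, transpose a c) \<in> r \<and> (transpose a c, transpose b c) \<in> r \<and>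
      (transpose a b, transpose b c) \<in> r \<or>
    (transpose b c, transpose a c) \<in> r \<and> (transpose a c, transpose a b) \<in> r \<and>
      (transpose b c, transpose a b) \<in> r"
  using assms reflection_orderD(1)[OF assms(1)] unfolding reflection_order_def by (meson transD)

text \<open>In every triple the transposition of the two outer points comes in the middle, and the
  other two at the ends. Hence \<open>transpose a b\<close> separates the other two exactly when
  \<open>e\<close> lies between \<open>a\<close> and \<open>b\<close>.\<close>

lemma reflection_order_third:
  assumes r: "reflection_order n r" and a: "1 \<le> a" "a < b" "b \<le> n"
    and e: "1 \<le> e" "e \<le> n" "e \<noteq> a" "e \<noteq> b"
  shows "((transpose a b, transpose a e) \<in> r \<longleftrightarrow> (transpose a b, transpose b e) \<in> r) \<longleftrightarrow>
    \<not> (a < e \<and> e < b)"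
proof -
  note asym = reflection_orderD(5)[OF r]
  consider "e < a" | "a < e" "e < b" | "b < e" using e by linarith
  then show ?thesis
  proof cases
    case 1
    then show ?thesis using reflection_order_triple[OF r, of e a b] a e asym
      by (simp add: transpose_commute[of e]) (metis transpose_commute)
  next
    case 2
    then show ?thesis using reflection_order_triple[OF r, of a e b] a e asym
      by (simp add: transpose_commute[of e]) (metis transpose_commute)
  next
    case 3
    then show ?thesis using reflection_order_triple[OF r, of a b e] a e asym
      by simp metis
  qed
qed

text \<open>If \<open>t\<close> is disjoint from \<open>transpose c d\<close>, nothing moves. If
  they share one point, the conjugate of \<open>transpose c d\<close> by \<open>t\<close> is the
  third reflection of a triple, and the previous lemma applies. This lets a statement on twisted
  orientations pass from \<open>u\<close> to \<open>t \<circ> u\<close>.\<close>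

lemma reflection_order_flip:
  assumes r: "reflection_order n r" and t: "t \<in> reflections n"
    and c: "c \<in> {1..n}" "d \<in> {1..n}" "c \<noteq> d" and ne: "t \<noteq> transpose c d"
  shows "(t c < t d \<longleftrightarrow> c < d) \<longleftrightarrow>
    ((t, transpose c d) \<in> r \<longleftrightarrow> (t, transpose (t c) (t d)) \<in> r)"
proof -
  obtain a b where ab: "t = transpose a b" "1 \<le> a" "a < b" "b \<le> n"
    using t by (rule reflectionsE)
  have "\<not> (c = a \<and> d = b)" "\<not> (c = b \<and> d = a)"
    using ne ab by (auto simp: transpose_commute)
  then consider "c \<notin> {a, b}" "d \<notin> {a, b}" | "c = a" "d \<notin> {a, b}" | "c = b" "d \<notin> {a, b}"
    | "d = a" "c \<notin> {a, b}" | "d = b" "c \<notin> {a, b}"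
    using c(3) by blast
  then show ?thesis
  proof cases
    case 1
    then show ?thesis by (simp add: ab)
  next
    case 2
    then show ?thesis using reflection_order_third[OF r ab(2-4), of d] c ab by auto
  next
    case 3
    then show ?thesis using reflection_order_third[OF r ab(2-4), of d] c ab by auto
  next
    case 4
    then show ?thesis using reflection_order_third[OF r ab(2-4), of c] c ab
      by (auto simp: transpose_commute[of c])
  next
    case 5
    then show ?thesis using reflection_order_third[OF r ab(2-4), of c] c ab
      by (auto simp: transpose_commute[of c])
  qed
qed

text \<open>Right multiplication exchanges the positions \<open>i\<close> and \<open>i + 1\<close>.
  It can only change the order of the positions of two values that occupy exactly these places, and
  that is the excluded label.\<close>

lemma ascends_simple_refl_right:
  assumes u: "u \<in> symgrp n" and i: "i \<in> {1..<n}" and t: "t \<in> reflections n"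
    and ne: "t \<noteq> transpose (u i) (u (i + 1))"
  shows "ascends n (u \<circ> simple_refl i) t \<longleftrightarrow> ascends n u t"
proof -
  obtain a b where ab: "t = transpose a b" "1 \<le> a" "a < b" "b \<le> n"
    using t by (rule reflectionsE)
  have bij: "bij u" using u by (rule symgrp_bij)
  have inv: "inv (u \<circ> simple_refl i) = simple_refl i \<circ> inv u"
    using bij by (simp add: o_inv_distrib simple_refl_def)
  have "inv u a \<noteq> inv u b" using ab bij by (metis bij_inv_eq_iff less_irrefl)
  moreover have "\<not> (inv u a = i \<and> inv u b = i + 1)" "\<not> (inv u a = i + 1 \<and> inv u b = i)"
    using ne ab bij by (metis bij_inv_eq_iff, metis bij_inv_eq_iff transpose_commute)
  ultimately have "simple_refl i (inv u a) < simple_refl i (inv u b) \<longleftrightarrow> inv u a < inv u b"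
    unfolding simple_refl_def transpose_def by auto
  then show ?thesis
    using len_less_transpose_iff[OF u ab(2-4)]
      len_less_transpose_iff[OF symgrp_comp[OF u symgrp_simple_refl[OF i]] ab(2-4)]
    by (simp add: ab(1) inv comp_apply)
qed

text \<open>
  For a final segment \<open>ts\<close> of the reflection order, the edge between \<open>u\<close> and \<open>u s\<close> is oriented by
  the length function twisted by \<open>ts\<close>: the usual orientation if \<open>u s u\<^sup>-\<^sup>1 \<in> ts\<close> and the opposite
  one otherwise. Prepending a reflection \<open>t\<close> reverses exactly the edges labelled \<open>t\<close>, which makes
  the recursion for the \<open>R\<close>-polynomials provable by induction on \<open>ts\<close>.
\<close>

lemma incp_right_tail:
  assumes r: "reflection_order n r" and i: "i \<in> {1..<n}" and v: "v \<in> symgrp n"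
    and vs: "len n (v \<circ> simple_refl i) < len n v"
  shows "\<lbrakk>sorted_wrt (\<lambda>s t. (s, t) \<in> r) ts; set ts \<subseteq> reflections n;
    \<And>t p. t \<in> set ts \<Longrightarrow> (t, p) \<in> r \<Longrightarrow> p \<in> set ts;
    u \<in> symgrp n; u i < u (i + 1) \<longleftrightarrow> transpose (u i) (u (i + 1)) \<in> set ts\<rbrakk> \<Longrightarrow>
    incp n ts u (v \<circ> simple_refl i) = incp n ts (u \<circ> simple_refl i) v \<and>
    incp n ts u v = incp n ts (u \<circ> simple_refl i) (v \<circ> simple_refl i) +
      q * incp n ts (u \<circ> simple_refl i) v"
proof (induction ts arbitrary: u)
  case Nil
  define s where "s = simple_refl i"
  have ss: "v \<circ> s \<circ> s = v" "u \<circ> s \<circ> s = u" by (simp_all add: s_def)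
  have 1: "u = v \<circ> s \<longleftrightarrow> u \<circ> s = v" using ss by metis
  have 2: "u = v \<longleftrightarrow> u \<circ> s = v \<circ> s" using ss by metis
  \<comment> \<open>For the empty list the hypothesis says that \<open>u\<close> descends along
    \<open>s\<close>. So does \<open>v\<close>, hence they cannot be the two ends of one
    edge.\<close>
  have "u \<circ> s \<noteq> v"
  proof
    assume "u \<circ> s = v"
    then have "u = v \<circ> s" using 1 by simp
    moreover have "\<not> len n u < len n (u \<circ> s)"
      using Nil len_simple_refl_right(1)[OF Nil(4) i] by (simp add: s_def)
    ultimately show False using vs ss by (simp add: s_def)
  qed
  then have "incp n [] u (v \<circ> s) = incp n [] (u \<circ> s) v \<and>
    incp n [] u v = incp n [] (u \<circ> s) (v \<circ> s) + q * incp n [] (u \<circ> s) v"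
    using 1 2 by simp
  then show ?case unfolding s_def .
next
  case (Cons t ts)
  define s where "s = simple_refl i"
  define \<rho> where "\<rho> u = transpose (u i) (u (i + 1))" for u :: "nat \<Rightarrow> nat"
  note asym = reflection_orderD(5)[OF r]
  have t: "t \<in> reflections n" using Cons.prems by simp
  have u: "u \<in> symgrp n" by fact
  have i1: "i \<in> {1..n}" "i + 1 \<in> {1..n}" using i by auto
  have sorted: "sorted_wrt (\<lambda>s t. (s, t) \<in> r) ts" and sub: "set ts \<subseteq> reflections n"
    using Cons.prems by auto
  have mem: "p \<in> set ts \<longleftrightarrow> (t, p) \<in> r" for p
    using Cons.prems(1) Cons.prems(3)[of t p] reflection_orderD(2)[OF r] by auto
  have up: "p \<in> set ts" if "t' \<in> set ts" "(t', p) \<in> r" for t' p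
    using mem that reflection_orderD(1)[OF r] by (meson transD)
  have IH: "incp n ts w (v \<circ> s) = incp n ts (w \<circ> s) v \<and>
    incp n ts w v = incp n ts (w \<circ> s) (v \<circ> s) + q * incp n ts (w \<circ> s) v"
    if "w \<in> symgrp n" "w i < w (i + 1) \<longleftrightarrow> transpose (w i) (w (i + 1)) \<in> set ts" for w
    unfolding s_def by (rule Cons.IH[OF sorted sub _ that]) (rule up)
  have us: "u \<circ> s \<in> symgrp n" "t \<circ> u \<in> symgrp n"
    using symgrp_comp[OF u symgrp_simple_refl[OF i]] symgrp_comp[OF reflections_symgrp[OF t] u]
    by (simp_all add: s_def)
  have ne: "u i \<noteq> u (i + 1)" using u by (auto simp: symgrp_def dest: permutes_neq_image[of u _ i "i + 1"])
  have s: "s i = i + 1" "s (i + 1) = i" by (simp_all add: s_def simple_refl_def)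
  have tn: "t \<notin> set ts" using mem reflection_orderD(2)[OF r] by blast
  have "incp n (t # ts) u (v \<circ> s) = incp n (t # ts) (u \<circ> s) v \<and>
    incp n (t # ts) u v = incp n (t # ts) (u \<circ> s) (v \<circ> s) + q * incp n (t # ts) (u \<circ> s) v"
  proof (cases "\<rho> u = t")
    case True
    have tu: "t \<circ> u = u \<circ> s"
      using transpose_comp_eq[OF symgrp_bij[OF u], of "u i" "u (i + 1)"] symgrp_bij[OF u] True
      by (simp add: \<rho>_def s_def simple_refl_def bij_is_inj)
    have lt: "u i < u (i + 1)" using Cons.prems(5) True by (simp add: \<rho>_def comp_apply)
    then have asc: "ascends n u t" using len_simple_refl_right(1)[OF u i] tu by (simp add: s_def)
    have tus: "t \<circ> (u \<circ> s) = u" by (simp only: tu[symmetric] reflections_cancel[OF t])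
    have nasc: "\<not> ascends n (u \<circ> s) t" using asc tu tus by simp
    have "\<rho> (u \<circ> s) = t" using True s by (simp add: \<rho>_def transpose_commute comp_apply)
    \<comment> \<open>Dropping \<open>t\<close> from the list reverses the twisted orientation of
      the edge between \<open>u\<close> and \<open>u \<circ> s\<close>, so the induction hypothesis
      is used with \<open>u \<circ> s\<close> in the place of \<open>u\<close>.\<close>
    then have "(u \<circ> s) i < (u \<circ> s) (i + 1) \<longleftrightarrow> transpose ((u \<circ> s) i) ((u \<circ> s) (i + 1)) \<in> set ts"
      using lt s tn by (simp add: \<rho>_def comp_apply)
    from IH[OF us(1) this] have
      "incp n ts (u \<circ> s) (v \<circ> s) = incp n ts u v"
      "incp n ts (u \<circ> s) v = incp n ts u (v \<circ> s) + q * incp n ts u v"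
      by (simp_all add: s_def)
    then show ?thesis using asc nasc by (simp add: tu)
  next
    case False
    have \<rho>tu: "\<rho> (t \<circ> u) = transpose (t (u i)) (t (u (i + 1)))" by (simp add: \<rho>_def comp_apply)
    have "u i < u (i + 1) \<longleftrightarrow> \<rho> u \<in> set ts"
      using Cons.prems(5) False by (auto simp: \<rho>_def comp_apply)
    from IH[OF u this[unfolded \<rho>_def]]
    have *: "incp n ts u (v \<circ> s) = incp n ts (u \<circ> s) v"
      "incp n ts u v = incp n ts (u \<circ> s) (v \<circ> s) + q * incp n ts (u \<circ> s) v" by simp_all
    \<comment> \<open>When the edge has a label other than \<open>t\<close>, both \<open>u\<close>
      and \<open>t \<circ> u\<close> satisfy the hypothesis for \<open>ts\<close>: direction and
      membership in \<open>ts\<close> change together.\<close>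
    have "(t (u i) < t (u (i + 1)) \<longleftrightarrow> u i < u (i + 1)) \<longleftrightarrow>
      ((t, \<rho> u) \<in> r \<longleftrightarrow> (t, \<rho> (t \<circ> u)) \<in> r)"
      unfolding \<rho>tu unfolding \<rho>_def
      using reflection_order_flip[OF r t symgrp_in_range[OF u i1(1)] symgrp_in_range[OF u i1(2)] ne] False
      by (simp add: \<rho>_def comp_apply)
    then have "(t \<circ> u) i < (t \<circ> u) (i + 1) \<longleftrightarrow> \<rho> (t \<circ> u) \<in> set ts"
      using Cons.prems(5) False mem by (auto simp: \<rho>_def comp_apply)
    from IH[OF us(2) this[unfolded \<rho>_def]]
    have **: "incp n ts (t \<circ> u) (v \<circ> s) = incp n ts (t \<circ> (u \<circ> s)) v"
      "incp n ts (t \<circ> u) v = incp n ts (t \<circ> (u \<circ> s)) (v \<circ> s) + q * incp n ts (t \<circ> (u \<circ> s)) v"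
      by (simp_all add: comp_assoc)
    have asc: "ascends n (u \<circ> s) t \<longleftrightarrow> ascends n u t"
      using ascends_simple_refl_right[OF u i t] False by (auto simp: \<rho>_def s_def)
    show ?thesis
    proof (cases "ascends n u t")
      case True
      then show ?thesis using asc * ** by (simp add: algebra_simps)
    next
      case False
      then show ?thesis using asc * by simp
    qed
  qed
  then show ?case unfolding s_def .
qed

text \<open>For the full list the twisted orientation is the usual one. If \<open>u\<close>
  descends, the first equation for tails is applied at the lower end
  \<open>u \<circ> simple_refl i\<close> of the edge.\<close>

lemma incp_right:
  assumes ts: "reflection_list n r ts" and i: "i \<in> {1..<n}" and uv: "u \<in> symgrp n" "v \<in> symgrp n"
    and vs: "len n (v \<circ> simple_refl i) < len n v"
  shows "incp n ts u v = (if len n u < len n (u \<circ> simple_refl i)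
    then incp n ts (u \<circ> simple_refl i) (v \<circ> simple_refl i) + q * incp n ts u (v \<circ> simple_refl i)
    else incp n ts (u \<circ> simple_refl i) (v \<circ> simple_refl i))"
proof -
  define s where "s = simple_refl i"
  have r: "reflection_order n r" and sorted: "sorted_wrt (\<lambda>s t. (s, t) \<in> r) ts"
    and set: "set ts = reflections n"
    using ts by (auto simp: reflection_list_def)
  have up: "p \<in> set ts" if "(t, p) \<in> r" for t p
    using reflection_orderD(3)[OF r] that set by auto
  have mem: "transpose (w i) (w (i + 1)) \<in> set ts" if "w \<in> symgrp n" for w
  proof -
    have "w i \<noteq> w (i + 1)"
      using that by (auto simp: symgrp_def dest: permutes_neq_image[of w _ i "i + 1"])
    then show ?thesis
      using symgrp_in_range[OF that, of i] symgrp_in_range[OF that, of "i + 1"] i set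
      by (auto intro!: transpose_in_reflections)
  qed
  have main: "incp n ts w (v \<circ> s) = incp n ts (w \<circ> s) v \<and>
    incp n ts w v = incp n ts (w \<circ> s) (v \<circ> s) + q * incp n ts (w \<circ> s) v"
    if "w \<in> symgrp n" "len n w < len n (w \<circ> s)" for w
    using incp_right_tail[OF r i uv(2) vs sorted _ up that(1)] len_simple_refl_right(1)[OF that(1) i]
      that(2) mem[OF that(1)] set by (auto simp: s_def)
  show ?thesis
  proof (cases "len n u < len n (u \<circ> s)")
    case True
    then show ?thesis using main[OF uv(1)] by (simp add: s_def)
  next
    case False
    have us: "u \<circ> s \<in> symgrp n" "u \<circ> s \<circ> s = u"
      using uv i by (auto simp: s_def intro!: symgrp_comp symgrp_simple_refl)
    have "len n (u \<circ> s) < len n (u \<circ> s \<circ> s)"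
      using False len_simple_refl_right(3)[OF uv(1) i] us by (simp add: s_def)
    then show ?thesis using main[OF us(1)] us False by (simp add: s_def)
  qed
qed

text \<open>The right-handed recursion does not mention the order, and it determines all values by
  induction on the length of \<open>v\<close>.\<close>

lemma incp_order_indep:
  assumes ts: "reflection_list n r ts" "reflection_list n r' ts'"
  shows "u \<in> symgrp n \<Longrightarrow> v \<in> symgrp n \<Longrightarrow> incp n ts u v = incp n ts' u v"
proof (induction "len n v" arbitrary: u v rule: less_induct)
  case less
  show ?case
  proof (cases "v = id")
    case True
    show ?thesis
    proof (cases "u = v")
      case False
      then have "incp n ts u v = 0" "incp n ts' u v = 0"
        using incp_neq_0D[of n _ u v] True by auto
      then show ?thesis by simp
    qed (simp add: incp_self)
  next
    case False
    then obtain i where i: "i \<in> {1..<n}" "len n (v \<circ> simple_refl i) < len n v"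
      using ex_right_descent less.prems by blast
    have "u \<circ> simple_refl i \<in> symgrp n" "v \<circ> simple_refl i \<in> symgrp n"
      using less.prems i by (auto intro!: symgrp_comp symgrp_simple_refl)
    then show ?thesis
      using incp_right[OF ts(1) i(1) less.prems i(2)] incp_right[OF ts(2) i(1) less.prems i(2)]
        less.hyps[OF i(2)] less.prems by simp
  qed
qed

lemma ex_sorted_list:
  assumes "finite A" and "trans r" "irrefl r" "total_on A r"
  shows "\<exists>ts. sorted_wrt (\<lambda>s t. (s, t) \<in> r) ts \<and> set ts = A"
  using assms(1,4)
proof (induction A rule: finite_induct)
  case (insert x A)
  have "total_on A r" using insert.prems by (auto simp: total_on_def)
  then obtain ts where ts: "sorted_wrt (\<lambda>s t. (s, t) \<in> r) ts" "set ts = A"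
    using insert.IH by blast
  define us where "us = filter (\<lambda>y. (y, x) \<in> r) ts @ x # filter (\<lambda>y. (x, y) \<in> r) ts"
  have "sorted_wrt (\<lambda>s t. (s, t) \<in> r) us"
    using ts(1) assms(2) by (auto simp: us_def sorted_wrt_append sorted_wrt_filter dest: transD)
  moreover have "set us = insert x A"
    using ts(2) insert.hyps(2) insert.prems by (auto simp: us_def total_on_def)
  ultimately show ?case by blast
qed simp

lemma ex_reflection_list:
  assumes "reflection_order n r"
  obtains ts where "reflection_list n r ts"
proof -
  have "\<exists>ts. sorted_wrt (\<lambda>s t. (s, t) \<in> r) ts \<and> set ts = reflections n"
    using assms unfolding reflection_order_def strict_linear_order_on_def
    by (intro ex_sorted_list finite_reflections) auto
  then show ?thesis using that assms by (auto simp: reflection_list_def)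
qed

section \<open>Reflection orders with a given simple reflection at the front or at the end\<close>

definition lo :: "(nat \<Rightarrow> nat) \<Rightarrow> nat" where "lo t = (LEAST k. t k \<noteq> k)"
definition hi :: "(nat \<Rightarrow> nat) \<Rightarrow> nat" where "hi t = t (lo t)"

lemma lo_hi_transpose:
  assumes "a < b" shows "lo (transpose a b) = a" "hi (transpose a b) = b"
proof -
  show 1: "lo (transpose a b) = a"
    unfolding lo_def
  proof (rule Least_equality)
    show "transpose a b a \<noteq> a" using assms by simp
    show "\<And>y. transpose a b y \<noteq> y \<Longrightarrow> a \<le> y"
      using assms by (auto simp: transpose_def split: if_splits)
  qed
  show "hi (transpose a b) = b" by (simp add: hi_def 1)
qed

lemma transpose_inject:
  fixes a b c d :: nat
  assumes "a < b" "c < d" "transpose a b = transpose c d"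
  shows "a = c" "b = d"
  using lo_hi_transpose[OF assms(1)] lo_hi_transpose[OF assms(2)] assms(3) by simp_all

text \<open>
  The lexicographic order, modified by swapping the second entries \<open>i\<close> and \<open>i + 1\<close>
  and by moving the simple reflection \<open>s\<^sub>i\<close> to the front.
\<close>

definition simple_first_less :: "nat \<Rightarrow> (nat \<Rightarrow> nat) \<Rightarrow> (nat \<Rightarrow> nat) \<Rightarrow> bool" where
  "simple_first_less i t t' \<longleftrightarrow> t = simple_refl i \<and> t' \<noteq> simple_refl i \<or>
    t \<noteq> simple_refl i \<and> t' \<noteq> simple_refl i \<and>
    (lo t < lo t' \<or> lo t = lo t' \<and> simple_refl i (hi t) < simple_refl i (hi t'))"

text \<open>In a triple \<open>a < i < i + 1\<close> the simple reflection is at one end. Moving it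
  to the front forces \<open>transpose a (i + 1)\<close> to precede \<open>transpose a i\<close>,
  which explains the swapped second entries.\<close>

lemma ex_reflection_order_simple_first:
  assumes i: "i \<in> {1..<n}"
  obtains r where "reflection_order n r"
    "\<And>t. t \<in> reflections n \<Longrightarrow> t \<noteq> simple_refl i \<Longrightarrow> (simple_refl i, t) \<in> r"
proof -
  define r where "r = {(t, t'). t \<in> reflections n \<and> t' \<in> reflections n \<and> simple_first_less i t t'}"
  have "trans r"
    by (rule transI) (auto simp: r_def simple_first_less_def)
  moreover have "irrefl r"
    by (auto simp: r_def simple_first_less_def irrefl_def)
  moreover have "total_on (reflections n) r"
  proof (rule total_onI)
    fix t t' assume t: "t \<in> reflections n" "t' \<in> reflections n" "t \<noteq> t'"
    have "lo t \<noteq> lo t' \<or> hi t \<noteq> hi t'"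
      using t by (auto elim!: reflectionsE simp: lo_hi_transpose)
    moreover have "simple_refl i k \<noteq> simple_refl i l" if "k \<noteq> l" for k l
      using that by (simp add: simple_refl_def inj_eq)
    ultimately show "(t, t') \<in> r \<or> (t', t) \<in> r"
      using t unfolding r_def simple_first_less_def by (auto simp: neq_iff)
  qed
  moreover have "(transpose a b, transpose a c) \<in> r \<and> (transpose a c, transpose b c) \<in> r \<or>
    (transpose b c, transpose a c) \<in> r \<and> (transpose a c, transpose a b) \<in> r"
    if "1 \<le> a" "a < b" "b < c" "c \<le> n" for a b c
  proof -
    have eq: "transpose k l = simple_refl i \<longleftrightarrow> k = i \<and> l = i + 1" if "k < l" for k l
      using that transpose_inject[of k l i "i + 1"] by (auto simp: simple_refl_def)
    have R: "transpose a b \<in> reflections n" "transpose a c \<in> reflections n" "transpose b c \<in> reflections n"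
      using that by (auto intro!: transpose_in_reflections)
    have lt: "a < b" "a < c" "b < c" using that by auto
    show ?thesis
      using R lt that unfolding r_def simple_first_less_def
      by (simp add: eq lo_hi_transpose) (auto simp: simple_refl_def transpose_def)
  qed
  ultimately have "reflection_order n r"
    unfolding reflection_order_def strict_linear_order_on_def by (auto simp: r_def)
  moreover have "(simple_refl i, t) \<in> r" if "t \<in> reflections n" "t \<noteq> simple_refl i" for t
    using that simple_refl_in_reflections[OF i] by (auto simp: r_def simple_first_less_def)
  ultimately show ?thesis using that by blast
qed

definition conj_refl :: "nat \<Rightarrow> (nat \<Rightarrow> nat) \<Rightarrow> nat \<Rightarrow> nat" where
  "conj_refl i t = simple_refl i \<circ> t \<circ> simple_refl i"

lemma conj_refl_transpose: "conj_refl i (transpose a b) = transpose (simple_refl i a) (simple_refl i b)"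
proof -
  have *: "transpose (simple_refl i a) (simple_refl i b) \<circ> simple_refl i = simple_refl i \<circ> transpose a b"
    using transpose_comp_eq[of "simple_refl i" "simple_refl i a" "simple_refl i b"]
    by (simp add: simple_refl_def)
  show ?thesis unfolding conj_refl_def by (simp only: *[symmetric] comp_simple_refl_cancel)
qed

lemma conj_refl_conj_refl [simp]: "conj_refl i (conj_refl i t) = t"
  by (auto simp: conj_refl_def fun_eq_iff simple_refl_def comp_apply)

lemma conj_refl_simple_refl [simp]: "conj_refl i (simple_refl i) = simple_refl i"
  by (auto simp: conj_refl_def fun_eq_iff simple_refl_def comp_apply)

lemma conj_refl_reflections:
  assumes "i \<in> {1..<n}" "t \<in> reflections n" shows "conj_refl i t \<in> reflections n"
proof -
  obtain a b where ab: "t = transpose a b" "1 \<le> a" "a < b" "b \<le> n"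
    using assms(2) by (rule reflectionsE)
  have "simple_refl i a \<noteq> simple_refl i b" using ab by (simp add: simple_refl_def inj_eq)
  moreover have "simple_refl i k \<in> {1..n}" if "k \<in> {1..n}" for k
    using symgrp_in_range[OF symgrp_simple_refl[OF assms(1)] that] .
  ultimately show ?thesis using ab
    by (auto simp: conj_refl_transpose intro!: transpose_in_reflections)
qed

lemma conj_refl_image_reflections:
  assumes "i \<in> {1..<n}"
  shows "conj_refl i ` (reflections n - {simple_refl i}) = reflections n - {simple_refl i}"
proof -
  have "conj_refl i t = simple_refl i \<longleftrightarrow> t = simple_refl i" for t
    by (metis conj_refl_conj_refl conj_refl_simple_refl)
  then have maps: "conj_refl i t \<in> reflections n - {simple_refl i}"
    if "t \<in> reflections n - {simple_refl i}" for t
    using conj_refl_reflections[OF assms] that by simp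
  show ?thesis
  proof (intro equalityI subsetI)
    fix t assume "t \<in> reflections n - {simple_refl i}"
    then show "t \<in> conj_refl i ` (reflections n - {simple_refl i})"
      using maps[of t] by (intro image_eqI[of _ _ "conj_refl i t"]) simp_all
  next
    fix t' assume "t' \<in> conj_refl i ` (reflections n - {simple_refl i})"
    then show "t' \<in> reflections n - {simple_refl i}" by (rule imageE) (simp only: maps)
  qed
qed

text \<open>Conjugation preserves the order of the points of a triple unless it contains both
  \<open>i\<close> and \<open>i + 1\<close>. In such a triple the simple reflection moves from the
  front to the end, while conjugation exchanges the other two; the result is the reversed order of
  the triple.\<close>

lemma reflection_order_conj:
  assumes i: "i \<in> {1..<n}" and r: "reflection_order n r"
    and first: "\<And>t. t \<in> reflections n \<Longrightarrow> t \<noteq> simple_refl i \<Longrightarrow> (simple_refl i, t) \<in> r"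
  defines "r' \<equiv> {(t, t'). t \<in> reflections n \<and> t' \<in> reflections n \<and> t \<noteq> simple_refl i \<and>
    (t' = simple_refl i \<or> (conj_refl i t, conj_refl i t') \<in> r)}"
  shows "reflection_order n r'"
proof -
  define s where "s = simple_refl i"
  have inj: "conj_refl i t = conj_refl i t' \<longleftrightarrow> t = t'" for t t'
    by (metis conj_refl_conj_refl)
  note D = reflection_orderD[OF r]
  note cr = conj_refl_reflections[OF i]
  have r': "(t, t') \<in> r' \<longleftrightarrow> t \<in> reflections n \<and> t' \<in> reflections n \<and> t \<noteq> s \<and>
    (t' = s \<or> (conj_refl i t, conj_refl i t') \<in> r)" for t t'
    by (simp add: r'_def s_def)
  have "trans r'"
  proof (rule transI)
    fix t1 t2 t3 assume "(t1, t2) \<in> r'" "(t2, t3) \<in> r'"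
    then show "(t1, t3) \<in> r'" unfolding r' using D(1) by (metis transD)
  qed
  moreover have "irrefl r'" using D(2) by (auto simp: irrefl_def r')
  moreover have "total_on (reflections n) r'"
  proof (rule total_onI)
    fix t t' assume t: "t \<in> reflections n" "t' \<in> reflections n" "t \<noteq> t'"
    then show "(t, t') \<in> r' \<or> (t', t) \<in> r'"
      using D(4)[OF cr[OF t(1)] cr[OF t(2)]] inj unfolding r' by metis
  qed
  moreover have "(transpose a b, transpose a c) \<in> r' \<and> (transpose a c, transpose b c) \<in> r' \<or>
    (transpose b c, transpose a c) \<in> r' \<and> (transpose a c, transpose a b) \<in> r'"
    if abc: "1 \<le> a" "a < b" "b < c" "c \<le> n" for a b c
  proof -
    have eq: "transpose k l = s \<longleftrightarrow> k = i \<and> l = i + 1" if "k < l" for k l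
      using that transpose_inject[of k l i "i + 1"] by (auto simp: simple_refl_def s_def)
    have R: "transpose a b \<in> reflections n" "transpose a c \<in> reflections n" "transpose b c \<in> reflections n"
      using abc by (auto intro!: transpose_in_reflections)
    have s: "s k = (if k = i then i + 1 else if k = i + 1 then i else k)" for k
      by (simp add: s_def simple_refl_def transpose_def)
    have conj: "conj_refl i (transpose k l) = transpose (s k) (s l)" for k l
      by (simp add: conj_refl_transpose s_def)
    have range: "s k \<in> {1..n}" if "k \<in> {1..n}" for k
      using symgrp_in_range[OF symgrp_simple_refl[OF i] that] by (simp add: s_def)
    consider "a = i" "b = i + 1" | "b = i" "c = i + 1" |
      "\<not> (a = i \<and> b = i + 1)" "\<not> (b = i \<and> c = i + 1)" by blast
    then show ?thesis
    proof cases
      case 1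
      have "(transpose i (i + 1), transpose (i + 1) c) \<in> r"
        using first[OF R(3)] eq[of b c] 1 abc by (simp add: s_def simple_refl_def)
      then have "(transpose i c, transpose (i + 1) c) \<in> r"
        using reflection_order_triple[OF r, of i "i + 1" c] 1 abc D(5) by auto
      then show ?thesis using R 1 abc by (simp add: r' conj eq s)
    next
      case 2
      have "(transpose i (i + 1), transpose a (i + 1)) \<in> r"
        using first[OF R(2)] eq[of a c] 2 abc by (simp add: s_def simple_refl_def)
      then have "(transpose a (i + 1), transpose a i) \<in> r"
        using reflection_order_triple[OF r, of a i "i + 1"] 2 abc D(5) by auto
      then show ?thesis using R 2 abc by (simp add: r' conj eq s)
    next
      case 3
      have "s a < s b" "s b < s c" using 3 abc by (auto simp: s)
      moreover have "transpose a b \<noteq> s" "transpose a c \<noteq> s" "transpose b c \<noteq> s"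
        using 3 abc by (auto simp: eq)
      ultimately show ?thesis
        using R reflection_order_triple[OF r, of "s a" "s b" "s c"] range[of a] range[of c] abc
        by (auto simp: r' conj)
    qed
  qed
  ultimately show ?thesis
    unfolding reflection_order_def strict_linear_order_on_def by (auto simp: r')
qed

text \<open>Left multiplication by \<open>simple_refl i\<close> renames values, and it preserves the
  order of any pair of values other than \<open>i\<close>, \<open>i + 1\<close>.\<close>

lemma ascends_conj:
  assumes i: "i \<in> {1..<n}" and u: "u \<in> symgrp n" and t: "t \<in> reflections n" "t \<noteq> simple_refl i"
  shows "ascends n (simple_refl i \<circ> u) (conj_refl i t) \<longleftrightarrow> ascends n u t"
proof -
  define s where "s = simple_refl i"
  obtain a b where ab: "t = transpose a b" "1 \<le> a" "a < b" "b \<le> n"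
    using t(1) by (rule reflectionsE)
  have "\<not> (a = i \<and> b = i + 1)" using t(2) ab by (auto simp: simple_refl_def)
  then have lt: "s a < s b" using ab by (auto simp: s_def simple_refl_def transpose_def)
  have rng: "1 \<le> s a" "s b \<le> n"
    using symgrp_in_range[OF symgrp_simple_refl[OF i], of a]
      symgrp_in_range[OF symgrp_simple_refl[OF i], of b] ab by (auto simp: s_def)
  have su: "s \<circ> u \<in> symgrp n" using i u by (auto simp: s_def intro!: symgrp_comp symgrp_simple_refl)
  have inv: "inv (s \<circ> u) = inv u \<circ> s"
    using symgrp_bij[OF u] by (simp add: s_def o_inv_distrib simple_refl_def)
  have "inv (s \<circ> u) (s k) = inv u k" for k
    by (simp add: inv comp_apply) (simp add: s_def simple_refl_def)
  moreover have "conj_refl i t = transpose (s a) (s b)"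
    by (simp add: ab conj_refl_transpose s_def)
  ultimately have "ascends n (s \<circ> u) (conj_refl i t) \<longleftrightarrow> ascends n u t"
    using len_less_transpose_iff[OF u ab(2-4)] len_less_transpose_iff[OF su rng(1) lt rng(2)] ab(1)
    by simp
  then show ?thesis unfolding s_def .
qed

lemma incp_conj:
  assumes i: "i \<in> {1..<n}"
  shows "set ts \<subseteq> reflections n - {simple_refl i} \<Longrightarrow> u \<in> symgrp n \<Longrightarrow>
    incp n (map (conj_refl i) ts) (simple_refl i \<circ> u) (simple_refl i \<circ> v) = incp n ts u v"
proof (induction ts arbitrary: u)
  case Nil
  have "simple_refl i \<circ> u = simple_refl i \<circ> v \<longleftrightarrow> u = v"
    by (metis simple_refl_comp_cancel)
  then have "incp n (map (conj_refl i) []) (simple_refl i \<circ> u) (simple_refl i \<circ> v) = incp n [] u v"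
    by simp
  then show ?case .
next
  case (Cons t ts)
  have t: "t \<in> reflections n" "t \<noteq> simple_refl i" using Cons.prems by auto
  have tu: "t \<circ> u \<in> symgrp n" using symgrp_comp[OF reflections_symgrp[OF t(1)] Cons.prems(2)] .
  have *: "conj_refl i t \<circ> (simple_refl i \<circ> u) = simple_refl i \<circ> (t \<circ> u)"
    by (simp add: conj_refl_def comp_assoc)
  have sub: "set ts \<subseteq> reflections n - {simple_refl i}" using Cons.prems by auto
  have "incp n (map (conj_refl i) (t # ts)) (simple_refl i \<circ> u) (simple_refl i \<circ> v) = incp n (t # ts) u v"
    using ascends_conj[OF i Cons.prems(2) t] Cons.IH[OF sub Cons.prems(2)] Cons.IH[OF sub tu]
    by (simp add: *)
  then show ?case .
qed

text \<open>Compare an order with \<open>s\<close> first and its conjugate with \<open>s\<close>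
  last: in the first \<open>s\<close> can only begin a path, in the second only end it. Paths
  avoiding \<open>s\<close> correspond under conjugation, and eliminating their polynomials leaves
  the recursion.\<close>

lemma incp_left:
  assumes ts: "reflection_list n r0 ts" and i: "i \<in> {1..<n}" and uv: "u \<in> symgrp n" "v \<in> symgrp n"
    and sv: "len n (simple_refl i \<circ> v) < len n v"
  shows "incp n ts u v = (if len n u < len n (simple_refl i \<circ> u)
    then incp n ts (simple_refl i \<circ> u) (simple_refl i \<circ> v) + q * incp n ts u (simple_refl i \<circ> v)
    else incp n ts (simple_refl i \<circ> u) (simple_refl i \<circ> v))"
proof -
  define s where "s = simple_refl i"
  have s: "s \<in> reflections n" using simple_refl_in_reflections[OF i] by (simp add: s_def)
  obtain r where r: "reflection_order n r"
    and first: "\<And>t. t \<in> reflections n \<Longrightarrow> t \<noteq> simple_refl i \<Longrightarrow> (simple_refl i, t) \<in> r"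
    using ex_reflection_order_simple_first[OF i] by blast
  define r' where "r' = {(t, t'). t \<in> reflections n \<and> t' \<in> reflections n \<and> t \<noteq> simple_refl i \<and>
    (t' = simple_refl i \<or> (conj_refl i t, conj_refl i t') \<in> r)}"
  have r': "reflection_order n r'"
    unfolding r'_def by (rule reflection_order_conj[OF i r first])
  have "\<exists>ts. sorted_wrt (\<lambda>s t. (s, t) \<in> r) ts \<and> set ts = reflections n - {s}"
    using r unfolding reflection_order_def strict_linear_order_on_def
    by (intro ex_sorted_list) (auto intro: finite_reflections simp: total_on_def)
  then obtain cs where cs: "sorted_wrt (\<lambda>s t. (s, t) \<in> r) cs" "set cs = reflections n - {s}"
    by blast
  define cs' where "cs' = map (conj_refl i) cs"
  have setcs': "set cs' = reflections n - {s}"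
    using conj_refl_image_reflections[OF i] cs(2) by (simp add: cs'_def s_def)
  have L: "reflection_list n r (s # cs)"
    using r cs first s by (auto simp: reflection_list_def s_def)
  have "sorted_wrt (\<lambda>s t. (s, t) \<in> r') cs'"
    unfolding cs'_def sorted_wrt_map
    by (rule sorted_wrt_mono_rel[OF _ cs(1)])
      (use cs(2) setcs' in \<open>auto simp: r'_def cs'_def s_def\<close>)
  then have L': "reflection_list n r' (cs' @ [s])"
    using r' setcs' s by (auto simp: reflection_list_def sorted_wrt_append r'_def s_def)
  \<comment> \<open>\<open>N\<close> and \<open>N'\<close> count the paths that avoid
    \<open>s\<close> in the two orders, whereas \<open>P\<close> is the same for both.\<close>
  define P N N' where "P = incp n ts" and "N = incp n cs" and "N' = incp n cs'"
  have S: "s \<circ> w \<in> symgrp n" if "w \<in> symgrp n" for w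
    using symgrp_comp[OF reflections_symgrp[OF s] that] .
  have ss: "s \<circ> (s \<circ> w) = w" for w by (simp add: s_def)
  have A: "P a b = N a b + (if len n a < len n (s \<circ> a) then q * N (s \<circ> a) b else 0)"
    if "a \<in> symgrp n" "b \<in> symgrp n" for a b
    using incp_order_indep[OF ts L that] by (simp add: P_def N_def)
  have B: "P a b = N' a b + (if len n (s \<circ> b) < len n b then q * N' a (s \<circ> b) else 0)"
    if "a \<in> symgrp n" "b \<in> symgrp n" for a b
    using incp_order_indep[OF ts L' that] incp_append[of cs' n s a b] that s setcs'
    by (simp add: P_def N'_def)
  have C: "N' (s \<circ> a) (s \<circ> b) = N a b" if "a \<in> symgrp n" for a b
    using incp_conj[OF i _ that, of cs b] cs(2) by (simp add: N_def N'_def cs'_def s_def)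
  have sv': "len n (s \<circ> v) < len n v" using sv by (simp add: s_def)
  have "P u v = (if len n u < len n (s \<circ> u) then P (s \<circ> u) (s \<circ> v) + q * P u (s \<circ> v)
    else P (s \<circ> u) (s \<circ> v))"
  proof (cases "len n u < len n (s \<circ> u)")
    case True
    have "P u v = N' u v + q * N' u (s \<circ> v)" using B[OF uv] sv' by simp
    moreover have "P (s \<circ> u) (s \<circ> v) = N' u v"
      using A[OF S S, OF uv] C[OF S[OF uv(1)], of "s \<circ> v"] True by (simp add: ss)
    moreover have "P u (s \<circ> v) = N' u (s \<circ> v)"
      using B[OF uv(1) S[OF uv(2)]] sv' by (simp add: ss)
    ultimately show ?thesis using True by simp
  next
    case False
    have "P u v = N u v" using A[OF uv] False by simp
    moreover have "P (s \<circ> u) (s \<circ> v) = N u v"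
      using B[OF S S, OF uv] C[OF uv(1), of v] sv' by (simp add: ss)
    ultimately show ?thesis using False by simp
  qed
  then show ?thesis unfolding P_def s_def .
qed

section \<open>The \<open>R\<close>-polynomials as increasing path polynomials\<close>

lemma bruhat_arc_iff:
  "x \<rightarrow>\<^bsub>bruhat_graph n\<^esub> y \<longleftrightarrow>
    x \<in> symgrp n \<and> y \<in> symgrp n \<and> y \<circ> inv x \<in> reflections n \<and> len n x < len n y"
  by (simp add: bruhat_graph_def)

lemma verts_bruhat_graph [simp]: "verts (bruhat_graph n) = symgrp n"
  by (simp add: bruhat_graph_def)

lemma reflection_comp_inv:
  assumes "x \<in> symgrp n" shows "t \<circ> x \<circ> inv x = t"
  using symgrp_bij[OF assms] by (metis bij_is_surj comp_assoc comp_id surj_iff)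

lemma bruhat_arcI:
  assumes "x \<in> symgrp n" "t \<in> reflections n" "ascends n x t"
  shows "x \<rightarrow>\<^bsub>bruhat_graph n\<^esub> (t \<circ> x)" "edge_label x (t \<circ> x) = t"
  using assms symgrp_comp[OF reflections_symgrp[OF assms(2)] assms(1)]
  by (simp_all add: bruhat_arc_iff reflection_comp_inv edge_label_def)

lemma bruhat_arcD:
  assumes "x \<rightarrow>\<^bsub>bruhat_graph n\<^esub> y"
  shows "x \<in> symgrp n" "y \<in> symgrp n" "edge_label x y \<in> reflections n"
    "y = edge_label x y \<circ> x" "ascends n x (edge_label x y)" "len n x < len n y"
proof -
  show x: "x \<in> symgrp n" and "y \<in> symgrp n" and "edge_label x y \<in> reflections n"
    and lt: "len n x < len n y"
    using assms by (auto simp: bruhat_arc_iff edge_label_def)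
  show y: "y = edge_label x y \<circ> x"
    using symgrp_bij[OF x] by (simp add: edge_label_def comp_assoc bij_is_inj)
  show "ascends n x (edge_label x y)" using lt y by simp
qed

lemma bruhat_leD:
  assumes "bruhat_le n x y"
  shows "x \<in> symgrp n" "y \<in> symgrp n" "x = y \<or> len n x < len n y"
proof -
  have *: "(x, y) \<in> rtrancl_on (symgrp n) (arcs_ends (bruhat_graph n))"
    using assms by (simp add: bruhat_le_def reachable_def)
  then show "x \<in> symgrp n" "y \<in> symgrp n" by (auto dest: in_rtrancl_on_in_F)
  show "x = y \<or> len n x < len n y"
    using * by (induction rule: rtrancl_on_induct) (auto dest: bruhat_arcD(6))
qed

lemma bruhat_le_refl: "x \<in> symgrp n \<Longrightarrow> bruhat_le n x x"
  by (simp add: bruhat_le_def reachable_def)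

lemma bruhat_le_trans: "bruhat_le n x y \<Longrightarrow> bruhat_le n y z \<Longrightarrow> bruhat_le n x z"
  unfolding bruhat_le_def reachable_def by (rule rtrancl_on_trans)

lemma bruhat_le_arc:
  assumes "x \<rightarrow>\<^bsub>bruhat_graph n\<^esub> y"
  shows "bruhat_le n x y"
  unfolding bruhat_le_def reachable_def using assms bruhat_arcD(1,2)[OF assms]
  by (auto intro: rtrancl_on_into_rtrancl_on[of x x])

lemma bruhat_le_ascends:
  "x \<in> symgrp n \<Longrightarrow> t \<in> reflections n \<Longrightarrow> ascends n x t \<Longrightarrow> bruhat_le n x (t \<circ> x)"
  by (rule bruhat_le_arc[OF bruhat_arcI(1)])

lemma bruhat_lessD:
  assumes "bruhat_less n x y"
  shows "x \<in> symgrp n" "y \<in> symgrp n" "len n x < len n y"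
  using assms bruhat_leD[of n x y] by (auto simp: bruhat_less_def)

lemma bruhat_less_simple_refl_iff:
  assumes u: "u \<in> symgrp n" and i: "i \<in> {1..<n}"
  shows "bruhat_less n (simple_refl i \<circ> u) u \<longleftrightarrow> len n (simple_refl i \<circ> u) < len n u"
proof
  assume lt: "len n (simple_refl i \<circ> u) < len n u"
  have "bruhat_le n (simple_refl i \<circ> u) (simple_refl i \<circ> (simple_refl i \<circ> u))"
    by (rule bruhat_le_ascends)
      (use lt symgrp_comp[OF symgrp_simple_refl[OF i] u] simple_refl_in_reflections[OF i] in simp_all)
  then show "bruhat_less n (simple_refl i \<circ> u) u"
    using lt by (auto simp: bruhat_less_def)
qed (rule bruhat_lessD)

lemma incp_bruhat_le:
  "set ts \<subseteq> reflections n \<Longrightarrow> u \<in> symgrp n \<Longrightarrow> incp n ts u v \<noteq> 0 \<Longrightarrow> bruhat_le n u v"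
proof (induction ts arbitrary: u)
  case Nil
  then show ?case by (auto split: if_splits intro: bruhat_le_refl)
next
  case (Cons t ts)
  have t: "t \<in> reflections n" using Cons.prems by simp
  have "incp n ts u v \<noteq> 0 \<or> ascends n u t \<and> incp n ts (t \<circ> u) v \<noteq> 0"
    using Cons.prems(3) by (auto split: if_splits)
  then show ?case
  proof
    assume "incp n ts u v \<noteq> 0"
    then show ?thesis using Cons.IH Cons.prems by simp
  next
    assume *: "ascends n u t \<and> incp n ts (t \<circ> u) v \<noteq> 0"
    then have "bruhat_le n (t \<circ> u) v"
      using Cons.IH[of "t \<circ> u"] Cons.prems symgrp_comp[OF reflections_symgrp[OF t], of u] by simp
    then show ?thesis using bruhat_le_ascends[OF Cons.prems(2) t] * bruhat_le_trans by blast
  qed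
qed

section \<open>Evaluation of integer polynomials at Laurent series\<close>

definition ev :: "int fls \<Rightarrow> int poly \<Rightarrow> int fls" where
  "ev e p = poly (map_poly of_int p) e"

lemma ev_0 [simp]: "ev e 0 = 0"
  by (simp add: ev_def)

lemma ev_pCons: "ev e (pCons a p) = of_int a + e * ev e p"
  by (simp add: ev_def map_poly_pCons)

lemma ev_1 [simp]: "ev e 1 = 1"
  using ev_pCons[of e 1 0] by (simp add: one_pCons)

lemma ev_add: "ev e (p + p') = ev e p + ev e p'"
proof -
  have "map_poly of_int (p + p') = (map_poly of_int p + map_poly of_int p' :: int fls poly)"
    by (intro poly_eqI) (simp add: coeff_map_poly)
  then show ?thesis by (simp add: ev_def)
qed

lemma ev_smult: "ev e (smult a p) = of_int a * ev e p"
  by (induction p) (simp_all add: ev_pCons algebra_simps)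

lemma ev_mult: "ev e (p * p') = ev e p * ev e p'"
  by (induction p) (simp_all add: ev_pCons ev_add ev_smult algebra_simps)

lemma ev_diff: "ev e (p - p') = ev e p - ev e p'"
  using ev_add[of e "p - p'" p'] by simp

lemma ev_power: "ev e (p ^ k) = ev e p ^ k"
  by (induction k) (simp_all add: ev_mult)

lemma of_int_fls_neq_0: "a \<noteq> 0 \<Longrightarrow> (of_int a :: int fls) \<noteq> 0"
  by (auto simp: fls_eq_iff fls_of_int_nth)

text \<open>At an element with a pole the term of highest degree has the deepest pole and cannot
  cancel. At an element of positive order the lowest nonzero term plays this part.\<close>

lemma ev_neq_0_neg:
  assumes "fls_subdegree e < 0"
  shows "p \<noteq> 0 \<Longrightarrow> ev e p \<noteq> 0 \<and> fls_subdegree (ev e p) \<le> 0"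
proof (induction p)
  case (pCons a p)
  show ?case
  proof (cases "p = 0")
    case True
    then show ?thesis using pCons of_int_fls_neq_0 by (auto simp: ev_pCons)
  next
    case False
    have e: "e \<noteq> 0" using assms by auto
    have ne: "e * ev e p \<noteq> 0" and sd: "fls_subdegree (e * ev e p) < 0"
      using pCons False e assms by simp_all
    then have "fls_subdegree (of_int a + e * ev e p) = fls_subdegree (e * ev e p)"
      by (intro fls_subdegree_add_eq2) simp_all
    then have "fls_subdegree (ev e (pCons a p)) < 0" using sd by (simp add: ev_pCons)
    then show ?thesis by auto
  qed
qed simp

lemma ev_neq_0_pos:
  assumes "fls_subdegree e > 0"
  shows "p \<noteq> 0 \<Longrightarrow> ev e p \<noteq> 0 \<and> fls_subdegree (ev e p) \<ge> 0"
proof (induction p)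
  case (pCons a p)
  have e: "e \<noteq> 0" using assms by auto
  show ?case
  proof (cases "p = 0")
    case True
    then show ?thesis using pCons of_int_fls_neq_0 by (auto simp: ev_pCons)
  next
    case False
    then have sd: "fls_subdegree (e * ev e p) > 0" and ne: "e * ev e p \<noteq> 0"
      using pCons e assms by simp_all
    show ?thesis
    proof (cases "a = 0")
      case True
      then show ?thesis using sd ne by (simp add: ev_pCons)
    next
      case False
      then have "fls_subdegree (of_int a + e * ev e p) = 0"
        using sd of_int_fls_neq_0[of a] fls_subdegree_add_eq1[of "of_int a" "e * ev e p"] by simp
      moreover have "of_int a + e * ev e p \<noteq> 0"
      proof
        assume "of_int a + e * ev e p = 0"
        then have "e * ev e p = - of_int a" by (simp add: eq_neg_iff_add_eq_0 add.commute)
        then show False using sd by (metis fls_subdegree_of_int fls_uminus_subdegree less_irrefl)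
      qed
      ultimately show ?thesis by (simp add: ev_pCons)
    qed
  qed
qed simp

text \<open>A Laurent series of nonzero order is transcendental. This is used at \<open>X2\<close>,
  to recover \<open>R\<close>, and at \<open>Xz\<close>, to recover its modified form.\<close>

lemma ev_inject:
  assumes "fls_subdegree e \<noteq> 0" "ev e p = ev e p'"
  shows "p = p'"
proof -
  have "ev e (p - p') = 0" using assms(2) by (simp add: ev_diff)
  then have "p - p' = 0"
    using assms(1) ev_neq_0_neg[of e "p - p'"] ev_neq_0_pos[of e "p - p'"] by (meson linorder_neqE)
  then show ?thesis by simp
qed

section \<open>The identity relating an R-polynomial to its modified form\<close>

abbreviation X2 :: "int fls" where "X2 \<equiv> fls_X ^ 2"
abbreviation Xz :: "int fls" where "Xz \<equiv> fls_X - fls_X_inv"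

lemma fls_subdegree_X2: "fls_subdegree X2 = 2"
  by simp

lemma fls_subdegree_Xz: "fls_subdegree Xz = - 1"
  using fls_subdegree_diff_eq2[of fls_X_inv "fls_X :: int fls"] by simp

lemma X_times_Xz: "fls_X * Xz = X2 - 1"
proof -
  have "fls_X * fls_X_inv = (1 :: int fls)"
    by (simp add: fls_X_inv_times_conv_shift)
  then show ?thesis by (simp add: algebra_simps power2_eq_square)
qed

lemma X_eq_intpow: "(fls_X :: int fls) = fls_X_intpow 1"
  by (simp add: fls_X_conv_shift_1)

lemma X2_power: "X2 ^ j = fls_X_intpow (2 * int j)"
  by (simp add: X_eq_intpow fls_X_intpow_power mult.commute flip: power_mult)

text \<open>In terms of \<open>q = X ^ 2\<close> this turns the weight of one path step into a
  factor \<open>q - 1\<close>.\<close>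

lemma intpow_Suc: "fls_X_intpow (k + 1) * Xz = fls_X_intpow k * (X2 - 1)"
proof -
  have "fls_X_intpow (k + 1) * Xz = fls_X_intpow k * (fls_X_intpow 1 * Xz)"
    by (simp only: fls_X_intpow_times_fls_X_intpow[symmetric] mult.assoc)
  then show ?thesis using X_times_Xz unfolding X_eq_intpow by simp
qed

definition is_R :: "nat \<Rightarrow> (nat \<Rightarrow> nat) \<Rightarrow> (nat \<Rightarrow> nat) \<Rightarrow> int poly \<Rightarrow> int poly \<Rightarrow> bool" where
  "is_R n u v P R \<longleftrightarrow> ev X2 R = fls_X_intpow (int (len n v) - int (len n u)) * ev Xz P"

lemma is_R_unique: "is_R n u v P R \<Longrightarrow> is_R n u v P R' \<Longrightarrow> R = R'"
  using ev_inject[of X2 R R'] by (simp add: is_R_def)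

lemma ev_q: "ev e q = e"
  by (simp add: ev_pCons)

lemma ev_q_minus_1: "ev e [:-1, 1:] = e - 1"
  by (simp add: ev_pCons)

text \<open>An edge raises the length by an odd number \<open>2 * j + 1\<close> and thus contributes
  \<open>(q - 1) * q ^ j\<close>, so no half-integral power of \<open>q\<close> remains.\<close>

lemma ex_R:
  "set ts \<subseteq> reflections n \<Longrightarrow> u \<in> symgrp n \<Longrightarrow> \<exists>R. is_R n u v (incp n ts u v) R"
proof (induction ts arbitrary: u)
  case Nil
  show ?case
  proof (cases "u = v")
    case True
    then show ?thesis by (intro exI[of _ 1]) (simp add: is_R_def)
  next
    case False
    then show ?thesis by (intro exI[of _ 0]) (simp add: is_R_def)
  qed
next
  case (Cons t ts)
  have t: "t \<in> reflections n" using Cons.prems by simp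
  have tu: "t \<circ> u \<in> symgrp n" using symgrp_comp[OF reflections_symgrp[OF t] Cons.prems(2)] .
  obtain R1 where R1: "is_R n u v (incp n ts u v) R1" using Cons by auto
  show ?case
  proof (cases "ascends n u t")
    case True
    obtain R2 where R2: "is_R n (t \<circ> u) v (incp n ts (t \<circ> u) v) R2" using Cons tu by auto
    have "odd (len n (t \<circ> u) - len n u)"
      using odd_len_reflection[OF Cons.prems(2) t] True by (auto simp: even_add)
    then obtain j where j: "len n (t \<circ> u) - len n u = 2 * j + 1" by (rule oddE)
    define l where "l = int (len n v) - int (len n (t \<circ> u))"
    have l: "int (len n v) - int (len n u) = 2 * int j + l + 1"
      using j True unfolding l_def by linarith
    have "ev X2 ([:-1, 1:] * [:0, 1:] ^ j * R2) = (X2 - 1) * X2 ^ j * (fls_X_intpow l * ev Xz (incp n ts (t \<circ> u) v))"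
      using R2 by (simp only: is_R_def l_def ev_mult ev_power ev_q ev_q_minus_1)
    also have "\<dots> = (fls_X_intpow (2 * int j + l) * (X2 - 1)) * ev Xz (incp n ts (t \<circ> u) v)"
      unfolding X2_power fls_X_intpow_times_fls_X_intpow[symmetric] by (simp only: mult_ac)
    also have "\<dots> = fls_X_intpow (2 * int j + l + 1) * Xz * ev Xz (incp n ts (t \<circ> u) v)"
      by (simp only: intpow_Suc)
    also have "\<dots> = fls_X_intpow (int (len n v) - int (len n u)) * ev Xz (q * incp n ts (t \<circ> u) v)"
      by (simp only: l ev_mult ev_q mult.assoc)
    finally have "is_R n u v (incp n (t # ts) u v) (R1 + [:-1, 1:] * [:0, 1:] ^ j * R2)"
      using R1 True by (simp only: is_R_def incp.simps if_True ev_add distrib_left)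
    then show ?thesis by blast
  next
    case False
    then show ?thesis using R1 by auto
  qed
qed

section \<open>Existence and uniqueness of the R-polynomials, and Dyer's formula\<close>

lemma R_family_unique:
  assumes "R_family n R" "R_family n R'"
  shows "R u v = R' u v"
proof (induction "len n v" arbitrary: u v rule: less_induct)
  case less
  have *: "\<not> bruhat_le n u v \<Longrightarrow> R u v = 0" "\<not> bruhat_le n u v \<Longrightarrow> R' u v = 0"
    "u \<in> symgrp n \<Longrightarrow> R u u = 1" "u \<in> symgrp n \<Longrightarrow> R' u u = 1" for u v
    using assms unfolding R_family_def by blast+
  have rec: "R u v = (if bruhat_less n (simple_refl i \<circ> u) u then R (simple_refl i \<circ> u) (simple_refl i \<circ> v)
      else [:-1, 1:] * R u (simple_refl i \<circ> v) + [:0, 1:] * R (simple_refl i \<circ> u) (simple_refl i \<circ> v))"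
    if "R_family n R" "i \<in> {1..<n}" "bruhat_less n u v" "bruhat_less n (simple_refl i \<circ> v) v" for R u v i
    using that unfolding R_family_def Let_def by blast
  show ?case
  proof (cases "bruhat_less n u v")
    case True
    note D = bruhat_lessD[OF True]
    have "v \<noteq> id" using D(3) by auto
    then obtain i where i: "i \<in> {1..<n}" "len n (simple_refl i \<circ> v) < len n v"
      using ex_left_descent[OF D(2)] by blast
    then have "bruhat_less n (simple_refl i \<circ> v) v"
      using bruhat_less_simple_refl_iff[OF D(2)] by blast
    then show ?thesis
      using rec[OF assms(1) i(1) True] rec[OF assms(2) i(1) True] less.hyps[OF i(2)] by simp
  next
    case False
    then show ?thesis using * bruhat_leD(1)[of n u v] by (cases "bruhat_le n u v") (auto simp: bruhat_less_def)
  qed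
qed

text \<open>The candidates are chosen pointwise from the path polynomials. After evaluation, their
  recursion becomes the left-handed recursion for paths, and evaluation is injective.\<close>

lemma ex_R_family:
  assumes ts: "reflection_list n r ts"
  obtains R where "R_family n R"
    "\<And>u v. u \<in> symgrp n \<Longrightarrow> v \<in> symgrp n \<Longrightarrow> is_R n u v (incp n ts u v) (R u v)"
proof -
  have set: "set ts \<subseteq> reflections n" using ts by (simp add: reflection_list_def)
  \<comment> \<open>Outside the symmetric group the value is 0, as \<open>R_family\<close> demands
    for pairs that are not comparable.\<close>
  define R where "R = (\<lambda>u v. if u \<in> symgrp n \<and> v \<in> symgrp n
    then SOME R. is_R n u v (incp n ts u v) R else 0)"
  have R: "is_R n u v (incp n ts u v) (R u v)" if "u \<in> symgrp n" "v \<in> symgrp n" for u v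
    using someI_ex[OF ex_R[OF set that(1), of v]] that by (simp add: R_def)
  have "R_family n R"
    unfolding R_family_def Let_def
  proof (intro conjI allI ballI impI)
    fix u v assume le: "\<not> bruhat_le n u v"
    show "R u v = 0"
    proof (cases "u \<in> symgrp n \<and> v \<in> symgrp n")
      case True
      then have "is_R n u v 0 (R u v)" using R[of u v] incp_bruhat_le[OF set, of u v] le by fastforce
      moreover have "is_R n u v 0 0" by (simp add: is_R_def)
      ultimately show ?thesis by (rule is_R_unique)
    qed (auto simp: R_def)
  next
    fix u assume u: "u \<in> symgrp n"
    have "is_R n u u (incp n ts u u) 1" by (simp add: is_R_def incp_self)
    then show "R u u = 1" using R[OF u u] is_R_unique by blast
  next
    fix u v i
    assume i: "i \<in> {1..<n}" and less: "bruhat_less n u v \<and> bruhat_less n (simple_refl i \<circ> v) v"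
    define s where "s = simple_refl i"
    have uv: "u \<in> symgrp n" "v \<in> symgrp n" using less bruhat_lessD by blast+
    have suv: "s \<circ> u \<in> symgrp n" "s \<circ> v \<in> symgrp n"
      using symgrp_comp[OF symgrp_simple_refl[OF i]] uv by (auto simp: s_def)
    have sv: "len n (s \<circ> v) < len n v" using less bruhat_lessD(3) unfolding s_def by blast
    have lv: "len n v = Suc (len n (s \<circ> v))"
      using len_simple_refl_left(2)[OF uv(2) i] sv unfolding s_def by linarith
    note rec = incp_left[OF ts i uv, folded s_def, OF sv]
    note ev = R[OF uv, unfolded is_R_def] R[OF suv, unfolded is_R_def]
      R[OF uv(1) suv(2), unfolded is_R_def]
    show "R u v = (if bruhat_less n (simple_refl i \<circ> u) u then R (simple_refl i \<circ> u) (simple_refl i \<circ> v)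
      else [:-1, 1:] * R u (simple_refl i \<circ> v) + [:0, 1:] * R (simple_refl i \<circ> u) (simple_refl i \<circ> v))"
    proof (cases "len n u < len n (s \<circ> u)")
      case True
      \<comment> \<open>The three length differences in the recursion are \<open>k\<close>,
        \<open>k + 1\<close> and \<open>k + 2\<close>; the gaps account for the factors
        \<open>X2 - 1\<close> and \<open>X2\<close>.\<close>
      define k where "k = int (len n (s \<circ> v)) - int (len n (s \<circ> u))"
      have lu: "len n (s \<circ> u) = Suc (len n u)"
        using len_simple_refl_left(1)[OF uv(1) i] True unfolding s_def by blast
      have k: "int (len n v) - int (len n u) = k + 2" "int (len n (s \<circ> v)) - int (len n u) = k + 1"
        using lv lu by (simp_all add: k_def)
      have "ev X2 ([:-1, 1:] * R u (s \<circ> v) + [:0, 1:] * R (s \<circ> u) (s \<circ> v)) =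
        (X2 - 1) * (fls_X_intpow (k + 1) * ev Xz (incp n ts u (s \<circ> v))) +
        X2 * (fls_X_intpow k * ev Xz (incp n ts (s \<circ> u) (s \<circ> v)))"
        by (simp only: ev_add ev_mult ev_q ev_q_minus_1 ev k k_def[symmetric])
      also have "\<dots> = (fls_X_intpow (k + 1) * (X2 - 1)) * ev Xz (incp n ts u (s \<circ> v)) +
        (fls_X_intpow k * X2) * ev Xz (incp n ts (s \<circ> u) (s \<circ> v))"
        by (simp only: mult_ac)
      also have "fls_X_intpow (k + 1) * (X2 - 1) = fls_X_intpow (k + 2) * Xz"
        using intpow_Suc[of "k + 1"] by (simp add: add.assoc)
      also have "fls_X_intpow k * X2 = fls_X_intpow (k + 2)"
        using X2_power[of 1] fls_X_intpow_times_fls_X_intpow[of k 2, where ?'a = int] by simp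
      also have "fls_X_intpow (k + 2) * Xz * ev Xz (incp n ts u (s \<circ> v)) +
          fls_X_intpow (k + 2) * ev Xz (incp n ts (s \<circ> u) (s \<circ> v)) =
        fls_X_intpow (k + 2) * ev Xz (incp n ts u v)"
        using rec True by (simp only: if_True ev_add ev_mult ev_q algebra_simps)
      also have "\<dots> = ev X2 (R u v)" by (simp add: ev k)
      finally have "R u v = [:-1, 1:] * R u (s \<circ> v) + [:0, 1:] * R (s \<circ> u) (s \<circ> v)"
        using ev_inject[of X2] fls_subdegree_X2 by (metis zero_neq_numeral)
      moreover have "\<not> bruhat_less n (s \<circ> u) u"
        using True bruhat_lessD(3) by (metis order.asym)
      ultimately show ?thesis unfolding s_def by simp
    next
      case False
      then have lu: "len n u = Suc (len n (s \<circ> u))"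
        using len_simple_refl_left(2)[OF uv(1) i] unfolding s_def by blast
      have "ev X2 (R u v) = ev X2 (R (s \<circ> u) (s \<circ> v))"
        using rec False by (simp add: ev lu lv)
      then have "R u v = R (s \<circ> u) (s \<circ> v)"
        using ev_inject[of X2] fls_subdegree_X2 by (metis zero_neq_numeral)
      moreover have "bruhat_less n (s \<circ> u) u"
        using bruhat_less_simple_refl_iff[OF uv(1) i] lu unfolding s_def by simp
      ultimately show ?thesis unfolding s_def by simp
    qed
  qed
  then show ?thesis using that R by blast
qed

text \<open>This is Dyer's formula. Uniqueness of the family resolves the description of
  \<open>R_poly\<close>, and injectivity of evaluation at \<open>Xz\<close> that of
  \<open>Rt_poly\<close>.\<close>

lemma Rt_poly_eq_incp:
  assumes ts: "reflection_list n r ts" and uv: "u \<in> symgrp n" "v \<in> symgrp n"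
  shows "Rt_poly n u v = incp n ts u v"
proof -
  obtain R where R: "R_family n R"
    "\<And>u v. u \<in> symgrp n \<Longrightarrow> v \<in> symgrp n \<Longrightarrow> is_R n u v (incp n ts u v) (R u v)"
    using ex_R_family[OF ts] by blast
  have "R_poly n = R"
    unfolding R_poly_def
  proof (rule the_equality)
    show "\<And>R'. R_family n R' \<Longrightarrow> R' = R" using R_family_unique[OF _ R(1)] by blast
  qed (rule R(1))
  then have *: "is_R n u v (incp n ts u v) (R_poly n u v)" using R(2) uv by simp
  show ?thesis
    unfolding Rt_poly_def
  proof (rule the_equality)
    show "poly (map_poly of_int (R_poly n u v)) X2 =
      fls_X_intpow (int (len n v) - int (len n u)) * poly (map_poly of_int (incp n ts u v)) Xz"
      using * by (simp add: is_R_def ev_def)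
  next
    fix p assume "poly (map_poly of_int (R_poly n u v)) X2 =
      fls_X_intpow (int (len n v) - int (len n u)) * poly (map_poly of_int p) Xz"
    then have "fls_X_intpow (int (len n v) - int (len n u)) * ev Xz p =
      fls_X_intpow (int (len n v) - int (len n u)) * ev Xz (incp n ts u v)"
      using * by (simp add: is_R_def ev_def)
    then have "ev Xz p = ev Xz (incp n ts u v)" by (simp only: mult_cancel_left fls_X_intpow_nonzero) simp
    then show "p = incp n ts u v" using ev_inject fls_subdegree_Xz by (metis neg_equal_0_iff_equal zero_neq_one)
  qed
qed

section \<open>Relative \<open>R\<close>-polynomials\<close>

lemma sorted_wrt_filter_append:
  assumes "sorted_wrt R ts" "\<And>s t. R s t \<Longrightarrow> P t \<Longrightarrow> P s"
  shows "ts = filter P ts @ filter (\<lambda>t. \<not> P t) ts"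
  using assms(1)
proof (induction ts)
  case (Cons t ts)
  show ?case
  proof (cases "P t")
    case False
    then have "filter P ts = []"
      using Cons.prems assms(2) by (auto simp: filter_empty_conv)
    then show ?thesis using False Cons by simp
  qed (use Cons in simp)
qed simp

text \<open>As the reverse of a reflection order is one again, decreasing paths compute the same
  polynomials. The two factors of a summand of \<open>Rt_rel\<close> can thus be expanded in
  opposite orders.\<close>

lemma reflection_list_rev:
  assumes "reflection_list n r ts" shows "reflection_list n (r\<inverse>) (rev ts)"
proof -
  have r: "reflection_order n r" using assms by (simp add: reflection_list_def)
  have "strict_linear_order_on (reflections n) (r\<inverse>)" "r\<inverse> \<subseteq> reflections n \<times> reflections n"
    using r unfolding reflection_order_def strict_linear_order_on_def
    by (auto simp: irrefl_def total_on_def trans_def)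
  moreover have "(transpose a b, transpose a c) \<in> r\<inverse> \<and> (transpose a c, transpose b c) \<in> r\<inverse> \<or>
    (transpose b c, transpose a c) \<in> r\<inverse> \<and> (transpose a c, transpose a b) \<in> r\<inverse>"
    if "1 \<le> a" "a < b" "b < c" "c \<le> n" for a b c
    using reflection_order_triple[OF r that] by auto
  ultimately have "reflection_order n (r\<inverse>)" unfolding reflection_order_def by blast
  then show ?thesis using assms by (simp add: reflection_list_def sorted_wrt_rev)
qed

lemma interval_iff: "w \<in> interval n x v \<longleftrightarrow> bruhat_le n x w \<and> bruhat_le n w v"
  by (simp add: interval_def)

lemma finite_interval: "finite (interval n x v)"
  by (rule finite_subset[OF _ finite_symgrp[of n]]) (auto simp: interval_iff dest: bruhat_leD)

text \<open>A path that uses labels of \<open>ds\<close> has one of them on its first step. That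
  step ends below \<open>y\<close>, hence in \<open>J\<close>, which is excluded.\<close>

lemma incp_append_avoiding:
  assumes "\<And>t. t \<in> set ds \<Longrightarrow> ascends n x t \<Longrightarrow> t \<circ> x \<in> J \<Longrightarrow> False"
    and "\<And>z. bruhat_le n x z \<Longrightarrow> bruhat_le n z y \<Longrightarrow> z \<in> J"
    and "set (ds @ cs) \<subseteq> reflections n" "x \<in> symgrp n"
  shows "incp n (ds @ cs) x y = incp n cs x y"
  using assms(1,3)
proof (induction ds)
  case (Cons t ds)
  have t: "t \<in> reflections n" using Cons.prems by simp
  have tx: "t \<circ> x \<in> symgrp n" using symgrp_comp[OF reflections_symgrp[OF t] assms(4)] .
  have "incp n (ds @ cs) (t \<circ> x) y = 0" if asc: "ascends n x t"
  proof (rule ccontr)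
    assume "incp n (ds @ cs) (t \<circ> x) y \<noteq> 0"
    then have "bruhat_le n (t \<circ> x) y" by (intro incp_bruhat_le[OF _ tx]) (use Cons.prems(2) in auto)
    then have "t \<circ> x \<in> J" using assms(2) bruhat_le_ascends[OF assms(4) t asc] by blast
    then show False using Cons.prems(1)[of t] asc by simp
  qed
  moreover have "incp n (ds @ cs) x y = incp n cs x y"
  proof (rule Cons.IH)
    show "\<And>t. t \<in> set ds \<Longrightarrow> ascends n x t \<Longrightarrow> t \<circ> x \<in> J \<Longrightarrow> False"
      using Cons.prems(1) by (meson list.set_intros(2))
  qed (use Cons.prems(2) in auto)
  ultimately show ?case by simp
qed simp

abbreviation negq :: "int poly \<Rightarrow> int poly" where
  "negq p \<equiv> p \<circ>\<^sub>p [:0, -1:]"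

lemma negq_add_q_times: "negq (p + q * p') = negq p - q * negq p'"
  by (simp add: pcompose_add pcompose_mult pcompose_pCons)

text \<open>The head \<open>c\<close> of the list can only be the last label of the first path and
  the first label of the second. Passing from \<open>y\<close> to \<open>c \<circ> y\<close> moves
  it between the two, and the argument \<open>-q\<close> of the first factor makes the terms cancel.
  Going up stays in \<open>J\<close> by the hypothesis on \<open>cs\<close>, going down by the ideal
  property.\<close>

lemma telescoping_sum:
  assumes J: "J \<subseteq> interval n x v" "x \<in> J"
    and ideal: "\<And>y z. y \<in> J \<Longrightarrow> bruhat_le n x z \<Longrightarrow> bruhat_le n z y \<Longrightarrow> z \<in> J"
    and bs: "set bs \<subseteq> reflections n"
  shows "set cs \<subseteq> reflections n \<Longrightarrow>
    (\<And>c y. c \<in> set cs \<Longrightarrow> y \<in> J \<Longrightarrow> ascends n y c \<Longrightarrow> bruhat_le n (c \<circ> y) v \<Longrightarrow> c \<circ> y \<in> J) \<Longrightarrow>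
    (\<Sum>y\<in>J. negq (incp n (rev cs) x y) * incp n (cs @ bs) y v) = incp n bs x v"
proof (induction cs)
  case Nil
  have fin: "finite J" using J(1) finite_interval finite_subset by blast
  have "(\<Sum>y\<in>J. negq (incp n [] x y) * incp n bs y v) = (\<Sum>y\<in>J. if x = y then incp n bs y v else 0)"
    by (intro sum.cong) (auto simp: pcompose_1)
  then show ?case using J(2) fin by (simp add: pcompose_1)
next
  case (Cons c cs)
  define D N where "D = (\<lambda>y. negq (incp n (rev cs) x y))" and "N = (\<lambda>y. incp n (cs @ bs) y v)"
  define up where "up = (\<lambda>y. ascends n y c)"
  have fin: "finite J" using J(1) finite_interval finite_subset by blast
  have c: "c \<in> reflections n" using Cons.prems by simp
  have xS: "x \<in> symgrp n" using subsetD[OF J] bruhat_leD(1)[of n x x] by (simp add: interval_iff)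
  have JS: "y \<in> symgrp n" if "y \<in> J" for y
    using subsetD[OF J(1) that] bruhat_leD(1)[of n y v] by (simp add: interval_iff)
  have CS: "c \<circ> y \<in> symgrp n" if "y \<in> symgrp n" for y
    using symgrp_comp[OF reflections_symgrp[OF c] that] .
  have cc: "c \<circ> (c \<circ> y) = y" for y using reflections_cancel[OF c] .
  have up_c: "up (c \<circ> y) \<longleftrightarrow> \<not> up y" if "y \<in> symgrp n" for y
    using not_ascends_iff[OF that c] by (simp add: up_def cc)
  have N_up: "c \<circ> y \<in> J" if "y \<in> J" "up y" "N (c \<circ> y) \<noteq> 0" for y
  proof -
    have "bruhat_le n (c \<circ> y) v"
      by (rule incp_bruhat_le[OF _ CS[OF JS[OF that(1)]]])
        (use that(3) Cons.prems(1) bs in \<open>auto simp: N_def\<close>)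
    then show ?thesis using Cons.prems(2)[of c y] that by (simp add: up_def)
  qed
  have D_down: "c \<circ> y \<in> J" if "y \<in> J" "\<not> up y" "D (c \<circ> y) \<noteq> 0" for y
  proof -
    have "incp n (rev cs) x (c \<circ> y) \<noteq> 0" using that(3) by (auto simp: D_def)
    then have "bruhat_le n x (c \<circ> y)"
      by (rule incp_bruhat_le[OF _ xS, rotated]) (use Cons.prems(1) in simp)
    moreover have "bruhat_le n (c \<circ> y) y"
      using bruhat_le_ascends[OF CS[OF JS[OF that(1)]] c] up_c[OF JS[OF that(1)]] that(2)
      by (simp add: up_def cc)
    ultimately show ?thesis using ideal that(1) by blast
  qed
  have summand: "negq (incp n (rev (c # cs)) x y) * incp n ((c # cs) @ bs) y v =
      D y * N y + (if up y then q * (D y * N (c \<circ> y)) else 0) -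
      (if up y then 0 else q * (D (c \<circ> y) * N y))" if "y \<in> J" for y
  proof -
    have "incp n (rev cs @ [c]) x y =
      incp n (rev cs) x y + (if \<not> up y then q * incp n (rev cs) x (c \<circ> y) else 0)"
      using incp_append[of "rev cs" n c x y] Cons.prems(1) c xS JS[OF that]
        not_ascends_iff[OF JS[OF that] c] by (simp add: up_def)
    then have 1: "negq (incp n (rev (c # cs)) x y) = D y - (if up y then 0 else q * D (c \<circ> y))"
      by (cases "up y") (simp_all only: rev.simps if_True if_False not_True_eq_False
        not_False_eq_True add_0_right diff_0_right negq_add_q_times D_def)
    have 2: "incp n ((c # cs) @ bs) y v = N y + (if up y then q * N (c \<circ> y) else 0)"
      by (simp only: append_Cons incp.simps N_def up_def)
    have "(d - (if b then 0 else p * d')) * (e + (if b then p * e' else 0)) =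
        d * e + (if b then p * (d * e') else 0) - (if b then 0 else p * (d' * e))"
      for b and d d' e e' p :: "int poly"
      by (simp add: algebra_simps)
    then show ?thesis unfolding 1 2 .
  qed
  \<comment> \<open>Where \<open>c \<circ> y\<close> lies outside \<open>J\<close> the summand
    vanishes, so the toggle is a bijection between the remaining index sets.\<close>
  have "(\<Sum>y\<in>J. if up y then q * (D y * N (c \<circ> y)) else 0) =
    (\<Sum>y\<in>{y \<in> J. up y \<and> c \<circ> y \<in> J}. q * (D y * N (c \<circ> y)))"
    using fin N_up by (intro sum.mono_neutral_cong_right) auto
  also have "\<dots> = (\<Sum>y\<in>{y \<in> J. \<not> up y \<and> c \<circ> y \<in> J}. q * (D (c \<circ> y) * N y))"
    by (rule sum.reindex_bij_witness[of _ "\<lambda>y. c \<circ> y" "\<lambda>y. c \<circ> y"])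
      (auto simp: cc up_c JS)
  also have "\<dots> = (\<Sum>y\<in>J. if up y then 0 else q * (D (c \<circ> y) * N y))"
    using fin D_down by (intro sum.mono_neutral_cong_left) auto
  finally have cancel: "(\<Sum>y\<in>J. if up y then q * (D y * N (c \<circ> y)) else 0) = \<dots>" .
  have "(\<Sum>y\<in>J. negq (incp n (rev (c # cs)) x y) * incp n ((c # cs) @ bs) y v) =
    (\<Sum>y\<in>J. D y * N y + (if up y then q * (D y * N (c \<circ> y)) else 0) -
      (if up y then 0 else q * (D (c \<circ> y) * N y)))"
    using summand by (rule sum.cong[OF refl])
  also have "\<dots> = (\<Sum>y\<in>J. D y * N y)"
    by (simp only: sum_subtractf sum.distrib cancel add_diff_cancel_right')
  also have "\<dots> = incp n bs x v"
    using Cons by (simp add: D_def N_def)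
  finally show ?case .
qed

text \<open>Cutting the order after the last label of an edge inside the ideal separates inner edges
  from leaving ones. The labels of \<open>as\<close> then satisfy the closure condition needed for
  the cancellation, and what survives is the trivial first path.\<close>

lemma Rt_rel_eq_incp:
  assumes ideal: "order_ideal n u v I" and x: "x \<in> I" and ts: "reflection_list n r ts"
    and E: "\<And>x1 x2 x3 y. \<lbrakk>x1 \<in> I \<inter> interval n x v; x2 \<in> I \<inter> interval n x v; x3 \<in> I \<inter> interval n x v;
      y \<in> interval n x v - I; x1 \<rightarrow>\<^bsub>bruhat_graph n\<^esub> x2; x3 \<rightarrow>\<^bsub>bruhat_graph n\<^esub> y\<rbrakk> \<Longrightarrow>
      (edge_label x1 x2, edge_label x3 y) \<in> r"
  obtains as bs where "ts = as @ bs"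
    "Rt_rel n x v (I \<inter> interval n x v) = incp n bs x v"
    "\<And>y. x \<rightarrow>\<^bsub>bruhat_graph n\<^esub> y \<Longrightarrow> y \<in> interval n x v \<Longrightarrow> edge_label x y \<in> set bs \<longleftrightarrow> y \<notin> I"
proof -
  define J where "J = I \<inter> interval n x v"
  \<comment> \<open>\<open>P\<close> holds up to the last label that occurs on an edge inside
    \<open>J\<close>; by property (E) every edge leaving \<open>J\<close> within the interval has a
    later label.\<close>
  define P where "P = (\<lambda>t. \<exists>x1\<in>J. \<exists>x2\<in>J. x1 \<rightarrow>\<^bsub>bruhat_graph n\<^esub> x2 \<and>
    (t = edge_label x1 x2 \<or> (t, edge_label x1 x2) \<in> r))"
  define as bs where "as = filter P ts" and "bs = filter (\<lambda>t. \<not> P t) ts"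
  have r: "reflection_order n r" and sorted: "sorted_wrt (\<lambda>s t. (s, t) \<in> r) ts"
    and set: "set ts = reflections n"
    using ts by (auto simp: reflection_list_def)
  have split: "ts = as @ bs"
    unfolding as_def bs_def
    by (rule sorted_wrt_filter_append[OF sorted])
      (use reflection_orderD(1)[OF r] in \<open>auto simp: P_def dest: transD\<close>)
  have subs: "set as \<subseteq> reflections n" "set bs \<subseteq> reflections n"
    using set by (auto simp: as_def bs_def)
  have xuv: "bruhat_le n u x" "bruhat_le n x v"
    using ideal x by (auto simp: order_ideal_def interval_iff)
  have xS: "x \<in> symgrp n" and vS: "v \<in> symgrp n" using bruhat_leD xuv(2) by blast+
  have J: "J \<subseteq> interval n x v" "x \<in> J"
    using x xuv bruhat_le_refl[OF xS] by (auto simp: J_def interval_iff)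
  have Jideal: "z \<in> J" if "y \<in> J" "bruhat_le n x z" "bruhat_le n z y" for y z
  proof -
    have "y \<in> I" "bruhat_le n y v" using that(1) by (auto simp: J_def interval_iff)
    then have "bruhat_le n z v" using that(3) bruhat_le_trans by blast
    moreover have "bruhat_le n u z" using xuv(1) that(2) bruhat_le_trans by blast
    ultimately show ?thesis
      using ideal \<open>y \<in> I\<close> that by (auto simp: order_ideal_def interval_iff J_def)
  qed
  have not_P: "\<not> P (edge_label y z)"
    if "y \<in> J" "y \<rightarrow>\<^bsub>bruhat_graph n\<^esub> z" "z \<in> interval n x v - I" for y z
  proof
    assume "P (edge_label y z)"
    then obtain x1 x2 where *: "x1 \<in> J" "x2 \<in> J" "x1 \<rightarrow>\<^bsub>bruhat_graph n\<^esub> x2"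
      "edge_label y z = edge_label x1 x2 \<or> (edge_label y z, edge_label x1 x2) \<in> r"
      by (auto simp: P_def)
    have "(edge_label x1 x2, edge_label y z) \<in> r"
      by (rule E) (use * that in \<open>auto simp: J_def\<close>)
    then show False using *(4) reflection_orderD(2,5)[OF r] by metis
  qed
  have P_I: "P (edge_label y z)" if "y \<in> J" "y \<rightarrow>\<^bsub>bruhat_graph n\<^esub> z" "z \<in> J" for y z
    using that by (auto simp: P_def)
  have as_J: "c \<circ> y \<in> J"
    if "c \<in> set as" "y \<in> J" "ascends n y c" "bruhat_le n (c \<circ> y) v" for c y
  proof -
    have c: "c \<in> reflections n" using that(1) subs by blast
    have yS: "y \<in> symgrp n" using that(2) bruhat_leD(1) by (auto simp: J_def interval_iff)
    note arc = bruhat_arcI[OF yS c that(3)]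
    have "c \<circ> y \<in> interval n x v"
      using bruhat_le_arc[OF arc(1)] that(2,4) bruhat_le_trans by (auto simp: J_def interval_iff)
    then show ?thesis
      using not_P[OF that(2) arc(1)] arc(2) that(1) by (auto simp: as_def J_def)
  qed
  have bs_J: False if "t \<in> set (rev bs)" "ascends n x t" "t \<circ> x \<in> J" for t
  proof -
    have t: "t \<in> reflections n" using that(1) subs by auto
    show False
      using P_I[OF J(2) bruhat_arcI(1)[OF xS t that(2)] that(3)] bruhat_arcI(2)[OF xS t that(2)] that(1)
      by (auto simp: bs_def)
  qed
  have "Rt_rel n x v J = (\<Sum>y\<in>J. negq (incp n (rev as) x y) * incp n (as @ bs) y v)"
    unfolding Rt_rel_def
  proof (rule sum.cong[OF refl])
    fix y assume y: "y \<in> J"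
    have yS: "y \<in> symgrp n" using y bruhat_leD(1) by (auto simp: J_def interval_iff)
    \<comment> \<open>In the reversed order the labels of \<open>bs\<close> come first. A path that
      uses them would start with one, although its first step stays in \<open>J\<close>.\<close>
    have "Rt_poly n x y = incp n (rev bs @ rev as) x y"
      using Rt_poly_eq_incp[OF reflection_list_rev[OF ts] xS yS] split by simp
    also have "\<dots> = incp n (rev as) x y"
      by (rule incp_append_avoiding[where J = J])
        (use bs_J Jideal[OF y] subs xS in auto)
    finally show "negq (Rt_poly n x y) * Rt_poly n y v = negq (incp n (rev as) x y) * incp n (as @ bs) y v"
      using Rt_poly_eq_incp[OF ts yS vS] split by simp
  qed
  also have "\<dots> = incp n bs x v"
    by (rule telescoping_sum[OF J Jideal subs(2) subs(1)]) (use as_J in auto)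
  finally have main: "Rt_rel n x v (I \<inter> interval n x v) = incp n bs x v" by (simp add: J_def)
  have exit: "edge_label x y \<in> set bs \<longleftrightarrow> y \<notin> I"
    if "x \<rightarrow>\<^bsub>bruhat_graph n\<^esub> y" "y \<in> interval n x v" for y
    using not_P[OF J(2) that(1)] P_I[OF J(2) that(1)] that bruhat_arcD(3)[OF that(1)] set
    by (auto simp: bs_def J_def)
  show ?thesis using that[OF split main exit] .
qed

section \<open>Diamonds\<close>

definition two_step :: "nat \<Rightarrow> (nat \<Rightarrow> nat) \<Rightarrow> (nat \<Rightarrow> nat) \<Rightarrow> (nat \<Rightarrow> nat) \<Rightarrow> bool" where
  "two_step n x t1 t2 \<longleftrightarrow> t1 \<in> reflections n \<and> t2 \<in> reflections n \<and>
     ascends n x t1 \<and> ascends n (t1 \<circ> x) t2"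

lemma two_step_iff:
  assumes x: "x \<in> symgrp n" and a: "1 \<le> a" "a < b" "b \<le> n" and c: "1 \<le> c" "c < d" "d \<le> n"
  shows "two_step n x (transpose a b) (transpose c d) \<longleftrightarrow>
    inv x a < inv x b \<and> inv x (transpose a b c) < inv x (transpose a b d)"
proof -
  have t: "transpose a b \<in> reflections n" "transpose c d \<in> reflections n"
    using a c by (auto intro!: transpose_in_reflections)
  have y: "transpose a b \<circ> x \<in> symgrp n" using symgrp_comp[OF reflections_symgrp[OF t(1)] x] .
  have "inv (transpose a b \<circ> x) = inv x \<circ> transpose a b"
    using symgrp_bij[OF x] by (simp add: o_inv_distrib)
  then show ?thesis
    using t len_less_transpose_iff[OF x a] len_less_transpose_iff[OF y c]
    by (simp add: two_step_def comp_apply)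
qed

lemma two_step_neq:
  assumes "x \<in> symgrp n" "two_step n x t1 t2" shows "t1 \<noteq> t2"
  using assms unfolding two_step_def by (metis order.asym reflections_cancel)

section \<open>Factorizations of a product of two transpositions\<close>

lemma transposition_factor_moves:
  assumes eq: "\<And>k. transpose c d (transpose a b k) = w k" and ab: "a \<noteq> b" and a: "w a = a"
  shows "transpose c d a = b" "w b = b"
proof -
  have "transpose c d b = a" using eq[of a] a by simp
  then show "transpose c d a = b" by (metis transpose_involutory)
  then show "w b = b" using eq[of b] by simp
qed

text \<open>The first factor must exchange two of the three points of the 3-cycle, and it determines
  the second factor; this leaves three possibilities.\<close>

lemma cycle_factorizations:
  fixes L M H :: nat
  assumes ord: "L < M" "M < H" and t: "t1 \<in> reflections n" "t2 \<in> reflections n"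
    and eq: "t2 \<circ> t1 = transpose L H \<circ> transpose L M"
  shows "(t1, t2) \<in> {(transpose L M, transpose L H), (transpose L H, transpose M H),
    (transpose M H, transpose L M)}"
proof -
  obtain a b where ab: "t1 = transpose a b" "a < b" using t(1) by (rule reflectionsE)
  obtain c d where cd: "t2 = transpose c d" "c < d" using t(2) by (rule reflectionsE)
  define w where "w = transpose L H \<circ> transpose L M"
  have w: "w L = M" "w M = H" "w H = L" "\<And>k. k \<notin> {L, M, H} \<Longrightarrow> w k = k"
    using ord by (auto simp: w_def transpose_def comp_apply)
  have eq1: "transpose c d (transpose a b k) = w k" for k
    using fun_cong[OF eq, of k] ab cd by (simp add: w_def comp_apply)
  have eq2: "transpose c d (transpose b a k) = w k" for k
    using eq1 by (simp add: transpose_commute[of b])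
  \<comment> \<open>If \<open>t1\<close> moved a point outside the cycle, it would move two such
    points, and \<open>t2\<close> alone would act on the rest as a 3-cycle, which is not an
    involution.\<close>
  have inside: "e \<in> {L, M, H}"
    if eqe: "\<And>k. transpose c d (transpose e f k) = w k" and "e \<noteq> f" for e f
  proof (rule ccontr)
    assume e: "e \<notin> {L, M, H}"
    then have f: "w f = f" using transposition_factor_moves(2)[OF eqe \<open>e \<noteq> f\<close>] w(4) by blast
    then have f: "f \<notin> {L, M, H}" using w(1-3) ord by auto
    have "transpose c d L = M" "transpose c d M = H"
      using eqe[of L] eqe[of M] e f w(1-3) by auto
    then have "transpose c d M = L" by (metis transpose_involutory)
    then show False using \<open>transpose c d M = H\<close> ord by simp
  qed
  have "a \<in> {L, M, H}" "b \<in> {L, M, H}"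
    using inside[OF eq1] inside[OF eq2] ab by auto
  moreover have t2: "t2 = w \<circ> t1"
    using eq ab reflections_comp_self[OF t(1)] unfolding w_def by (metis comp_assoc comp_id)
  ultimately consider "t1 = transpose L M" | "t1 = transpose L H" | "t1 = transpose M H"
    using ab ord by auto
  then show ?thesis
  proof cases
    case 1
    then have "t2 = transpose L H" using t2 by (simp add: w_def comp_assoc)
    then show ?thesis using 1 by simp
  next
    case 2
    then have "t2 = transpose M H"
      using t2 ord by (auto simp: w_def fun_eq_iff transpose_def comp_apply)
    then show ?thesis using 2 by simp
  next
    case 3
    then have "t2 = transpose L M"
      using t2 ord by (auto simp: w_def fun_eq_iff transpose_def comp_apply)
    then show ?thesis using 3 by simp
  qed
qed

lemma disjoint_factorizations:
  fixes a b c d :: nat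
  assumes dist: "distinct [a, b, c, d]" and t: "t1 \<in> reflections n" "t2 \<in> reflections n"
    and eq: "t2 \<circ> t1 = transpose c d \<circ> transpose a b"
  shows "(t1, t2) \<in> {(transpose a b, transpose c d), (transpose c d, transpose a b)}"
proof -
  obtain e f where ef: "t1 = transpose e f" "e < f" using t(1) by (rule reflectionsE)
  obtain g h where gh: "t2 = transpose g h" "g < h" using t(2) by (rule reflectionsE)
  define w where "w = transpose c d \<circ> transpose a b"
  have w: "w a = b" "w b = a" "w c = d" "w d = c" "\<And>k. k \<notin> {a, b, c, d} \<Longrightarrow> w k = k"
    using dist by (auto simp: w_def transpose_def comp_apply)
  have eq1: "transpose g h (transpose e f k) = w k" for k
    using fun_cong[OF eq, of k] ef gh by (simp add: w_def comp_apply)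
  have eq2: "transpose g h (transpose f e k) = w k" for k
    using eq1 by (simp add: transpose_commute[of f])
  have not_two: False if "transpose g h k = l" "transpose g h k' = l'" "distinct [k, l, k', l']" for k l k' l'
    using that by (auto simp: transpose_def split: if_splits)
  have inside: "p \<in> {a, b, c, d}"
    if eqp: "\<And>k. transpose g h (transpose p p' k) = w k" and "p \<noteq> p'" for p p'
  proof (rule ccontr)
    assume p: "p \<notin> {a, b, c, d}"
    then have p': "w p' = p'" using transposition_factor_moves(2)[OF eqp \<open>p \<noteq> p'\<close>] w(5) by blast
    have p': "p' \<notin> {a, b, c, d}" using p' w(1-4) dist by auto
    have "transpose g h a = b" "transpose g h c = d"
      using eqp[of a] eqp[of c] p p' w(1-4) by auto
    then show False using not_two dist by blast
  qed
  have in4: "e \<in> {a, b, c, d}" "f \<in> {a, b, c, d}"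
    using inside[OF eq1] inside[OF eq2] ef by auto
  have t2: "t2 = w \<circ> t1"
    using eq ef reflections_comp_self[OF t(1)] unfolding w_def by (metis comp_assoc comp_id)
  \<comment> \<open>For a first factor joining the two pairs, the second one would have to exchange
    \<open>w p'\<close> with \<open>p\<close> as well as with \<open>p'\<close>.\<close>
  have cross: False
    if eqp: "\<And>k. transpose g h (transpose p p' k) = w k" and "p \<in> {a, b}" "p' \<in> {c, d}" for p p'
  proof -
    have 1: "transpose g h p = w p'" using eqp[of p'] by simp
    have "w p' \<noteq> p" "w p' \<noteq> p'" "w (w p') = p'" using that(2,3) w(1-4) dist by auto
    then have "transpose g h (w p') = p'" using eqp[of "w p'"] by simp
    then have "p = p'" using 1 by (metis transpose_involutory)
    then show False using that(2,3) dist by auto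
  qed
  have "t1 = transpose a b \<or> t1 = transpose c d"
    using in4 cross[OF eq1] cross[OF eq2] ef by (auto simp: transpose_commute)
  then show ?thesis
  proof
    assume 1: "t1 = transpose a b"
    then have "t2 = transpose c d" using t2 by (simp add: w_def comp_assoc)
    then show ?thesis using 1 by simp
  next
    assume 1: "t1 = transpose c d"
    then have "t2 = transpose a b"
      using t2 dist by (auto simp: w_def fun_eq_iff transpose_def comp_apply)
    then show ?thesis using 1 by simp
  qed
qed

text \<open>Transpositions with one common point generate the permutations of a triple. The cases
  \<open>cycle\<close> and \<open>cycle_inv\<close> distinguish the two 3-cycles that
  \<open>t2 \<circ> t1\<close> can be.\<close>

lemma two_reflections_cases:
  assumes t: "t1 \<in> reflections n" "t2 \<in> reflections n" "t1 \<noteq> t2"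
  obtains
    (disjoint) a b c d where "t1 = transpose a b" "t2 = transpose c d" "1 \<le> a" "a < b" "b \<le> n"
      "1 \<le> c" "c < d" "d \<le> n" "distinct [a, b, c, d]"
  | (cycle) L M H where "1 \<le> L" "L < M" "M < H" "H \<le> n"
      "(t1, t2) \<in> {(transpose L M, transpose L H), (transpose L H, transpose M H),
        (transpose M H, transpose L M)}"
  | (cycle_inv) L M H where "1 \<le> L" "L < M" "M < H" "H \<le> n"
      "(t1, t2) \<in> {(transpose L H, transpose L M), (transpose M H, transpose L H),
        (transpose L M, transpose M H)}"
proof -
  obtain a b where ab: "t1 = transpose a b" "1 \<le> a" "a < b" "b \<le> n" using t(1) by (rule reflectionsE)
  obtain c d where cd: "t2 = transpose c d" "1 \<le> c" "c < d" "d \<le> n" using t(2) by (rule reflectionsE)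
  have ne: "\<not> (a = c \<and> b = d)" using t(3) ab cd by auto
  consider "distinct [a, b, c, d]" | "a = c" "b < d" | "a = c" "d < b" | "b = d" "a < c" | "b = d" "c < a"
    | "b = c" | "a = d"
    using ne ab cd by fastforce
  then show ?thesis
  proof cases
    case 1
    then show ?thesis using disjoint ab cd by blast
  next
    case 2
    show ?thesis by (rule cycle[of a b d]) (use 2 ab cd in auto)
  next
    case 3
    show ?thesis by (rule cycle_inv[of a d b]) (use 3 ab cd in auto)
  next
    case 4
    show ?thesis by (rule cycle[of a c b]) (use 4 ab cd in auto)
  next
    case 5
    show ?thesis by (rule cycle_inv[of c a b]) (use 5 ab cd in auto)
  next
    case 6
    show ?thesis by (rule cycle_inv[of a b d]) (use 6 ab cd in auto)
  next
    case 7
    show ?thesis by (rule cycle[of c a b]) (use 7 ab cd in auto)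
  qed
qed

lemma cycle_products:
  fixes L M H :: nat
  assumes "L < M" "M < H"
  shows "(t1, t2) \<in> {(transpose L M, transpose L H), (transpose L H, transpose M H),
      (transpose M H, transpose L M)} \<Longrightarrow> t2 \<circ> t1 = transpose L H \<circ> transpose L M"
    and "(t1, t2) \<in> {(transpose L H, transpose L M), (transpose M H, transpose L H),
      (transpose L M, transpose M H)} \<Longrightarrow> t1 \<circ> t2 = transpose L H \<circ> transpose L M"
proof -
  have "transpose M H \<circ> transpose L H = transpose L H \<circ> transpose L M"
    "transpose L M \<circ> transpose M H = transpose L H \<circ> transpose L M"
    using assms by (auto simp: fun_eq_iff transpose_def comp_apply)
  then show "(t1, t2) \<in> {(transpose L M, transpose L H), (transpose L H, transpose M H),
      (transpose M H, transpose L M)} \<Longrightarrow> t2 \<circ> t1 = transpose L H \<circ> transpose L M"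
    and "(t1, t2) \<in> {(transpose L H, transpose L M), (transpose M H, transpose L H),
      (transpose L M, transpose M H)} \<Longrightarrow> t1 \<circ> t2 = transpose L H \<circ> transpose L M"
    by auto
qed

text \<open>Invert both sides: reflections are involutions. This reduces factorizations of the
  inverse 3-cycle to those of the 3-cycle.\<close>

lemma reverse_product:
  assumes "t1 \<in> reflections n" "t2 \<in> reflections n" "t1' \<in> reflections n" "t2' \<in> reflections n"
    and "t2' \<circ> t1' = t2 \<circ> t1"
  shows "t1' \<circ> t2' = t1 \<circ> t2"
proof -
  have inv: "inv (s \<circ> t) = t \<circ> s" if st: "s \<in> reflections n" "t \<in> reflections n" for s t
  proof -
    have "inv s = s" "inv t = t" using st by (auto elim!: reflectionsE)
    then show ?thesis using st by (simp add: o_inv_distrib reflections_symgrp[THEN symgrp_bij])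
  qed
  show ?thesis using assms inv by metis
qed

lemma two_step_classification:
  assumes x: "x \<in> symgrp n" and s: "two_step n x t1 t2"
  obtains
    (disjoint) a b c d where "t1 = transpose a b" "t2 = transpose c d" "two_step n x t2 t1" "t1 \<noteq> t2"
      "\<And>t1' t2'. two_step n x t1' t2' \<Longrightarrow> t2' \<circ> t1' = t2 \<circ> t1 \<Longrightarrow> (t1', t2') \<in> {(t1, t2), (t2, t1)}"
      "t1 \<circ> t2 = t2 \<circ> t1"
  | (cycle) L M H where "1 \<le> L" "L < M" "M < H" "H \<le> n"
      "(t1, t2) \<in> {(transpose L M, transpose L H), (transpose L H, transpose M H),
        (transpose M H, transpose L M)}"
      "t2 \<circ> t1 = transpose L H \<circ> transpose L M"
      "\<And>t1' t2'. two_step n x t1' t2' \<Longrightarrow> t2' \<circ> t1' = t2 \<circ> t1 \<Longrightarrow>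
        (t1', t2') \<in> {(transpose L M, transpose L H), (transpose L H, transpose M H),
          (transpose M H, transpose L M)}"
  | (cycle_inv) L M H where "1 \<le> L" "L < M" "M < H" "H \<le> n"
      "(t1, t2) \<in> {(transpose L H, transpose L M), (transpose M H, transpose L H),
        (transpose L M, transpose M H)}"
      "t1 \<circ> t2 = transpose L H \<circ> transpose L M"
      "\<And>t1' t2'. two_step n x t1' t2' \<Longrightarrow> t2' \<circ> t1' = t2 \<circ> t1 \<Longrightarrow>
        (t1', t2') \<in> {(transpose L H, transpose L M), (transpose M H, transpose L H),
          (transpose L M, transpose M H)}"
proof -
  have t: "t1 \<in> reflections n" "t2 \<in> reflections n" using s by (auto simp: two_step_def)
  have ne: "t1 \<noteq> t2" using two_step_neq[OF x s] .
  from t ne show ?thesis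
  proof (cases rule: two_reflections_cases)
    case (disjoint a b c d)
    have d: "transpose a b c = c" "transpose a b d = d" "transpose c d a = a" "transpose c d b = b"
      using disjoint(9) by auto
    have sw: "two_step n x t2 t1"
      using s two_step_iff[OF x disjoint(3-8)] two_step_iff[OF x disjoint(6-8,3-5)] d
      by (simp add: disjoint(1,2))
    have comm: "t1 \<circ> t2 = t2 \<circ> t1"
      using transpose_comp_eq[of "transpose c d" a b] d by (simp add: disjoint(1,2))
    show ?thesis
    proof (rule that(1)[OF disjoint(1,2) sw ne _ comm])
      fix t1' t2' assume "two_step n x t1' t2'" "t2' \<circ> t1' = t2 \<circ> t1"
      then show "(t1', t2') \<in> {(t1, t2), (t2, t1)}"
        using disjoint_factorizations[OF disjoint(9)] by (auto simp: two_step_def disjoint(1,2))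
    qed
  next
    case (cycle L M H)
    note p = cycle_products(1)[OF cycle(2,3,5)]
    show ?thesis
    proof (rule that(2)[OF cycle p])
      fix t1' t2' assume "two_step n x t1' t2'" "t2' \<circ> t1' = t2 \<circ> t1"
      then show "(t1', t2') \<in> {(transpose L M, transpose L H), (transpose L H, transpose M H),
          (transpose M H, transpose L M)}"
        by (intro cycle_factorizations[OF cycle(2,3), where n = n]) (auto simp: two_step_def p)
    qed
  next
    case (cycle_inv L M H)
    note p = cycle_products(2)[OF cycle_inv(2,3,5)]
    show ?thesis
    proof (rule that(3)[OF cycle_inv p])
      fix t1' t2' assume *: "two_step n x t1' t2'" "t2' \<circ> t1' = t2 \<circ> t1"
      then have t': "t1' \<in> reflections n" "t2' \<in> reflections n" by (auto simp: two_step_def)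
      have "t1' \<circ> t2' = t1 \<circ> t2" by (rule reverse_product[OF t t' *(2)])
      then have "(t2', t1') \<in> {(transpose L M, transpose L H), (transpose L H, transpose M H),
          (transpose M H, transpose L M)}"
        using cycle_factorizations[OF cycle_inv(2,3) t'(2,1)] p by simp
      then show "(t1', t2') \<in> {(transpose L H, transpose L M), (transpose M H, transpose L H),
          (transpose L M, transpose M H)}" by auto
    qed
  qed
qed

section \<open>The two paths of a diamond and their labels\<close>

lemma two_step_triple:
  assumes x: "x \<in> symgrp n" and o: "1 \<le> L" "L < M" "M < H" "H \<le> n"
  defines "p \<equiv> inv x"
  shows "two_step n x (transpose L M) (transpose L H) \<longleftrightarrow> p L < p M \<and> p M < p H"
    "two_step n x (transpose L H) (transpose M H) \<longleftrightarrow> p L < p H \<and> p M < p L"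
    "two_step n x (transpose M H) (transpose L M) \<longleftrightarrow> p M < p H \<and> p L < p H"
    "two_step n x (transpose L H) (transpose L M) \<longleftrightarrow> p L < p H \<and> p H < p M"
    "two_step n x (transpose M H) (transpose L H) \<longleftrightarrow> p M < p H \<and> p L < p M"
    "two_step n x (transpose L M) (transpose M H) \<longleftrightarrow> p L < p M \<and> p L < p H"
    "p L \<noteq> p M" "p L \<noteq> p H" "p M \<noteq> p H"
proof -
  show "p L \<noteq> p M" "p L \<noteq> p H" "p M \<noteq> p H"
    using o symgrp_inv[OF x] unfolding p_def symgrp_def
    by (auto dest: permutes_neq_image[of _ _ L M] permutes_neq_image[of _ _ L H] permutes_neq_image[of _ _ M H])
  have e: "transpose L M L = M" "transpose L M M = L" "transpose L M H = H"
    "transpose L H L = H" "transpose L H M = M" "transpose L H H = L"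
    "transpose M H L = L" "transpose M H M = H" "transpose M H H = M"
    using o by auto
  have i: "1 \<le> M" "M \<le> n" "L < H" using o by auto
  show "two_step n x (transpose L M) (transpose L H) \<longleftrightarrow> p L < p M \<and> p M < p H"
    "two_step n x (transpose L H) (transpose M H) \<longleftrightarrow> p L < p H \<and> p M < p L"
    "two_step n x (transpose M H) (transpose L M) \<longleftrightarrow> p M < p H \<and> p L < p H"
    "two_step n x (transpose L H) (transpose L M) \<longleftrightarrow> p L < p H \<and> p H < p M"
    "two_step n x (transpose M H) (transpose L H) \<longleftrightarrow> p M < p H \<and> p L < p M"
    "two_step n x (transpose L M) (transpose M H) \<longleftrightarrow> p L < p M \<and> p L < p H"
    using two_step_iff[OF x o(1,2) i(2) o(1) i(3) o(4)] two_step_iff[OF x o(1) i(3) o(4) i(1) o(3,4)]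
      two_step_iff[OF x i(1) o(3,4) o(1,2) i(2)] two_step_iff[OF x o(1) i(3) o(4) o(1,2) i(2)]
      two_step_iff[OF x i(1) o(3,4) o(1) i(3) o(4)] two_step_iff[OF x o(1,2) i(2) i(1) o(3,4)]
    by (simp_all only: p_def e)
qed

lemma transposes_neq:
  fixes L M H :: nat
  assumes "L < M" "M < H"
  shows "transpose L M \<noteq> transpose L H" "transpose L M \<noteq> transpose M H" "transpose L H \<noteq> transpose M H"
  using assms transpose_inject[of L M L H] transpose_inject[of L M M H] transpose_inject[of L H M H] by auto

text \<open>
  In a coset of a dihedral subgroup of type \<open>A\<^sub>2\<close>, the product of two reflections has three
  factorizations. Exactly two of them ascend from \<open>x\<close> or none does; the third listed one is
  always among them.
\<close>

lemma two_step_triple_exclusive: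
  assumes x: "x \<in> symgrp n" and o: "1 \<le> L" "L < M" "M < H" "H \<le> n"
  shows "\<not> (two_step n x (transpose L M) (transpose L H) \<and> two_step n x (transpose L H) (transpose M H))"
    "two_step n x (transpose L M) (transpose L H) \<or> two_step n x (transpose L H) (transpose M H) \<longleftrightarrow>
      two_step n x (transpose M H) (transpose L M)"
    "\<not> (two_step n x (transpose L H) (transpose L M) \<and> two_step n x (transpose M H) (transpose L H))"
    "two_step n x (transpose L H) (transpose L M) \<or> two_step n x (transpose M H) (transpose L H) \<longleftrightarrow>
      two_step n x (transpose L M) (transpose M H)"
  unfolding two_step_triple(1-6)[OF x o] using two_step_triple(7-9)[OF x o] by linarith+

text \<open>This and the next two lemmas are propositional. They abstract from permutations so that
  each serves both for a 3-cycle and for its inverse.\<close>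

lemma exclusive_triple_other:
  assumes "(t1, t2) \<in> {(A1, B1), (A2, B2), (A3, B3)}" "S t1 t2"
    and "distinct [A1, A2, A3]" "S A1 B1 \<or> S A2 B2 \<longleftrightarrow> S A3 B3"
  shows "\<exists>t1' t2'. (t1', t2') \<in> {(A1, B1), (A2, B2), (A3, B3)} \<and> S t1' t2' \<and> t1' \<noteq> t1"
  using assms by auto

lemma exclusive_triple_unique:
  assumes "(t1, t2) \<in> {(A1, B1), (A2, B2), (A3, B3)}" "S t1 t2"
    and "(t1', t2') \<in> {(A1, B1), (A2, B2), (A3, B3)}" "S t1' t2'"
    and "(t1'', t2'') \<in> {(A1, B1), (A2, B2), (A3, B3)}" "S t1'' t2''"
    and "\<not> (S A1 B1 \<and> S A2 B2)" "t1' \<noteq> t1" "t1'' \<noteq> t1"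
  shows "t1' = t1''"
  using assms by auto

text \<open>Here \<open>A\<close>, \<open>B\<close>, \<open>C\<close> stand for the transpositions
  of a triple, with \<open>B\<close> in the middle of the order. Of two distinct ascending
  factorizations one is the third listed pair, made of the extreme labels \<open>A\<close> and
  \<open>C\<close>; it runs in the opposite direction to the other two, and its labels enclose
  theirs.\<close>

lemma exclusive_triple_labels:
  fixes \<kappa> :: "'a \<Rightarrow> nat"
  assumes "(t1, t2) \<in> {(A, B), (B, C), (C, A)} \<and> (t1', t2') \<in> {(A, B), (B, C), (C, A)} \<and>
      \<not> (S A B \<and> S B C) \<or>
    (t1, t2) \<in> {(B, A), (C, B), (A, C)} \<and> (t1', t2') \<in> {(B, A), (C, B), (A, C)} \<and>
      \<not> (S B A \<and> S C B)"
    and "S t1 t2" "S t1' t2'" "t1' \<noteq> t1"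
    and "\<kappa> A < \<kappa> B \<and> \<kappa> B < \<kappa> C \<or> \<kappa> C < \<kappa> B \<and> \<kappa> B < \<kappa> A"
  shows "(\<kappa> t1 < \<kappa> t2 \<longleftrightarrow> \<kappa> t2' < \<kappa> t1') \<and> (\<kappa> t1 < \<kappa> t2 \<longrightarrow> \<kappa> t1 < \<kappa> t1' \<and> \<kappa> t2' < \<kappa> t2)"
  using assms(1)
proof
  assume "(t1, t2) \<in> {(A, B), (B, C), (C, A)} \<and> (t1', t2') \<in> {(A, B), (B, C), (C, A)} \<and>
      \<not> (S A B \<and> S B C)"
  then show ?thesis using assms(2-5) by auto
next
  assume "(t1, t2) \<in> {(B, A), (C, B), (A, C)} \<and> (t1', t2') \<in> {(B, A), (C, B), (A, C)} \<and>
      \<not> (S B A \<and> S C B)"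
  then show ?thesis using assms(2-5) by auto
qed

text \<open>The existence half of the diamond property; together with \<open>two_step_unique\<close>
  it gives each path of two steps exactly one partner with the same ends.\<close>

lemma ex_other_two_step:
  assumes x: "x \<in> symgrp n" and s: "two_step n x t1 t2"
  obtains t1' t2' where "two_step n x t1' t2'" "t2' \<circ> t1' = t2 \<circ> t1" "t1' \<noteq> t1"
  using x s
proof (cases rule: two_step_classification)
  case (disjoint a b c d)
  show ?thesis by (rule that[OF disjoint(3) disjoint(6) disjoint(4)[symmetric]])
next
  case (cycle L M H)
  have "distinct [transpose L M, transpose L H, transpose M H]"
    using transposes_neq[OF cycle(2,3)] by simp
  from exclusive_triple_other[where S = "two_step n x", OF cycle(5) s this two_step_triple_exclusive(2)[OF x cycle(1-4)]]
  obtain t1' t2' where *: "two_step n x t1' t2'" "t1' \<noteq> t1"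
    and "(t1', t2') \<in> {(transpose L M, transpose L H), (transpose L H, transpose M H),
        (transpose M H, transpose L M)}" by blast
  from cycle_products(1)[OF cycle(2,3) this(3)] show ?thesis
    using that[OF *(1) _ *(2)] cycle(6) by simp
next
  case (cycle_inv L M H)
  have t: "t1 \<in> reflections n" "t2 \<in> reflections n" using s by (auto simp: two_step_def)
  have "distinct [transpose L H, transpose M H, transpose L M]"
    using transposes_neq[OF cycle_inv(2,3)] by simp
  from exclusive_triple_other[where S = "two_step n x", OF cycle_inv(5) s this two_step_triple_exclusive(4)[OF x cycle_inv(1-4)]]
  obtain t1' t2' where *: "two_step n x t1' t2'" "t1' \<noteq> t1"
    and "(t1', t2') \<in> {(transpose L H, transpose L M), (transpose M H, transpose L H),
        (transpose L M, transpose M H)}" by blast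
  from cycle_products(2)[OF cycle_inv(2,3) this(3)] have eq: "t1' \<circ> t2' = t1 \<circ> t2"
    using cycle_inv(6) by simp
  have t': "t1' \<in> reflections n" "t2' \<in> reflections n" using *(1) by (auto simp: two_step_def)
  show ?thesis by (rule that[OF *(1) reverse_product[OF t(2,1) t'(2,1) eq] *(2)])
qed

lemma two_step_unique:
  assumes x: "x \<in> symgrp n" and s: "two_step n x t1 t2" "two_step n x t1' t2'" "two_step n x t1'' t2''"
    and eq: "t2' \<circ> t1' = t2 \<circ> t1" "t2'' \<circ> t1'' = t2 \<circ> t1" and ne: "t1' \<noteq> t1" "t1'' \<noteq> t1"
  shows "t1' = t1''"
  using x s(1)
proof (cases rule: two_step_classification)
  case (disjoint a b c d)
  then show ?thesis using disjoint(5)[OF s(2) eq(1)] disjoint(5)[OF s(3) eq(2)] ne by blast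
next
  case (cycle L M H)
  show ?thesis
    by (rule exclusive_triple_unique[where S = "two_step n x", OF cycle(5) s(1) cycle(7)[OF s(2) eq(1)] s(2)
          cycle(7)[OF s(3) eq(2)] s(3) two_step_triple_exclusive(1)[OF x cycle(1-4)] ne])
next
  case (cycle_inv L M H)
  show ?thesis
    by (rule exclusive_triple_unique[where S = "two_step n x", OF cycle_inv(5) s(1) cycle_inv(7)[OF s(2) eq(1)] s(2)
          cycle_inv(7)[OF s(3) eq(2)] s(3) two_step_triple_exclusive(3)[OF x cycle_inv(1-4)] ne])
qed

text \<open>Ranks in place of a relation, so that comparisons of labels are left to arithmetic on
  natural numbers.\<close>

definition reflection_key :: "nat \<Rightarrow> ((nat \<Rightarrow> nat) \<Rightarrow> nat) \<Rightarrow> bool" where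
  "reflection_key n \<kappa> \<longleftrightarrow> inj_on \<kappa> (reflections n) \<and>
    (\<forall>a b c. 1 \<le> a \<and> a < b \<and> b < c \<and> c \<le> n \<longrightarrow>
      \<kappa> (transpose a b) < \<kappa> (transpose a c) \<and> \<kappa> (transpose a c) < \<kappa> (transpose b c) \<or>
      \<kappa> (transpose b c) < \<kappa> (transpose a c) \<and> \<kappa> (transpose a c) < \<kappa> (transpose a b))"

text \<open>Disjoint labels are merely exchanged between the two paths; otherwise the labels form a
  triple. The second claim controls how labels change when the last two steps of a path are
  flipped.\<close>

lemma two_step_labels:
  assumes x: "x \<in> symgrp n" and \<kappa>: "reflection_key n \<kappa>"
    and s: "two_step n x t1 t2" "two_step n x t1' t2'"
    and eq: "t2' \<circ> t1' = t2 \<circ> t1" and ne: "t1' \<noteq> t1"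
  shows "\<kappa> t1 < \<kappa> t2 \<longleftrightarrow> \<kappa> t2' < \<kappa> t1'"
    and "\<kappa> t1 < \<kappa> t2 \<Longrightarrow> \<kappa> t1 < \<kappa> t1' \<and> \<kappa> t2' < \<kappa> t2"
proof -
  have K: "\<kappa> (transpose L M) < \<kappa> (transpose L H) \<and> \<kappa> (transpose L H) < \<kappa> (transpose M H) \<or>
      \<kappa> (transpose M H) < \<kappa> (transpose L H) \<and> \<kappa> (transpose L H) < \<kappa> (transpose L M)"
    if "1 \<le> L" "L < M" "M < H" "H \<le> n" for L M H
    using \<kappa> that unfolding reflection_key_def by blast
  have "(\<kappa> t1 < \<kappa> t2 \<longleftrightarrow> \<kappa> t2' < \<kappa> t1') \<and> (\<kappa> t1 < \<kappa> t2 \<longrightarrow> \<kappa> t1 < \<kappa> t1' \<and> \<kappa> t2' < \<kappa> t2)"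
    using x s(1)
  proof (cases rule: two_step_classification)
    case (disjoint a b c d)
    have "t1' = t2 \<and> t2' = t1" using disjoint(5)[OF s(2) eq] ne by blast
    then show ?thesis by simp
  next
    case (cycle L M H)
    show ?thesis
      by (rule exclusive_triple_labels[where S = "two_step n x" and \<kappa> = \<kappa>, OF disjI1 s ne K[OF cycle(1-4)]])
        (intro conjI cycle(5) cycle(7)[OF s(2) eq] two_step_triple_exclusive(1)[OF x cycle(1-4)])
  next
    case (cycle_inv L M H)
    show ?thesis
      by (rule exclusive_triple_labels[where S = "two_step n x" and \<kappa> = \<kappa>, OF disjI2 s ne K[OF cycle_inv(1-4)]])
        (intro conjI cycle_inv(5) cycle_inv(7)[OF s(2) eq]
          two_step_triple_exclusive(3)[OF x cycle_inv(1-4)])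
  qed
  then show "\<kappa> t1 < \<kappa> t2 \<longleftrightarrow> \<kappa> t2' < \<kappa> t1'"
    and "\<kappa> t1 < \<kappa> t2 \<Longrightarrow> \<kappa> t1 < \<kappa> t1' \<and> \<kappa> t2' < \<kappa> t2" by blast+
qed

section \<open>Hypercubes\<close>

definition cube_arcs :: "('a set \<Rightarrow> 'b) \<Rightarrow> 'a set \<Rightarrow> ('b \<times> 'b) set" where
  "cube_arcs g Y = {(g A, g (insert a A)) | A a. A \<subseteq> Y \<and> a \<in> Y \<and> a \<notin> A}"

text \<open>The vertices are indexed by subsets of the spanning set instead of
  \<open>{..<m}\<close>. No enumeration of the directions is chosen, and faces through the bottom
  arise by restriction.\<close>

definition cube_map :: "'a pair_pre_digraph \<Rightarrow> 'a \<Rightarrow> 'a set \<Rightarrow> ('a set \<Rightarrow> 'a) \<Rightarrow> bool" where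
  "cube_map H x Y g \<longleftrightarrow> finite Y \<and> inj_on g (Pow Y) \<and> pverts H = g ` Pow Y \<and>
     parcs H = cube_arcs g Y \<and> g {} = x \<and> (\<forall>y\<in>Y. g {y} = y)"

lemma cube_arcsE:
  assumes "(p, p') \<in> cube_arcs g Y"
  obtains A a where "p = g A" "p' = g (insert a A)" "A \<subseteq> Y" "a \<in> Y" "a \<notin> A"
  using assms by (auto simp: cube_arcs_def)

lemma cube_arcsI: "A \<subseteq> Y \<Longrightarrow> a \<in> Y \<Longrightarrow> a \<notin> A \<Longrightarrow> (g A, g (insert a A)) \<in> cube_arcs g Y"
  by (auto simp: cube_arcs_def)

text \<open>By injectivity each vertex determines its subset, and an arc only adds an
  element.\<close>

lemma cube_reachable_subset:
  assumes inj: "inj_on g (Pow Y)" and "(p, p') \<in> rtrancl_on V (cube_arcs g Y)"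
    and "p = g A" "A \<subseteq> Y"
  shows "\<exists>B\<subseteq>Y. p' = g B \<and> A \<subseteq> B"
  using assms(2)
proof (induction rule: rtrancl_on_induct)
  case base
  then show ?case using assms by blast
next
  case (step y z)
  then obtain B where B: "B \<subseteq> Y" "y = g B" "A \<subseteq> B" by blast
  obtain C a where C: "y = g C" "z = g (insert a C)" "C \<subseteq> Y" "a \<in> Y" "a \<notin> C"
    using step(2) by (rule cube_arcsE)
  have "B = C" by (rule inj_onD[OF inj]) (use B C in auto)
  then show ?case using B C by blast
qed

lemma cube_reachable:
  assumes fin: "finite Y"
  shows "A \<subseteq> B \<Longrightarrow> B \<subseteq> Y \<Longrightarrow> (g A, g B) \<in> rtrancl_on (g ` Pow Y) (cube_arcs g Y)"
proof (induction "card (B - A)" arbitrary: B)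
  case 0
  have "finite (B - A)" using fin 0 by (meson finite_Diff finite_subset)
  then have "A = B" using 0 by auto
  then show ?case using 0 by (auto intro: rtrancl_on_refl)
next
  case (Suc k)
  have finB: "finite (B - A)" using fin Suc.prems by (meson finite_Diff finite_subset)
  have "B - A \<noteq> {}" using Suc.hyps(2) by (metis card.empty nat.distinct(1))
  then obtain b where b: "b \<in> B - A" by blast
  have "(B - {b}) - A = (B - A) - {b}" by blast
  then have "k = card ((B - {b}) - A)"
    using Suc.hyps(2) card_Diff_singleton[OF b] by simp
  then have "(g A, g (B - {b})) \<in> rtrancl_on (g ` Pow Y) (cube_arcs g Y)"
    using Suc.hyps(1)[of "B - {b}"] Suc.prems b by blast
  moreover have "(g (B - {b}), g B) \<in> cube_arcs g Y"
    using cube_arcsI[of "B - {b}" Y b g] b Suc.prems by (auto simp: insert_absorb)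
  ultimately show ?case using Suc.prems by (auto intro: rtrancl_on_into_rtrancl_on)
qed

lemma boolean_hasse_simps [simp]:
  "verts (boolean_hasse m) = Pow {..<m}"
  "arcs (boolean_hasse m) = cube_arcs id {..<m}"
  "tail (boolean_hasse m) = fst" "head (boolean_hasse m) = snd"
  by (auto simp: boolean_hasse_def cube_arcs_def)

lemma spanned_cube_map:
  assumes "hypercube_spanned_by G x Y H"
  obtains g where "cube_map H x Y g"
proof -
  from assms obtain m f where bot: "is_bottom H x" and Y: "{y. (x, y) \<in> parcs H} = Y"
    and f: "pre_digraph.digraph_isomorphism (boolean_hasse m) f" "with_proj H = app_iso f (boolean_hasse m)"
    by (auto simp: hypercube_spanned_by_def hypercube_in_def digraph_iso_def)
  define \<phi> where "\<phi> = iso_verts f"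
  define M where "M = {..<m}"
  have inj: "inj_on \<phi> (Pow M)"
    using f(1) by (simp add: pre_digraph.digraph_isomorphism_def \<phi>_def M_def)
  have verts: "pverts H = \<phi> ` Pow M"
    using arg_cong[OF f(2), of verts] by (simp add: verts_app_iso \<phi>_def M_def)
  \<comment> \<open>The arcs of \<open>H\<close> are pairs of vertices, so the isomorphism acts on
    arcs as its vertex map dictates.\<close>
  have ends: "iso_arcs f e = (\<phi> (fst e), \<phi> (snd e))" if "e \<in> cube_arcs id M" for e
  proof -
    have "\<phi> (fst e) = iso_tail f (iso_arcs f e)" "\<phi> (snd e) = iso_head f (iso_arcs f e)"
      using f(1) that by (auto simp: pre_digraph.digraph_isomorphism_def \<phi>_def M_def)
    moreover have "iso_tail f = fst" "iso_head f = snd"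
      using arg_cong[OF f(2), of tail] arg_cong[OF f(2), of head] by (simp_all add: app_iso_def)
    ultimately show ?thesis by simp
  qed
  have "parcs H = iso_arcs f ` cube_arcs id M"
    using arg_cong[OF f(2), of arcs] by (simp add: arcs_app_iso M_def)
  also have "\<dots> = (\<lambda>e. (\<phi> (fst e), \<phi> (snd e))) ` cube_arcs id M"
    using ends by (rule image_cong[OF refl])
  also have "\<dots> = cube_arcs \<phi> M"
  proof (intro equalityI subsetI)
    fix e assume "e \<in> cube_arcs \<phi> M"
    then obtain A a where "A \<subseteq> M" "a \<in> M" "a \<notin> A" "e = (\<phi> A, \<phi> (insert a A))"
      by (auto simp: cube_arcs_def)
    then show "e \<in> (\<lambda>e. (\<phi> (fst e), \<phi> (snd e))) ` cube_arcs id M"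
      using cube_arcsI[of A M a id] by (intro image_eqI[of _ _ "(A, insert a A)"]) auto
  next
    fix e assume "e \<in> (\<lambda>e. (\<phi> (fst e), \<phi> (snd e))) ` cube_arcs id M"
    then obtain A a where "A \<subseteq> M" "a \<in> M" "a \<notin> A" "e = (\<phi> A, \<phi> (insert a A))"
      by (auto simp: cube_arcs_def)
    then show "e \<in> cube_arcs \<phi> M" using cube_arcsI by metis
  qed
  finally have arcs: "parcs H = cube_arcs \<phi> M" .
  \<comment> \<open>The bottom reaches \<open>\<phi> {}\<close>, so its own subset is contained in
    the empty set.\<close>
  have x: "x = \<phi> {}"
  proof -
    obtain A where A: "A \<subseteq> M" "x = \<phi> A" using bot verts by (auto simp: is_bottom_def)
    have "(x, \<phi> {}) \<in> rtrancl_on (pverts H) (parcs H)"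
      using bot verts by (auto simp: is_bottom_def reachable_def)
    from cube_reachable_subset[OF inj this[unfolded arcs] A(2,1)]
    obtain B where B: "B \<subseteq> M" "\<phi> {} = \<phi> B" "A \<subseteq> B" by blast
    have "{} = B" by (rule inj_onD[OF inj B(2)]) (use B(1) in auto)
    then have "A = {}" using B(3) by simp
    then show ?thesis using A by simp
  qed
  define e where "e = (\<lambda>i. \<phi> {i})"
  have Ye: "Y = e ` M"
  proof -
    have "(x, y) \<in> cube_arcs \<phi> M \<longleftrightarrow> y \<in> e ` M" for y
    proof
      assume "(x, y) \<in> cube_arcs \<phi> M"
      then obtain A a where *: "x = \<phi> A" "y = \<phi> (insert a A)" "A \<subseteq> M" "a \<in> M"
        by (rule cube_arcsE)
      then have "\<phi> A = \<phi> {}" using x by simp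
      then have "A = {}" by (rule inj_onD[OF inj]) (use *(3) in auto)
      then show "y \<in> e ` M" using * by (auto simp: e_def)
    next
      assume "y \<in> e ` M"
      then show "(x, y) \<in> cube_arcs \<phi> M"
        using cube_arcsI[of "{}" M _ \<phi>] by (auto simp: e_def x)
    qed
    then show ?thesis using Y arcs by auto
  qed
  have inje: "inj_on e M" using inj by (auto simp: e_def inj_on_def)
  \<comment> \<open>\<open>h\<close> turns a set of neighbours of the bottom back into a set of
    indices.\<close>
  define h where "h = (\<lambda>B. {i \<in> M. e i \<in> B})"
  have he: "h (e ` A) = A" if "A \<subseteq> M" for A
    using that inje by (auto simp: h_def dest: inj_onD)
  have eh: "e ` h B = B" if "B \<subseteq> Y" for B
    using that by (auto simp: h_def Ye)
  have hM: "h B \<subseteq> M" for B by (auto simp: h_def)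
  have hi: "h (insert (e i) B) = insert i (h B)" if "i \<in> M" for i B
    using that inje by (auto simp: h_def dest: inj_onD)
  define g where "g = (\<lambda>B. \<phi> (h B))"
  have "finite Y" by (simp add: Ye M_def)
  moreover have "inj_on g (Pow Y)"
  proof (rule inj_onI)
    fix B C assume BC: "B \<in> Pow Y" "C \<in> Pow Y" "g B = g C"
    have "h B = h C" by (rule inj_onD[OF inj]) (use BC(3) hM in \<open>auto simp: g_def\<close>)
    then show "B = C" using eh BC by (metis PowD)
  qed
  moreover have "pverts H = g ` Pow Y"
  proof -
    have "\<phi> A \<in> g ` Pow Y" if "A \<subseteq> M" for A
      using that he[OF that] Ye by (intro image_eqI[of _ _ "e ` A"]) (auto simp: g_def)
    then show ?thesis using hM by (auto simp: verts g_def)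
  qed
  moreover have "parcs H = cube_arcs g Y"
  proof -
    have "(p, p') \<in> cube_arcs \<phi> M \<longleftrightarrow> (p, p') \<in> cube_arcs g Y" for p p'
    proof
      assume "(p, p') \<in> cube_arcs \<phi> M"
      then obtain A a where *: "p = \<phi> A" "p' = \<phi> (insert a A)" "A \<subseteq> M" "a \<in> M" "a \<notin> A"
        by (rule cube_arcsE)
      have "(g (e ` A), g (insert (e a) (e ` A))) \<in> cube_arcs g Y"
        using * inje Ye by (intro cube_arcsI) (auto dest: inj_onD)
      then show "(p, p') \<in> cube_arcs g Y" using * by (simp add: g_def hi he)
    next
      assume "(p, p') \<in> cube_arcs g Y"
      then obtain B b where *: "p = g B" "p' = g (insert b B)" "B \<subseteq> Y" "b \<in> Y" "b \<notin> B"
        by (rule cube_arcsE)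
      then obtain i where i: "i \<in> M" "b = e i" using Ye by auto
      have "(\<phi> (h B), \<phi> (insert i (h B))) \<in> cube_arcs \<phi> M"
        using * i by (intro cube_arcsI) (auto simp: h_def)
      then show "(p, p') \<in> cube_arcs \<phi> M" using * i by (simp add: g_def hi)
    qed
    then show ?thesis using arcs by auto
  qed
  moreover have "g {} = x" by (simp add: g_def h_def x)
  moreover have "\<forall>y\<in>Y. g {y} = y"
  proof
    fix y assume "y \<in> Y"
    then obtain i where i: "i \<in> M" "y = e i" using Ye by auto
    then have "h {y} = {i}" using inje by (auto simp: h_def dest: inj_onD)
    then show "g {y} = y" using i by (simp add: g_def e_def)
  qed
  ultimately have "cube_map H x Y g" by (simp add: cube_map_def)
  then show ?thesis by (rule that)
qed

lemma cube_map_spanned: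
  assumes sub: "subgraph (with_proj H) G" and g: "cube_map H x Y g"
  shows "hypercube_spanned_by G x Y H"
proof -
  have fin: "finite Y" and inj: "inj_on g (Pow Y)" and verts: "pverts H = g ` Pow Y"
    and arcs: "parcs H = cube_arcs g Y" and x: "g {} = x" and sing: "\<And>y. y \<in> Y \<Longrightarrow> g {y} = y"
    using g by (auto simp: cube_map_def)
  obtain b where b: "bij_betw b {..<card Y} Y"
    using ex_bij_betw_nat_finite[OF fin] by (auto simp: atLeast0LessThan)
  define m where "m = card Y"
  define M where "M = {..<m}"
  have injb: "inj_on b M" and bM: "b ` M = Y" using b by (auto simp: bij_betw_def M_def m_def)
  define f where "f = \<lparr> iso_verts = (\<lambda>A. g (b ` A)),
    iso_arcs = (\<lambda>e. (g (b ` fst e), g (b ` snd e))), iso_head = snd, iso_tail = fst \<rparr>"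
  have inj': "inj_on (\<lambda>A. g (b ` A)) (Pow M)"
  proof (rule inj_onI)
    fix A B assume AB: "A \<in> Pow M" "B \<in> Pow M" "g (b ` A) = g (b ` B)"
    then have "b ` A = b ` B" using bM by (intro inj_onD[OF inj]) auto
    then show "A = B" using inj_on_image_eq_iff[OF injb] AB by auto
  qed
  have "wf_digraph (boolean_hasse m)"
    by unfold_locales (auto simp: cube_arcs_def)
  moreover have "inj_on (\<lambda>e. (g (b ` fst e), g (b ` snd e))) (cube_arcs id M)"
  proof (rule inj_onI)
    fix e e' assume e: "e \<in> cube_arcs id M" "e' \<in> cube_arcs id M"
      "(g (b ` fst e), g (b ` snd e)) = (g (b ` fst e'), g (b ` snd e'))"
    have "fst e \<in> Pow M" "fst e' \<in> Pow M" "snd e \<in> Pow M" "snd e' \<in> Pow M"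
      using e by (auto simp: cube_arcs_def)
    then show "e = e'" using e(3) inj_onD[OF inj'] by (intro prod_eqI) auto
  qed
  ultimately have iso: "pre_digraph.digraph_isomorphism (boolean_hasse m) f"
    using inj' by (simp add: pre_digraph.digraph_isomorphism_def f_def M_def)
  have V: "(\<lambda>A. g (b ` A)) ` Pow M = g ` Pow Y"
    using bM image_Pow_surj[of b M Y] by (simp add: image_image[symmetric])
  have A: "(\<lambda>e. (g (b ` fst e), g (b ` snd e))) ` cube_arcs id M = cube_arcs g Y"
  proof (intro equalityI subsetI)
    fix e assume "e \<in> (\<lambda>e. (g (b ` fst e), g (b ` snd e))) ` cube_arcs id M"
    then obtain A a where *: "A \<subseteq> M" "a \<in> M" "a \<notin> A" "e = (g (b ` A), g (insert (b a) (b ` A)))"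
      by (auto simp: cube_arcs_def)
    then show "e \<in> cube_arcs g Y"
      using bM injb by (auto intro!: cube_arcsI dest: inj_onD)
  next
    fix e assume "e \<in> cube_arcs g Y"
    then obtain B y where *: "e = (g B, g (insert y B))" "B \<subseteq> Y" "y \<in> Y" "y \<notin> B"
      by (auto simp: cube_arcs_def)
    obtain a where a: "a \<in> M" "y = b a" using * bM by auto
    obtain A where A: "A \<subseteq> M" "B = b ` A" using *(2) bM by (metis subset_image_iff)
    have "(A, insert a A) \<in> cube_arcs id M"
      using cube_arcsI[of A M a id] A a * by auto
    then show "e \<in> (\<lambda>e. (g (b ` fst e), g (b ` snd e))) ` cube_arcs id M"
      using * a A by (intro image_eqI[of _ _ "(A, insert a A)"]) auto
  qed
  have "with_proj H = app_iso f (boolean_hasse m)"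
    using V A by (simp add: app_iso_def with_proj_def f_def verts arcs M_def)
  then have "hypercube_in G m H"
    using sub iso by (auto simp: hypercube_in_def digraph_iso_def)
  moreover have "is_bottom H x"
    unfolding is_bottom_def reachable_def
    using cube_reachable[OF fin, of "{}" _ g] by (auto simp: verts arcs x[symmetric])
  moreover have "{y. (x, y) \<in> parcs H} = Y"
  proof (intro equalityI subsetI CollectI)
    fix y assume "y \<in> {y. (x, y) \<in> parcs H}"
    then have "(x, y) \<in> cube_arcs g Y" by (simp add: arcs)
    then obtain A a where *: "x = g A" "y = g (insert a A)" "A \<subseteq> Y" "a \<in> Y" by (rule cube_arcsE)
    then have "g A = g {}" using x by simp
    then have "A = {}" by (rule inj_onD[OF inj]) (use *(3) in auto)
    then show "y \<in> Y" using * sing by simp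
  next
    fix y assume "y \<in> Y"
    then show "(x, y) \<in> parcs H" using cube_arcsI[of "{}" Y y g] x sing by (simp add: arcs)
  qed
  ultimately show ?thesis by (auto simp: hypercube_spanned_by_def)
qed

lemma cube_map_top:
  assumes "cube_map H x Y g"
  shows "is_top H w \<longleftrightarrow> w = g Y"
proof -
  have fin: "finite Y" and inj: "inj_on g (Pow Y)" and verts: "pverts H = g ` Pow Y"
    and arcs: "parcs H = cube_arcs g Y"
    using assms by (auto simp: cube_map_def)
  have "is_top H (g Y)"
    unfolding is_top_def reachable_def
    using cube_reachable[OF fin, of _ Y g] by (auto simp: verts arcs)
  moreover have "w = g Y" if "is_top H w"
  proof -
    have "(g Y, w) \<in> rtrancl_on (pverts H) (cube_arcs g Y)"
      using that by (auto simp: is_top_def reachable_def verts arcs)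
    from cube_reachable_subset[OF inj this refl subset_refl]
    obtain B where "B \<subseteq> Y" "w = g B" "Y \<subseteq> B" by blast
    then show ?thesis by (simp add: subset_antisym)
  qed
  ultimately show ?thesis by blast
qed

lemma cube_map_restrict:
  assumes sub: "subgraph (with_proj H) G" and g: "cube_map H x Y g" and Z: "Z \<subseteq> Y"
  defines "H' \<equiv> \<lparr> pverts = g ` Pow Z, parcs = cube_arcs g Z \<rparr>"
  shows "subgraph (with_proj H') G" "cube_map H' x Z g"
proof -
  have fin: "finite Y" and inj: "inj_on g (Pow Y)" and verts: "pverts H = g ` Pow Y"
    and arcs: "parcs H = cube_arcs g Y" and x: "g {} = x" and sing: "\<forall>y\<in>Y. g {y} = y"
    using g by (auto simp: cube_map_def)
  have wf: "wf_digraph (with_proj H')"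
    by unfold_locales (auto simp: H'_def cube_arcs_def)
  have sa: "cube_arcs g Z \<subseteq> cube_arcs g Y" using Z by (auto simp: cube_arcs_def)
  show "subgraph (with_proj H') G"
    using sub wf sa Z verts arcs
    by (auto simp: subgraph_def compatible_def H'_def)
  show "cube_map H' x Z g"
    using Z fin inj x sing by (auto simp: cube_map_def H'_def intro: finite_subset inj_on_subset)
qed

section \<open>The map theta as coordinates of a cube\<close>

lemma theta_eq:
  assumes "subgraph (with_proj H) (interval_graph n u v)" "cube_map H x Y g"
    and "\<exists>!H. hypercube_spanned_by (interval_graph n u v) x Y H"
  shows "theta n u v x Y = g Y"
proof -
  have 1: "(THE H. hypercube_spanned_by (interval_graph n u v) x Y H) = H"
    using cube_map_spanned[OF assms(1,2)] assms(3) by (rule the1_equality[rotated])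
  show ?thesis
    unfolding theta_def 1 by (rule the_equality) (simp_all add: cube_map_top[OF assms(2)])
qed

lemma antichains_subset: "Y \<in> antichains n u v I x \<Longrightarrow> Z \<subseteq> Y \<Longrightarrow> Z \<in> antichains n u v I x"
  by (auto simp: antichains_def)

text \<open>Each face through the bottom of the cube spanned by \<open>Y\<close> is a cube spanned
  by a subset of \<open>Y\<close>. By uniqueness it is the one that defines \<open>theta\<close>
  there, so on \<open>Pow Y\<close> the map \<open>theta\<close> is the coordinate map of a single
  cube.\<close>

lemma theta_cube:
  assumes cl: "hypercube_cluster n u v I x" and Y: "Y \<in> antichains n u v I x"
  shows "inj_on (theta n u v x) (Pow Y)" "theta n u v x {} = x"
    "y \<in> Y \<Longrightarrow> theta n u v x {y} = y"
    "A \<subseteq> Y \<Longrightarrow> a \<in> Y \<Longrightarrow> a \<notin> A \<Longrightarrow>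
      theta n u v x A \<rightarrow>\<^bsub>interval_graph n u v\<^esub> theta n u v x (insert a A)"
    "finite Y"
proof -
  define \<theta> where "\<theta> = theta n u v x"
  obtain H where H: "hypercube_spanned_by (interval_graph n u v) x Y H"
    using cl Y by (auto simp: hypercube_cluster_def)
  obtain g where g: "cube_map H x Y g" using H by (rule spanned_cube_map)
  have sub: "subgraph (with_proj H) (interval_graph n u v)"
    using H by (auto simp: hypercube_spanned_by_def hypercube_in_def)
  have \<theta>: "\<theta> Z = g Z" if "Z \<subseteq> Y" for Z
    unfolding \<theta>_def
    using cube_map_restrict[OF sub g that] cl antichains_subset[OF Y that]
    by (intro theta_eq) (auto simp: hypercube_cluster_def)
  have fin: "finite Y" and inj: "inj_on g (Pow Y)"
    and arcs: "parcs H = cube_arcs g Y" and x: "g {} = x" and sing: "\<forall>y\<in>Y. g {y} = y"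
    using g by (auto simp: cube_map_def)
  have "inj_on \<theta> (Pow Y)"
    using inj \<theta> by (simp add: inj_on_def)
  moreover have "\<theta> {} = x" "\<And>y. y \<in> Y \<Longrightarrow> \<theta> {y} = y"
    using \<theta> x sing by auto
  moreover have "\<theta> A \<rightarrow>\<^bsub>interval_graph n u v\<^esub> \<theta> (insert a A)" if "A \<subseteq> Y" "a \<in> Y" "a \<notin> A" for A a
  proof -
    have "(g A, g (insert a A)) \<in> arcs_ends (with_proj H)"
      using cube_arcsI[OF that] by (simp add: arcs)
    then show ?thesis
      using pre_digraph.adj_mono[OF _ sub] \<theta> that by simp
  qed
  ultimately show "inj_on (theta n u v x) (Pow Y)" "theta n u v x {} = x"
    "y \<in> Y \<Longrightarrow> theta n u v x {y} = y"
    "A \<subseteq> Y \<Longrightarrow> a \<in> Y \<Longrightarrow> a \<notin> A \<Longrightarrow>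
      theta n u v x A \<rightarrow>\<^bsub>interval_graph n u v\<^esub> theta n u v x (insert a A)"
    "finite Y"
    using fin unfolding \<theta>_def by auto
qed

section \<open>Strong clusters\<close>

abbreviation label_key :: "((nat \<Rightarrow> nat) \<Rightarrow> nat) \<Rightarrow> (nat \<Rightarrow> nat) \<Rightarrow> (nat \<Rightarrow> nat) \<Rightarrow> nat" where
  "label_key \<kappa> p m \<equiv> \<kappa> (edge_label p m)"

section \<open>Diamonds in terms of vertices\<close>

lemma arcs_two_step:
  assumes "p \<rightarrow>\<^bsub>bruhat_graph n\<^esub> m" "m \<rightarrow>\<^bsub>bruhat_graph n\<^esub> z"
  shows "two_step n p (edge_label p m) (edge_label m z)"
    "edge_label m z \<circ> edge_label p m = z \<circ> inv p"
proof -
  note D = bruhat_arcD[OF assms(1)] and D' = bruhat_arcD[OF assms(2)]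
  show "two_step n p (edge_label p m) (edge_label m z)"
    unfolding two_step_def using D(3,5) D'(3,5) D(4) by simp
  have "z = edge_label m z \<circ> edge_label p m \<circ> p"
    using D(4) D'(4) by (metis comp_assoc)
  then show "edge_label m z \<circ> edge_label p m = z \<circ> inv p"
    using reflection_comp_inv[OF D(1)] by metis
qed

lemma two_step_arcs:
  assumes p: "p \<in> symgrp n" and s: "two_step n p t1 t2"
  shows "p \<rightarrow>\<^bsub>bruhat_graph n\<^esub> (t1 \<circ> p)" "(t1 \<circ> p) \<rightarrow>\<^bsub>bruhat_graph n\<^esub> (t2 \<circ> (t1 \<circ> p))"
    "edge_label p (t1 \<circ> p) = t1"
proof -
  have t: "t1 \<in> reflections n" "t2 \<in> reflections n" "ascends n p t1" "ascends n (t1 \<circ> p) t2"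
    using s by (auto simp: two_step_def)
  show "p \<rightarrow>\<^bsub>bruhat_graph n\<^esub> (t1 \<circ> p)" "edge_label p (t1 \<circ> p) = t1"
    using bruhat_arcI[OF p t(1,3)] .
  show "(t1 \<circ> p) \<rightarrow>\<^bsub>bruhat_graph n\<^esub> (t2 \<circ> (t1 \<circ> p))"
    using bruhat_arcI(1)[OF symgrp_comp[OF reflections_symgrp[OF t(1)] p] t(2,4)] .
qed

lemma edge_label_inject:
  assumes "p \<rightarrow>\<^bsub>bruhat_graph n\<^esub> m" "p \<rightarrow>\<^bsub>bruhat_graph n\<^esub> m'"
  shows "edge_label p m = edge_label p m' \<longleftrightarrow> m = m'"
  using bruhat_arcD(4)[OF assms(1)] bruhat_arcD(4)[OF assms(2)] by metis

lemma edge_label_inject_left: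
  assumes "m \<rightarrow>\<^bsub>bruhat_graph n\<^esub> z" "m' \<rightarrow>\<^bsub>bruhat_graph n\<^esub> z"
  shows "edge_label m z = edge_label m' z \<longleftrightarrow> m = m'"
proof
  assume "edge_label m z = edge_label m' z"
  then show "m = m'"
    using bruhat_arcD(3,4)[OF assms(1)] bruhat_arcD(3,4)[OF assms(2)] by (metis reflections_cancel)
qed simp

lemma diamond_labels:
  assumes \<kappa>: "reflection_key n \<kappa>" and ne: "m \<noteq> m'"
    and m: "p \<rightarrow>\<^bsub>bruhat_graph n\<^esub> m" "m \<rightarrow>\<^bsub>bruhat_graph n\<^esub> z"
    and m': "p \<rightarrow>\<^bsub>bruhat_graph n\<^esub> m'" "m' \<rightarrow>\<^bsub>bruhat_graph n\<^esub> z"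
  shows "label_key \<kappa> p m < label_key \<kappa> m z \<longleftrightarrow> label_key \<kappa> m' z < label_key \<kappa> p m'"
    "label_key \<kappa> p m < label_key \<kappa> m z \<Longrightarrow>
      label_key \<kappa> p m < label_key \<kappa> p m' \<and> label_key \<kappa> m' z < label_key \<kappa> m z"
proof -
  have eq: "edge_label m' z \<circ> edge_label p m' = edge_label m z \<circ> edge_label p m"
    using arcs_two_step(2)[OF m] arcs_two_step(2)[OF m'] by simp
  have "edge_label p m' \<noteq> edge_label p m" using edge_label_inject[OF m'(1) m(1)] ne by simp
  note L = two_step_labels[OF bruhat_arcD(1)[OF m(1)] \<kappa> arcs_two_step(1)[OF m] arcs_two_step(1)[OF m'] eq this]
  show "label_key \<kappa> p m < label_key \<kappa> m z \<longleftrightarrow> label_key \<kappa> m' z < label_key \<kappa> p m'"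
    "label_key \<kappa> p m < label_key \<kappa> m z \<Longrightarrow>
      label_key \<kappa> p m < label_key \<kappa> p m' \<and> label_key \<kappa> m' z < label_key \<kappa> m z"
    using L by blast+
qed

lemma ex_diamond:
  assumes m: "p \<rightarrow>\<^bsub>bruhat_graph n\<^esub> m" "m \<rightarrow>\<^bsub>bruhat_graph n\<^esub> z"
  obtains m' where "m' \<noteq> m" "p \<rightarrow>\<^bsub>bruhat_graph n\<^esub> m'" "m' \<rightarrow>\<^bsub>bruhat_graph n\<^esub> z"
proof -
  have p: "p \<in> symgrp n" using bruhat_arcD(1)[OF m(1)] .
  obtain t1 t2 where t: "two_step n p t1 t2" "t2 \<circ> t1 = edge_label m z \<circ> edge_label p m"
    "t1 \<noteq> edge_label p m"
    using ex_other_two_step[OF p arcs_two_step(1)[OF m]] by blast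
  have "t2 \<circ> (t1 \<circ> p) = edge_label m z \<circ> edge_label p m \<circ> p"
    using t(2) by (simp add: comp_assoc[symmetric])
  also have "\<dots> = z"
    using bruhat_arcD(4)[OF m(1)] bruhat_arcD(4)[OF m(2)] by (simp add: comp_assoc)
  finally have z: "t2 \<circ> (t1 \<circ> p) = z" .
  note A = two_step_arcs[OF p t(1), unfolded z]
  have "t1 \<circ> p \<noteq> m" using A(3) t(3) by auto
  then show ?thesis using that A(1,2) by blast
qed

lemma diamond_unique:
  assumes m: "p \<rightarrow>\<^bsub>bruhat_graph n\<^esub> m" "m \<rightarrow>\<^bsub>bruhat_graph n\<^esub> z"
    and m': "p \<rightarrow>\<^bsub>bruhat_graph n\<^esub> m'" "m' \<rightarrow>\<^bsub>bruhat_graph n\<^esub> z" "m' \<noteq> m"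
    and m'': "p \<rightarrow>\<^bsub>bruhat_graph n\<^esub> m''" "m'' \<rightarrow>\<^bsub>bruhat_graph n\<^esub> z" "m'' \<noteq> m"
  shows "m' = m''"
proof -
  have "edge_label p m' = edge_label p m''"
    by (rule two_step_unique[OF bruhat_arcD(1)[OF m(1)] arcs_two_step(1)[OF m]
          arcs_two_step(1)[OF m'(1,2)] arcs_two_step(1)[OF m''(1,2)]])
      (use m m' m'' in \<open>simp_all add: arcs_two_step(2) edge_label_inject\<close>)
  then show ?thesis using edge_label_inject[OF m'(1) m''(1)] by simp
qed

lemma interval_arc_iff:
  "p \<rightarrow>\<^bsub>interval_graph n u v\<^esub> p' \<longleftrightarrow>
    p \<in> interval n u v \<and> p' \<in> interval n u v \<and> p \<rightarrow>\<^bsub>bruhat_graph n\<^esub> p'"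
  by (auto simp: interval_graph_def bruhat_graph_def arcs_ends_conv)

lemma ex_reflection_key:
  assumes r: "reflection_order n r"
  obtains \<kappa> :: "(nat \<Rightarrow> nat) \<Rightarrow> nat" where
    "\<And>s t. s \<in> reflections n \<Longrightarrow> t \<in> reflections n \<Longrightarrow> (s, t) \<in> r \<longleftrightarrow> \<kappa> s < \<kappa> t"
proof -
  note D = reflection_orderD[OF r]
  \<comment> \<open>The rank of a reflection is the number of its predecessors.\<close>
  define \<kappa> where "\<kappa> = (\<lambda>t. card {s. (s, t) \<in> r})"
  have fin: "finite {s. (s, t) \<in> r}" for t
    using D(3) by (auto intro!: finite_subset[OF _ finite_reflections[of n]])
  have mono: "\<kappa> s < \<kappa> t" if "(s, t) \<in> r" for s t
    unfolding \<kappa>_def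
  proof (rule psubset_card_mono[OF fin])
    show "{s'. (s', s) \<in> r} \<subset> {s. (s, t) \<in> r}"
      using that D(1,2) by (auto dest: transD)
  qed
  have "(s, t) \<in> r \<longleftrightarrow> \<kappa> s < \<kappa> t" if "s \<in> reflections n" "t \<in> reflections n" for s t
    using mono[of s t] mono[of t s] D(4)[OF that] by (metis less_asym less_irrefl)
  then show ?thesis using that by blast
qed

text \<open>The cancellation has already consumed property (E); all that is kept of it is
  \<open>exit\<close>, which starts the inductions at the edges from \<open>x\<close>.\<close>

locale cluster_with_order =
  fixes n :: nat and u v x :: "nat \<Rightarrow> nat" and I :: "(nat \<Rightarrow> nat) set"
    and r :: "(nat \<Rightarrow> nat) rel" and \<kappa> :: "(nat \<Rightarrow> nat) \<Rightarrow> nat" and as bs :: "(nat \<Rightarrow> nat) list"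
  assumes ideal: "order_ideal n u v I" and x: "x \<in> I"
    and cluster: "hypercube_cluster n u v I x" and strong: "strong_cluster n u v I x"
    and ts: "reflection_list n r (as @ bs)"
    and \<kappa>: "\<And>s t. s \<in> reflections n \<Longrightarrow> t \<in> reflections n \<Longrightarrow> (s, t) \<in> r \<longleftrightarrow> \<kappa> s < \<kappa> t"
    and exit: "\<And>y. x \<rightarrow>\<^bsub>bruhat_graph n\<^esub> y \<Longrightarrow> y \<in> interval n x v \<Longrightarrow> edge_label x y \<in> set bs \<longleftrightarrow> y \<notin> I"
begin

abbreviation "R \<equiv> reflections n"
abbreviation "\<A> \<equiv> antichains n u v I x"
abbreviation "\<theta> \<equiv> theta n u v x"
abbreviation arc (infix "\<leadsto>" 50) where "p \<leadsto> p' \<equiv> p \<rightarrow>\<^bsub>bruhat_graph n\<^esub> p'"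

text \<open>Labels are read at the edges into the top, because the inductions remove the last step
  of a path and this step is one of these edges.\<close>

definition L :: "(nat \<Rightarrow> nat) set \<Rightarrow> (nat \<Rightarrow> nat) \<Rightarrow> nat \<Rightarrow> nat" where
  "L Y a = edge_label (\<theta> (Y - {a})) (\<theta> Y)"

lemma order: "reflection_order n r"
  using ts by (simp add: reflection_list_def)

lemma set_ts: "set as \<union> set bs = R"
  using ts by (auto simp: reflection_list_def)

lemma sorted_ts: "sorted_wrt (\<lambda>s t. (s, t) \<in> r) (as @ bs)"
  using ts by (simp add: reflection_list_def)

lemma inj_\<kappa>: "inj_on \<kappa> R"
proof (rule inj_onI)
  fix s t assume "s \<in> R" "t \<in> R" "\<kappa> s = \<kappa> t"
  then show "s = t" using \<kappa> reflection_orderD(4)[OF order] by (metis less_irrefl)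
qed

lemma key: "reflection_key n \<kappa>"
  unfolding reflection_key_def
proof (intro conjI allI impI inj_\<kappa>)
  fix a b c assume *: "1 \<le> a \<and> a < b \<and> b < c \<and> c \<le> n"
  then have R: "transpose a b \<in> R" "transpose a c \<in> R" "transpose b c \<in> R"
    by (auto intro!: transpose_in_reflections)
  show "\<kappa> (transpose a b) < \<kappa> (transpose a c) \<and> \<kappa> (transpose a c) < \<kappa> (transpose b c) \<or>
      \<kappa> (transpose b c) < \<kappa> (transpose a c) \<and> \<kappa> (transpose a c) < \<kappa> (transpose a b)"
    using reflection_order_triple[OF order, of a b c] * \<kappa>[OF R(1,2)] \<kappa>[OF R(2,3)] \<kappa>[OF R(3,2)] \<kappa>[OF R(2,1)]
    by blast
qed

lemma bs_up: "t \<in> set bs \<Longrightarrow> s \<in> R \<Longrightarrow> \<kappa> t < \<kappa> s \<Longrightarrow> s \<in> set bs"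
proof (rule ccontr)
  assume *: "t \<in> set bs" "s \<in> R" "\<kappa> t < \<kappa> s" "s \<notin> set bs"
  then have "s \<in> set as" using set_ts by blast
  then have "(s, t) \<in> r" using sorted_ts * by (auto simp: sorted_wrt_append)
  then show False using \<kappa>[of s t] * set_ts by auto
qed

lemma finite_\<A>: "finite \<A>"
proof (rule finite_subset)
  show "\<A> \<subseteq> Pow (interval n u v)" by (auto simp: antichains_def out_nbrs_def)
  show "finite (Pow (interval n u v))" using finite_interval by simp
qed

lemmas \<theta>_inj = theta_cube(1)[OF cluster]
  and \<theta>_sing = theta_cube(3)[OF cluster]
  and \<theta>_arc_interval = theta_cube(4)[OF cluster]
  and \<A>_finite = theta_cube(5)[OF cluster]

lemma empty_\<A>: "{} \<in> \<A>" by (simp add: antichains_def)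

lemma \<theta>_empty: "\<theta> {} = x" using theta_cube(2)[OF cluster empty_\<A>] .

lemma \<theta>_arc: "Y \<in> \<A> \<Longrightarrow> A \<subseteq> Y \<Longrightarrow> a \<in> Y \<Longrightarrow> a \<notin> A \<Longrightarrow> \<theta> A \<leadsto> \<theta> (insert a A)"
  using \<theta>_arc_interval[of Y A a] by (simp add: interval_arc_iff)

lemma \<theta>_arc_minus:
  assumes "Y \<in> \<A>" "a \<in> Y" shows "\<theta> (Y - {a}) \<leadsto> \<theta> Y"
proof -
  have "insert a (Y - {a}) = Y" using assms(2) by blast
  moreover have "\<theta> (Y - {a}) \<leadsto> \<theta> (insert a (Y - {a}))"
    by (rule \<theta>_arc[OF assms(1)]) (use assms(2) in auto)
  ultimately show ?thesis by (simp only:)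
qed

lemma \<theta>_eqD: "Y \<in> \<A> \<Longrightarrow> A \<subseteq> Y \<Longrightarrow> B \<subseteq> Y \<Longrightarrow> \<theta> A = \<theta> B \<Longrightarrow> A = B"
  using inj_onD[OF \<theta>_inj, of Y A B] by simp

lemma x_interval: "x \<in> interval n u v" "x \<in> interval n x v" "x \<in> symgrp n"
proof -
  show 1: "x \<in> interval n u v" using ideal x by (auto simp: order_ideal_def)
  then show 2: "x \<in> symgrp n" using bruhat_leD(2) by (auto simp: interval_iff)
  show "x \<in> interval n x v" using 1 bruhat_le_refl[OF 2] by (auto simp: interval_iff)
qed

lemma interval_x_u: "w \<in> interval n x v \<Longrightarrow> w \<in> interval n u v"
  using x_interval(1) bruhat_le_trans by (auto simp: interval_iff)

lemma \<theta>_interval: "Y \<in> \<A> \<Longrightarrow> \<theta> Y \<in> interval n x v"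
proof (induction "card Y" arbitrary: Y)
  case 0
  then have "Y = {}" using \<A>_finite by auto
  then show ?case using \<theta>_empty x_interval by simp
next
  case (Suc k)
  then obtain a where a: "a \<in> Y" by (metis card.empty equals0I nat.distinct(1))
  have Ya: "Y - {a} \<in> \<A>" using antichains_subset[OF Suc.prems] by blast
  have "card (Y - {a}) = k" using Suc.hyps(2) card_Diff_singleton[OF a] by simp
  then have "bruhat_le n x (\<theta> (Y - {a}))" using Suc.hyps(1)[OF _ Ya] by (simp add: interval_iff)
  moreover have "bruhat_le n (\<theta> (Y - {a})) (\<theta> Y)"
    using bruhat_le_arc[OF \<theta>_arc_minus[OF Suc.prems a]] .
  moreover have "\<theta> Y \<in> interval n u v"
  proof -
    have "\<theta> (Y - {a}) \<rightarrow>\<^bsub>interval_graph n u v\<^esub> \<theta> (insert a (Y - {a}))"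
      by (rule \<theta>_arc_interval[OF Suc.prems]) (use a in auto)
    then show ?thesis using a by (simp add: interval_arc_iff insert_absorb)
  qed
  ultimately show ?case using bruhat_le_trans by (auto simp: interval_iff)
qed

lemma L_R: "Y \<in> \<A> \<Longrightarrow> a \<in> Y \<Longrightarrow> L Y a \<in> R"
  unfolding L_def by (rule bruhat_arcD(3)[OF \<theta>_arc_minus])

lemma \<theta>_L: "Y \<in> \<A> \<Longrightarrow> a \<in> Y \<Longrightarrow> \<theta> Y = L Y a \<circ> \<theta> (Y - {a})"
  unfolding L_def by (rule bruhat_arcD(4)[OF \<theta>_arc_minus])

lemma L_inject:
  assumes "Y \<in> \<A>" "a \<in> Y" "b \<in> Y" "L Y a = L Y b" shows "a = b"
proof -
  have "\<theta> (Y - {a}) = \<theta> (Y - {b})"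
    using edge_label_inject_left[OF \<theta>_arc_minus[OF assms(1,2)] \<theta>_arc_minus[OF assms(1,3)]] assms(4)
    by (simp add: L_def)
  then have "Y - {a} = Y - {b}" using \<theta>_eqD[OF assms(1)] by blast
  then show ?thesis using assms by blast
qed

lemma \<kappa>_L_inject:
  assumes "Y \<in> \<A>" "a \<in> Y" "b \<in> Y" "\<kappa> (L Y a) = \<kappa> (L Y b)" shows "a = b"
  using L_inject[OF assms(1-3)] inj_onD[OF inj_\<kappa>, of "L Y a" "L Y b"] L_R assms by simp

text \<open>The tops over \<open>Y\<close>, \<open>Y - {a}\<close>, \<open>Y - {b}\<close> and
  \<open>Y - {a} - {b}\<close> form a diamond, and its increasing side ends with the larger of the
  two labels at the top.\<close>

lemma diamond_in_cube:
  assumes Y: "Y \<in> \<A>" and ab: "a \<in> Y" "b \<in> Y" "a \<noteq> b"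
  shows "\<kappa> (L Y b) < \<kappa> (L Y a) \<longleftrightarrow> \<kappa> (L (Y - {a}) b) < \<kappa> (L Y a)"
proof -
  define p where "p = \<theta> (Y - {a} - {b})"
  have sub: "Y - {a} \<in> \<A>" "Y - {b} \<in> \<A>" using antichains_subset[OF Y] by blast+
  have sw: "Y - {b} - {a} = Y - {a} - {b}" by blast
  have arcs: "p \<leadsto> \<theta> (Y - {a})" "p \<leadsto> \<theta> (Y - {b})"
    using \<theta>_arc_minus[OF sub(1), of b] \<theta>_arc_minus[OF sub(2), of a] ab by (simp_all add: p_def sw)
  note tops = \<theta>_arc_minus[OF Y ab(1)] \<theta>_arc_minus[OF Y ab(2)]
  have ne: "\<theta> (Y - {a}) \<noteq> \<theta> (Y - {b})" using \<theta>_eqD[OF Y, of "Y - {a}" "Y - {b}"] ab by blast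
  have labels: "edge_label p (\<theta> (Y - {a})) = L (Y - {a}) b" "edge_label p (\<theta> (Y - {b})) = L (Y - {b}) a"
    "edge_label (\<theta> (Y - {a})) (\<theta> Y) = L Y a" "edge_label (\<theta> (Y - {b})) (\<theta> Y) = L Y b"
    by (simp_all add: L_def p_def sw)
  note D1 = diamond_labels[OF key ne arcs(1) tops(1) arcs(2) tops(2), unfolded labels]
  note D2 = diamond_labels[OF key ne[symmetric] arcs(2) tops(2) arcs(1) tops(1), unfolded labels]
  have "L (Y - {a}) b \<noteq> L Y a"
    using two_step_neq[OF bruhat_arcD(1)[OF arcs(1)] arcs_two_step(1)[OF arcs(1) tops(1)]] by (simp add: labels)
  then have "\<kappa> (L (Y - {a}) b) \<noteq> \<kappa> (L Y a)"
    using inj_onD[OF inj_\<kappa>, of "L (Y - {a}) b" "L Y a"] L_R[OF Y ab(1)] L_R[OF sub(1), of b] ab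
    by auto
  then show ?thesis using D1 D2 by (metis less_asym linorder_neqE_nat)
qed

text \<open>Iterating this criterion singles out one increasing path from the bottom of the cube to
  its top: the one that always descends along the largest label.\<close>

lemma max_label_remove:
  assumes Y: "Y \<in> \<A>" "a \<in> Y"
  shows "(\<forall>b\<in>Y - {a}. \<kappa> (L Y b) < \<kappa> (L Y a)) \<longleftrightarrow> (\<forall>b\<in>Y - {a}. \<kappa> (L (Y - {a}) b) < \<kappa> (L Y a))"
  using diamond_in_cube[OF Y(1) Y(2)] by auto

lemma ex_max_label:
  assumes Y: "Y \<in> \<A>" "Y \<noteq> {}"
  obtains a where "a \<in> Y" "\<forall>b\<in>Y - {a}. \<kappa> (L Y b) < \<kappa> (L Y a)"
proof -
  have fin: "finite ((\<lambda>b. \<kappa> (L Y b)) ` Y)" using \<A>_finite[OF Y(1)] by simp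
  then have "Max ((\<lambda>b. \<kappa> (L Y b)) ` Y) \<in> (\<lambda>b. \<kappa> (L Y b)) ` Y" using Y by (intro Max_in) auto
  then obtain a where a: "a \<in> Y" "\<kappa> (L Y a) = Max ((\<lambda>b. \<kappa> (L Y b)) ` Y)" by auto
  have "\<kappa> (L Y b) < \<kappa> (L Y a)" if "b \<in> Y - {a}" for b
  proof -
    have "\<kappa> (L Y b) \<le> \<kappa> (L Y a)" using that a(2) fin by (simp add: Max_ge)
    moreover have "\<kappa> (L Y b) \<noteq> \<kappa> (L Y a)" using \<kappa>_L_inject[OF Y(1)] that a(1) by blast
    ultimately show ?thesis by simp
  qed
  then show ?thesis using that a(1) by blast
qed

text \<open>Descend along the largest labels to a single edge from \<open>x\<close> into the
  antichain. It leaves the ideal, so its label is in the final segment \<open>bs\<close>, and the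
  labels grow on the way up.\<close>

lemma max_label_exits:
  "Y \<in> \<A> \<Longrightarrow> a \<in> Y \<Longrightarrow> \<forall>b\<in>Y - {a}. \<kappa> (L Y b) < \<kappa> (L Y a) \<Longrightarrow> L Y a \<in> set bs"
proof (induction "card Y" arbitrary: Y a)
  case 0
  then show ?case using \<A>_finite by auto
next
  case (Suc k)
  have Ya: "Y - {a} \<in> \<A>" using antichains_subset[OF Suc.prems(1)] by blast
  show ?case
  proof (cases "Y - {a} = {}")
    case True
    then have Y: "Y = {a}" using Suc.prems by blast
    have "a \<in> out_nbrs n u v I x" using Suc.prems by (auto simp: antichains_def)
    then have a: "a \<notin> I" "x \<leadsto> a" by (auto simp: out_nbrs_def)
    have "\<theta> {a} = a" using \<theta>_sing[OF Suc.prems(1,2)] .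
    then have "L Y a = edge_label x a" "a \<in> interval n x v"
      using \<theta>_empty \<theta>_interval[OF Suc.prems(1)] by (simp_all add: Y L_def)
    then show ?thesis using exit[OF a(2)] a(1) by simp
  next
    case False
    obtain b where b: "b \<in> Y - {a}" "\<forall>c\<in>Y - {a} - {b}. \<kappa> (L (Y - {a}) c) < \<kappa> (L (Y - {a}) b)"
      by (rule ex_max_label[OF Ya False])
    have "card (Y - {a}) = k" using Suc.hyps(2) card_Diff_singleton[OF Suc.prems(2)] by simp
    then have "L (Y - {a}) b \<in> set bs" using Suc.hyps(1)[OF _ Ya b] by simp
    moreover have "\<kappa> (L (Y - {a}) b) < \<kappa> (L Y a)"
      using max_label_remove[OF Suc.prems(1,2)] Suc.prems(3) b(1) by blast
    ultimately show ?thesis using bs_up L_R[OF Suc.prems(1,2)] by blast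
  qed
qed

lemma singleton_\<A>:
  assumes "x \<leadsto> w" "w \<in> interval n x v" "w \<notin> I"
  shows "{w} \<in> \<A>"
  using assms interval_x_u by (auto simp: antichains_def out_nbrs_def)

text \<open>Here strongness enters. With \<open>Z\<close> the set \<open>Y\<close> without its
  direction of largest label, flipping the path from \<open>\<theta> Z\<close> through
  \<open>\<theta> Y\<close> to \<open>w\<close> gives a vertex \<open>m\<close>, which by induction
  is the top of a cube on \<open>insert a Z\<close>. Now \<open>Y\<close> and
  \<open>insert a Z\<close> have equal size and intersection \<open>Z\<close>, and \<open>w\<close>
  lies above both tops.\<close>

lemma ex_extension:
  "Y \<in> \<A> \<Longrightarrow> \<theta> Y \<leadsto> w \<Longrightarrow> w \<in> interval n x v \<Longrightarrow> edge_label (\<theta> Y) w \<in> set bs \<Longrightarrow>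
    \<forall>b\<in>Y. \<kappa> (L Y b) < label_key \<kappa> (\<theta> Y) w \<Longrightarrow>
    \<exists>a. a \<notin> Y \<and> insert a Y \<in> \<A> \<and> \<theta> (insert a Y) = w"
proof (induction "card Y" arbitrary: Y w)
  case 0
  then have Y: "Y = {}" using \<A>_finite by auto
  have "w \<notin> I" using exit[of w] 0 by (simp add: Y \<theta>_empty)
  then have "{w} \<in> \<A>" using singleton_\<A> 0 by (simp add: Y \<theta>_empty)
  then show ?case using \<theta>_sing[of "{w}" w] by (auto simp: Y)
next
  case (Suc k)
  have "Y \<noteq> {}" using Suc.hyps(2) by auto
  then obtain b where b: "b \<in> Y" "\<forall>c\<in>Y - {b}. \<kappa> (L Y c) < \<kappa> (L Y b)"
    using ex_max_label[OF Suc.prems(1)] by blast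
  define Z where "Z = Y - {b}"
  have Z: "Z \<in> \<A>" "b \<notin> Z" "insert b Z = Y" "Z \<subseteq> Y"
    using antichains_subset[OF Suc.prems(1), of Z] b by (auto simp: Z_def)
  have cardZ: "card Z = k" using Suc.hyps(2) card_Diff_singleton[OF b(1)] by (simp add: Z_def)
  have p: "\<theta> Z \<leadsto> \<theta> Y" using \<theta>_arc_minus[OF Suc.prems(1) b(1)] by (simp add: Z_def)
  have lb: "label_key \<kappa> (\<theta> Z) (\<theta> Y) = \<kappa> (L Y b)" by (simp add: L_def Z_def)
  obtain m where m: "m \<noteq> \<theta> Y" "\<theta> Z \<leadsto> m" "m \<leadsto> w" by (rule ex_diamond[OF p Suc.prems(2)])
  have "label_key \<kappa> (\<theta> Z) (\<theta> Y) < label_key \<kappa> (\<theta> Y) w" using Suc.prems(5) b(1) lb by simp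
  \<comment> \<open>The flipped side of the diamond starts with a larger label than the increasing
    side. It therefore still lies in \<open>bs\<close> and above all labels at the top of
    \<open>Z\<close>, as the induction hypothesis requires.\<close>
  then have gt: "\<kappa> (L Y b) < label_key \<kappa> (\<theta> Z) m"
    using diamond_labels(2)[OF key m(1)[symmetric] p Suc.prems(2) m(2,3)] lb by simp
  have mI: "m \<in> interval n x v"
    using \<theta>_interval[OF Z(1)] Suc.prems(3) bruhat_le_arc[OF m(2)] bruhat_le_arc[OF m(3)] bruhat_le_trans
    unfolding interval_iff by blast
  have "L Y b \<in> set bs" by (rule max_label_exits[OF Suc.prems(1) b])
  then have mbs: "edge_label (\<theta> Z) m \<in> set bs" using bs_up gt bruhat_arcD(3)[OF m(2)] by blast
  have "\<forall>c\<in>Z. \<kappa> (L Z c) < \<kappa> (L Y b)"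
    using max_label_remove[OF Suc.prems(1) b(1)] b(2) by (simp add: Z_def)
  then have "\<forall>c\<in>Z. \<kappa> (L Z c) < label_key \<kappa> (\<theta> Z) m" using gt by auto
  from Suc.hyps(1)[OF cardZ[symmetric] Z(1) m(2) mI mbs this]
  obtain a where a: "a \<notin> Z" "insert a Z \<in> \<A>" "\<theta> (insert a Z) = m" by blast
  have ab: "a \<noteq> b" using a(3) m(1) Z(3) by auto
  have fin: "finite Z" using \<A>_finite[OF Z(1)] .
  have int: "Y \<inter> insert a Z = Z" using Z a ab by blast
  have card: "card Y = card (insert a Z)" "card (insert a Z) = card (Y \<inter> insert a Z) + 1"
    using fin Z(2,3) a(1) int by (auto simp flip: Z(3))
  have I: "\<theta> Z \<in> interval n u v" "\<theta> Y \<in> interval n u v" "m \<in> interval n u v" "w \<in> interval n u v"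
    using \<theta>_interval[OF Z(1)] \<theta>_interval[OF Suc.prems(1)] mI Suc.prems(3) interval_x_u by blast+
  have "Y \<union> insert a Z \<in> \<A> \<and> \<theta> (Y \<union> insert a Z) = w"
    using strong[unfolded strong_cluster_def, rule_format, OF Suc.prems(1) a(2), of w]
      card p m(2,3) Suc.prems(2) I a(3) int by (simp add: interval_arc_iff)
  moreover have "Y \<union> insert a Z = insert a Y" using Z by blast
  moreover have "a \<notin> Y" using a(1) ab Z(3) by blast
  ultimately show ?case by auto
qed

text \<open>Remove a common direction \<open>b\<close>. Both extensions then complete the same path,
  through the tops of \<open>Z\<close> and \<open>Y\<close> to the common top, to a diamond, and its
  fourth vertex is unique.\<close>

lemma extension_unique:
  "insert a Y \<in> \<A> \<Longrightarrow> insert a' Y \<in> \<A> \<Longrightarrow> a \<notin> Y \<Longrightarrow> a' \<notin> Y \<Longrightarrow>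
    \<theta> (insert a Y) = \<theta> (insert a' Y) \<Longrightarrow> a = a'"
proof (induction "card Y" arbitrary: Y)
  case 0
  have "finite Y" using \<A>_finite[OF 0(2)] by simp
  then have "Y = {}" using 0 by simp
  then show ?case using 0 \<theta>_sing[of "{a}" a] \<theta>_sing[of "{a'}" a'] by simp
next
  case (Suc k)
  then obtain b where b: "b \<in> Y" by (metis card.empty equals0I nat.distinct(1))
  define Z where "Z = Y - {b}"
  have Y: "Y = insert b Z" "b \<notin> Z" using b by (auto simp: Z_def)
  have cardZ: "card Z = k" using Suc.hyps(2) card_Diff_singleton[OF b] by (simp add: Z_def)
  have sub: "insert c Z \<in> \<A>" "Y \<in> \<A>" "\<theta> Z \<leadsto> \<theta> Y" "\<theta> Y \<leadsto> \<theta> (insert c Y)"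
    "\<theta> Z \<leadsto> \<theta> (insert c Z)" "\<theta> (insert c Z) \<leadsto> \<theta> (insert c Y)" "\<theta> (insert c Z) \<noteq> \<theta> Y"
    if c: "insert c Y \<in> \<A>" "c \<notin> Y" for c
  proof -
    show "insert c Z \<in> \<A>" by (rule antichains_subset[OF c(1)]) (auto simp: Z_def)
    show "Y \<in> \<A>" by (rule antichains_subset[OF c(1)]) auto
    show "\<theta> Z \<leadsto> \<theta> Y" using \<theta>_arc[OF c(1), of Z b] Y by auto
    show "\<theta> Y \<leadsto> \<theta> (insert c Y)" using \<theta>_arc[OF c(1), of Y c] c by auto
    show "\<theta> Z \<leadsto> \<theta> (insert c Z)" using \<theta>_arc[OF c(1), of Z c] c Y by auto
    have "insert b (insert c Z) = insert c Y" using Y by blast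
    then show "\<theta> (insert c Z) \<leadsto> \<theta> (insert c Y)"
      using \<theta>_arc[OF c(1), of "insert c Z" b] c Y by auto
    show "\<theta> (insert c Z) \<noteq> \<theta> Y"
      using \<theta>_eqD[OF c(1), of "insert c Z" Y] c Y by blast
  qed
  note s = sub[OF Suc.prems(1,3)] and s' = sub[OF Suc.prems(2,4)]
  have "\<theta> (insert a Z) = \<theta> (insert a' Z)"
    by (rule diamond_unique[OF s(3,4) s(5,6,7) s'(5) _ s'(7)]) (use s'(6) Suc.prems(5) in simp)
  then show ?case
    using Suc.hyps(1)[OF cardZ[symmetric] s(1) s'(1)] Suc.prems(3,4) by (auto simp: Z_def)
qed

lemma incp_prefix:
  "bs = cs @ ds \<Longrightarrow> w \<in> interval n x v \<Longrightarrow>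
    incp n cs x w = (\<Sum>Y\<in>{Y \<in> \<A>. \<theta> Y = w \<and> (\<forall>a\<in>Y. L Y a \<in> set as \<union> set cs)}. monom 1 (card Y))"
proof (induction cs arbitrary: ds w rule: rev_induct)
  case Nil
  \<comment> \<open>With no label of \<open>bs\<close> available only the empty antichain counts: a
    nonempty one has its largest label in \<open>bs\<close>.\<close>
  have "{Y \<in> \<A>. \<theta> Y = w \<and> (\<forall>a\<in>Y. L Y a \<in> set as)} = (if x = w then {{}} else {})"
  proof -
    have "Y = {}" if Y: "Y \<in> \<A>" "\<forall>a\<in>Y. L Y a \<in> set as" for Y
    proof (rule ccontr)
      assume "Y \<noteq> {}"
      then obtain a where a: "a \<in> Y" "\<forall>b\<in>Y - {a}. \<kappa> (L Y b) < \<kappa> (L Y a)"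
        using ex_max_label[OF Y(1)] by blast
      have "L Y a \<in> set bs" by (rule max_label_exits[OF Y(1) a])
      moreover have "L Y a \<in> set as" using Y(2) a(1) by blast
      ultimately have "(L Y a, L Y a) \<in> r" using sorted_ts by (auto simp: sorted_wrt_append)
      then show False using reflection_orderD(2)[OF order] by blast
    qed
    then have "Y \<in> \<A> \<and> \<theta> Y = w \<and> (\<forall>a\<in>Y. L Y a \<in> set as) \<longleftrightarrow> Y = {} \<and> x = w" for Y
      using empty_\<A> \<theta>_empty by (metis empty_iff)
    then show ?thesis by simp
  qed
  then show ?case by simp
next
  case (snoc t cs)
  have bs: "bs = cs @ t # ds" using snoc.prems by simp
  have t: "t \<in> R" and csR: "set cs \<subseteq> R" using set_ts bs by auto
  have w: "w \<in> symgrp n" using snoc.prems(2) bruhat_leD(1) by (auto simp: interval_iff)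
  have tw: "t \<circ> w \<in> symgrp n" using symgrp_comp[OF reflections_symgrp[OF t] w] .
  have mem: "s \<in> set as \<union> set cs \<longleftrightarrow> \<kappa> s < \<kappa> t" if s: "s \<in> R" for s
  proof
    assume "s \<in> set as \<union> set cs"
    then have "(s, t) \<in> r" using sorted_ts bs by (auto simp: sorted_wrt_append)
    then show "\<kappa> s < \<kappa> t" using \<kappa> s t by simp
  next
    assume lt: "\<kappa> s < \<kappa> t"
    show "s \<in> set as \<union> set cs"
    proof (rule ccontr)
      assume "s \<notin> set as \<union> set cs"
      then have "s = t \<or> s \<in> set ds" using s set_ts bs by auto
      then have "s = t \<or> (t, s) \<in> r" using sorted_ts bs by (auto simp: sorted_wrt_append)
      then show False using lt \<kappa>[OF t s] by auto
    qed
  qed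
  define S where "S = (\<lambda>w. {Y \<in> \<A>. \<theta> Y = w \<and> (\<forall>a\<in>Y. \<kappa> (L Y a) < \<kappa> t)})"
  \<comment> \<open>\<open>B\<close> collects the antichains with largest label \<open>t\<close>.
    Deleting that direction will match them with \<open>S (t \<circ> w)\<close>, which accounts for
    the paths whose last label is \<open>t\<close>.\<close>
  define B where "B = {Y \<in> \<A>. \<theta> Y = w \<and> (\<exists>a\<in>Y. L Y a = t \<and> (\<forall>b\<in>Y - {a}. \<kappa> (L Y b) < \<kappa> (L Y a)))}"
  have S_eq: "{Y \<in> \<A>. \<theta> Y = w \<and> (\<forall>a\<in>Y. L Y a \<in> set as \<union> set cs)} = S w" for w
    unfolding S_def using mem L_R by blast
  have split: "{Y \<in> \<A>. \<theta> Y = w \<and> (\<forall>a\<in>Y. L Y a \<in> set as \<union> set (cs @ [t]))} = S w \<union> B"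
  proof (intro equalityI subsetI)
    fix Y assume "Y \<in> {Y \<in> \<A>. \<theta> Y = w \<and> (\<forall>a\<in>Y. L Y a \<in> set as \<union> set (cs @ [t]))}"
    then have Y: "Y \<in> \<A>" "\<theta> Y = w" "\<And>a. a \<in> Y \<Longrightarrow> L Y a = t \<or> \<kappa> (L Y a) < \<kappa> t"
      using mem L_R by auto
    show "Y \<in> S w \<union> B"
    proof (cases "\<exists>a\<in>Y. L Y a = t")
      case True
      then obtain a where a: "a \<in> Y" "L Y a = t" by blast
      have "\<kappa> (L Y b) < \<kappa> (L Y a)" if "b \<in> Y - {a}" for b
        using Y(3)[of b] L_inject[OF Y(1) _ a(1), of b] a that by auto
      then show ?thesis using a Y by (auto simp: B_def)
    next
      case False
      then show ?thesis using Y by (auto simp: S_def)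
    qed
  next
    fix Y assume "Y \<in> S w \<union> B"
    then show "Y \<in> {Y \<in> \<A>. \<theta> Y = w \<and> (\<forall>a\<in>Y. L Y a \<in> set as \<union> set (cs @ [t]))}"
    proof
      assume "Y \<in> S w"
      then have Y: "Y \<in> \<A>" "\<theta> Y = w" "\<And>a. a \<in> Y \<Longrightarrow> \<kappa> (L Y a) < \<kappa> t" by (auto simp: S_def)
      have "L Y a \<in> set as \<union> set cs" if "a \<in> Y" for a
        using mem[OF L_R[OF Y(1) that]] Y(3)[OF that] by blast
      then show ?thesis using Y(1,2) by auto
    next
      assume "Y \<in> B"
      then obtain a where Y: "Y \<in> \<A>" "\<theta> Y = w" "a \<in> Y" "L Y a = t"
        "\<And>b. b \<in> Y \<Longrightarrow> b \<noteq> a \<Longrightarrow> \<kappa> (L Y b) < \<kappa> t" by (auto simp: B_def)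
      have "L Y b \<in> set as \<union> set (cs @ [t])" if "b \<in> Y" for b
        using mem[OF L_R[OF Y(1) that]] Y(4,5) that by (cases "b = a") auto
      then show ?thesis using Y(1,2) by blast
    qed
  qed
  have disj: "S w \<inter> B = {}" by (auto simp: S_def B_def)
  have fin: "finite (S w)" "finite B" for w using finite_\<A> by (auto simp: S_def B_def)
  have Bsum: "(\<Sum>Y\<in>B. monom 1 (card Y)) =
    (if len n (t \<circ> w) < len n w then q * incp n cs x (t \<circ> w) else 0)"
  proof (cases "len n (t \<circ> w) < len n w")
    case False
    have "B = {}"
    proof (rule ccontr)
      assume "B \<noteq> {}"
      then obtain Y a where Y: "Y \<in> \<A>" "\<theta> Y = w" "a \<in> Y" "L Y a = t" by (auto simp: B_def)
      have "t \<circ> w = \<theta> (Y - {a})" using \<theta>_L[OF Y(1,3)] Y(2,4) reflections_cancel[OF t] by simp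
      then show False using bruhat_arcD(6)[OF \<theta>_arc_minus[OF Y(1,3)]] Y(2) False by simp
    qed
    then show ?thesis using False by simp
  next
    case True
    have up: "(t \<circ> w) \<leadsto> w" "edge_label (t \<circ> w) w = t"
      using bruhat_arcI[OF tw t] True unfolding reflections_cancel[OF t] by blast+
    \<comment> \<open>The direction to delete is described by its label, which determines it by
      \<open>L_inject\<close>; so \<open>f\<close> involves no choice.\<close>
    define f where "f = (\<lambda>Y. {b \<in> Y. L Y b \<noteq> t})"
    have f: "f Y = Y - {a}" if "Y \<in> \<A>" "a \<in> Y" "L Y a = t" for Y a
      using that L_inject by (auto simp: f_def)
    have inj: "inj_on f B"
    proof (rule inj_onI)
      fix Y Y' assume YY: "Y \<in> B" "Y' \<in> B" "f Y = f Y'"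
      obtain a where a: "Y \<in> \<A>" "\<theta> Y = w" "a \<in> Y" "L Y a = t" using YY(1) by (auto simp: B_def)
      obtain a' where a': "Y' \<in> \<A>" "\<theta> Y' = w" "a' \<in> Y'" "L Y' a' = t" using YY(2) by (auto simp: B_def)
      define Z where "Z = Y - {a}"
      have Z: "Z = Y' - {a'}" using YY(3) f[OF a(1,3,4)] f[OF a'(1,3,4)] by (simp add: Z_def)
      have Y: "insert a Z = Y" "a \<notin> Z" using a(3) by (auto simp: Z_def)
      have Y': "insert a' Z = Y'" "a' \<notin> Z" using a'(3) by (auto simp: Z)
      have "a = a'" using extension_unique[of a Z a'] a(1,2) a'(1,2) Y Y' by simp
      then show "Y = Y'" using Y Y' by simp
    qed
    have image: "f ` B = S (t \<circ> w)"
    proof (intro equalityI subsetI)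
      fix Z assume "Z \<in> f ` B"
      then obtain Y a where Y: "Y \<in> \<A>" "\<theta> Y = w" "a \<in> Y" "L Y a = t"
        "\<forall>b\<in>Y - {a}. \<kappa> (L Y b) < \<kappa> (L Y a)" "Z = f Y" by (auto simp: B_def)
      have Z: "Z = Y - {a}" using f Y by simp
      have "t \<circ> w = \<theta> Z" using \<theta>_L[OF Y(1,3)] Y(2,4) reflections_cancel[OF t] by (simp add: Z)
      moreover have "Z \<in> \<A>" using antichains_subset[OF Y(1)] Z by blast
      moreover have "\<forall>b\<in>Z. \<kappa> (L Z b) < \<kappa> t"
        using max_label_remove[OF Y(1,3)] Y(4,5) Z by simp
      ultimately show "Z \<in> S (t \<circ> w)" by (simp add: S_def)
    next
      \<comment> \<open>Surjectivity is the extension property for the edge from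
        \<open>t \<circ> w\<close> to \<open>w\<close>; its label \<open>t\<close> exceeds all
        labels at the top of \<open>Z\<close>.\<close>
      fix Z assume "Z \<in> S (t \<circ> w)"
      then have Z: "Z \<in> \<A>" "\<theta> Z = t \<circ> w" "\<forall>b\<in>Z. \<kappa> (L Z b) < \<kappa> t" by (auto simp: S_def)
      have "\<exists>a. a \<notin> Z \<and> insert a Z \<in> \<A> \<and> \<theta> (insert a Z) = w"
        by (rule ex_extension[OF Z(1)]) (use Z up snoc.prems(2) bs in simp_all)
      then obtain a where a: "a \<notin> Z" "insert a Z \<in> \<A>" "\<theta> (insert a Z) = w" by blast
      have Za: "insert a Z - {a} = Z" using a(1) by simp
      have La: "L (insert a Z) a = t" using Za a(3) Z(2) up(2) by (simp add: L_def)
      have "\<forall>b\<in>insert a Z - {a}. \<kappa> (L (insert a Z) b) < \<kappa> (L (insert a Z) a)"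
        using max_label_remove[OF a(2), of a] Z(3) La Za by simp
      then have "insert a Z \<in> B" using a La by (auto simp: B_def)
      moreover have "f (insert a Z) = Z" using f[OF a(2) _ La] Za by simp
      ultimately show "Z \<in> f ` B" by (metis imageI)
    qed
    have "bij_betw f B (S (t \<circ> w))" using inj image by (simp add: bij_betw_def)
    then have "(\<Sum>Z\<in>S (t \<circ> w). q * monom 1 (card Z)) = (\<Sum>Y\<in>B. q * monom 1 (card (f Y)))"
      by (rule sum.reindex_bij_betw[symmetric])
    also have "\<dots> = (\<Sum>Y\<in>B. monom 1 (card Y))"
    proof (rule sum.cong[OF refl])
      fix Y assume "Y \<in> B"
      then obtain a where Y: "Y \<in> \<A>" "a \<in> Y" "L Y a = t" by (auto simp: B_def)
      have "card Y = Suc (card (f Y))"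
        using f[OF Y] card.remove[OF \<A>_finite[OF Y(1)] Y(2)] by simp
      then show "q * monom 1 (card (f Y)) = (monom 1 (card Y) :: int poly)"
        by (simp add: monom_Suc)
    qed
    finally have B_S: "(\<Sum>Y\<in>B. monom 1 (card Y)) = q * (\<Sum>Z\<in>S (t \<circ> w). monom 1 (card Z))"
      by (simp only: sum_distrib_left)
    \<comment> \<open>The induction hypothesis only covers the interval above \<open>x\<close>. If
      \<open>t \<circ> w\<close> is outside it, there are neither paths nor cubes ending
      there.\<close>
    have "incp n cs x (t \<circ> w) = (\<Sum>Z\<in>S (t \<circ> w). monom 1 (card Z))"
    proof (cases "bruhat_le n x (t \<circ> w)")
      case True
      have "bruhat_le n (t \<circ> w) v"
        using bruhat_le_arc[OF up(1)] snoc.prems(2) bruhat_le_trans unfolding interval_iff by blast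
      then have "t \<circ> w \<in> interval n x v" using True by (simp add: interval_iff)
      from snoc.IH[OF bs this] show ?thesis by (simp only: S_eq)
    next
      case False
      have "incp n cs x (t \<circ> w) = 0" using incp_bruhat_le[OF csR x_interval(3)] False by blast
      moreover have "\<theta> Y \<noteq> t \<circ> w" if "Y \<in> \<A>" for Y
        using \<theta>_interval[OF that] False unfolding interval_iff by metis
      then have "S (t \<circ> w) = {}" by (simp add: S_def) blast
      ultimately show ?thesis by simp
    qed
    then show ?thesis using B_S True by (simp only: if_True)
  qed
  have "incp n (cs @ [t]) x w = incp n cs x w +
      (if len n (t \<circ> w) < len n w then q * incp n cs x (t \<circ> w) else 0)"
    by (rule incp_append[OF csR t x_interval(3) w])
  also have "\<dots> = (\<Sum>Y\<in>S w. monom 1 (card Y)) + (\<Sum>Y\<in>B. monom 1 (card Y))"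
    using snoc.IH[OF bs snoc.prems(2)] Bsum by (simp only: S_eq)
  also have "\<dots> = (\<Sum>Y\<in>S w \<union> B. monom 1 (card Y))"
    using sum.union_disjoint[OF fin disj] by metis
  finally have "incp n (cs @ [t]) x w =
    (\<Sum>Y\<in>{Y \<in> \<A>. \<theta> Y = w \<and> (\<forall>a\<in>Y. L Y a \<in> set as \<union> set (cs @ [t]))}. monom 1 (card Y))"
    by (simp only: split)
  then show ?case .
qed

lemma incp_cluster: "incp n bs x v = (\<Sum>Y\<in>{Y \<in> \<A>. \<theta> Y = v}. monom 1 (card Y))"
proof -
  have v: "v \<in> interval n x v"
    using x_interval(1) bruhat_leD(2) bruhat_le_refl by (auto simp: interval_iff)
  have "{Y \<in> \<A>. \<theta> Y = v \<and> (\<forall>a\<in>Y. L Y a \<in> set as \<union> set bs)} = {Y \<in> \<A>. \<theta> Y = v}"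
    using set_ts L_R by blast
  then show ?thesis using incp_prefix[of bs "[]", OF _ v] by simp
qed

end

theorem theorem3p7:
  fixes n :: nat and u v x :: "nat \<Rightarrow> nat" and I :: "(nat \<Rightarrow> nat) set"
  assumes "u \<in> symgrp n" and "v \<in> symgrp n" and "bruhat_le n u v"
    and "order_ideal n u v I"
    and "diamond_closed n u v I"
    and "x \<in> I"
    and "hypercube_cluster n u v I x"
    and "strong_cluster n u v I x"
    and "property_E n v I x"
  shows "Rt_rel n x v (I \<inter> interval n x v) =
         (\<Sum>Y\<in>{Y \<in> antichains n u v I x. theta n u v x Y = v}. monom 1 (card Y))"
proof -
  obtain r where r: "reflection_order n r"
    and E: "\<forall>x1\<in>I \<inter> interval n x v. \<forall>x2\<in>I \<inter> interval n x v. \<forall>x3\<in>I \<inter> interval n x v.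
        \<forall>y\<in>interval n x v - I.
          x1 \<rightarrow>\<^bsub>bruhat_graph n\<^esub> x2 \<and> x3 \<rightarrow>\<^bsub>bruhat_graph n\<^esub> y \<longrightarrow>
          (edge_label x1 x2, edge_label x3 y) \<in> r"
    using assms(9) unfolding property_E_def by blast
  obtain ts where ts: "reflection_list n r ts" using ex_reflection_list[OF r] by blast
  obtain \<kappa> :: "(nat \<Rightarrow> nat) \<Rightarrow> nat" where
    \<kappa>: "\<And>s t. s \<in> reflections n \<Longrightarrow> t \<in> reflections n \<Longrightarrow> (s, t) \<in> r \<longleftrightarrow> \<kappa> s < \<kappa> t"
    using ex_reflection_key[OF r] by blast
  obtain as bs where asbs: "ts = as @ bs" "Rt_rel n x v (I \<inter> interval n x v) = incp n bs x v"
    and exit: "\<And>y. x \<rightarrow>\<^bsub>bruhat_graph n\<^esub> y \<Longrightarrow> y \<in> interval n x v \<Longrightarrow>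
      edge_label x y \<in> set bs \<longleftrightarrow> y \<notin> I"
    by (rule Rt_rel_eq_incp[OF assms(4,6) ts]) (use E in blast)+
  interpret cluster_with_order n u v x I r \<kappa> as bs
    using assms ts \<kappa> exit asbs(1) by unfold_locales auto
  show ?thesis using asbs(2) incp_cluster by simp
qed

end
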